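(* Let $n\ge2$, let $H=-\Delta+|x|^2$ on $L^2(\mathbb{R}^n)$, and let $2\le p\le\frac{2n}{n-2}$ with $(n,p)\ne(2,\infty)$ (where $\frac{2n}{n-2}=\infty$ if $n=2$). There is a constant $C$ depending only on $n$ and $p$ such that for every $k$ in the spectrum of $H$ and every $\phi\in L^2(\mathbb{R}^n)$, $$\|P_k\phi\|_{L^p(\mathbb{R}^n)}\le C\|\phi\|_{L^2(\mathbb{R}^n)}.$$
   Context: The spectrum of $H$ is $\{n+2m: m=0,1,2,\dots\}$, and for $k$ in the spectrum, $P_k$ denotes the $L^2$-orthogonal projector onto the eigenspace $\ker(H-k)$. *)

theory Defs
  imports "HOL-Analysis.Analysis" "HOL-Probability.Essential_Supremum"
begin

(* Elements of L^p(R^n) are represented by Borel functions R^n -> C.  Every class modulo null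
   sets has such a representative, and equality of classes is written "AE x in lborel". *)

(* The L^p norm with values in [0,\<infinity>]; an inequality with a finite right-hand side
   therefore includes membership in L^p. *)
definition Lp_norm :: "ereal \<Rightarrow> (real^'n::finite \<Rightarrow> complex) \<Rightarrow> ennreal" where
  "Lp_norm p f =
     (if p = \<infinity> then esssup lborel (\<lambda>x. ennreal (norm (f x)))
      else (let r = real_of_ereal p;
                I = (\<integral>\<^sup>+x. ennreal (norm (f x) powr r) \<partial>lborel)
            in if I = \<infinity> then \<infinity> else ennreal (enn2real I powr (1 / r))))"

definition L2 :: "(real^'n::finite \<Rightarrow> complex) set" where
  "L2 = {f \<in> borel_measurable lborel. integrable lborel (\<lambda>x. (norm (f x))\<^sup>2)}"

definition L2_inner :: "(real^'n::finite \<Rightarrow> complex) \<Rightarrow> (real^'n \<Rightarrow> complex) \<Rightarrow> complex" where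
  "L2_inner f g = (\<integral>x. f x * cnj (g x) \<partial>lborel)"

definition partial :: "'n \<Rightarrow> (real^'n::finite \<Rightarrow> complex) \<Rightarrow> real^'n \<Rightarrow> complex" where
  "partial i f x = frechet_derivative f (at x) (axis i 1)"

definition partials :: "'n list \<Rightarrow> (real^'n::finite \<Rightarrow> complex) \<Rightarrow> real^'n \<Rightarrow> complex" where
  "partials is f = foldr partial is f"

(* Differentiability of all iterated partial derivatives at every point is C^\<infinity>
   smoothness; boundedness against all powers of 1 + |x| is the usual decay condition. *)
definition schwartz :: "(real^'n::finite \<Rightarrow> complex) set" where
  "schwartz = {\<psi>. \<forall>is. (\<forall>x. partials is \<psi> differentiable (at x)) \<and>
     (\<forall>N::nat. bounded (range (\<lambda>x. (1 + norm x) ^ N *\<^sub>R partials is \<psi> x)))}"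

definition laplacian :: "(real^'n::finite \<Rightarrow> complex) \<Rightarrow> real^'n \<Rightarrow> complex" where
  "laplacian \<psi> x = (\<Sum>i\<in>UNIV. partial i (partial i \<psi>) x)"

(* The graph of H = -\<Delta> + |x|^2 as an (unbounded, self-adjoint) operator on L^2:
   H u = f in the sense of tempered distributions, with domain all u in L^2 whose
   distributional image H u lies in L^2. *)
definition hermite_op :: "(real^'n::finite \<Rightarrow> complex) \<Rightarrow> (real^'n \<Rightarrow> complex) \<Rightarrow> bool" where
  "hermite_op u f \<longleftrightarrow> u \<in> L2 \<and> f \<in> L2 \<and>
     (\<forall>\<psi>\<in>schwartz.
        (\<integral>x. u x * (- laplacian \<psi> x + of_real ((norm x)\<^sup>2) * \<psi> x) \<partial>lborel) =
        (\<integral>x. f x * \<psi> x \<partial>lborel))"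

(* The resolvent set: H - k maps its domain bijectively onto L^2 with bounded inverse. *)
definition hermite_resolvent_set :: "'n::finite itself \<Rightarrow> complex set" where
  "hermite_resolvent_set _ = {k.
     (\<forall>f\<in>L2. \<exists>u::real^'n \<Rightarrow> complex. hermite_op u (\<lambda>x. f x + k * u x)) \<and>
     (\<forall>u::real^'n \<Rightarrow> complex. hermite_op u (\<lambda>x. k * u x) \<longrightarrow> (AE x in lborel. u x = 0)) \<and>
     (\<exists>B::real. \<forall>(u::real^'n \<Rightarrow> complex) f.
        f \<in> L2 \<longrightarrow> hermite_op u (\<lambda>x. f x + k * u x) \<longrightarrow> Lp_norm 2 u \<le> ennreal B * Lp_norm 2 f)}"

definition hermite_spectrum :: "'n::finite itself \<Rightarrow> complex set" where
  "hermite_spectrum T = - hermite_resolvent_set T"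

definition hermite_eigenspace :: "complex \<Rightarrow> (real^'n::finite \<Rightarrow> complex) set" where
  "hermite_eigenspace k = {u. hermite_op u (\<lambda>x. k * u x)}"

(* A representative of the L^2-orthogonal projection of \<phi> onto ker (H - k); it is unique
   up to a null set. *)
definition hermite_proj :: "complex \<Rightarrow> (real^'n::finite \<Rightarrow> complex) \<Rightarrow> real^'n \<Rightarrow> complex" where
  "hermite_proj k \<phi> = (SOME u. u \<in> hermite_eigenspace k \<and>
     (\<forall>v\<in>hermite_eigenspace k. L2_inner (\<lambda>x. \<phi> x - u x) v = 0))"

end

theory Submission
  imports Defs "HOL-Complex_Analysis.Complex_Analysis" "HOL-Probability.Sinc_Integral"
begin

text \<open>
  For complex \<open>r\<close> in the unit disc let \<open>U r\<close> be the operator whose kernel is Mehler's kernel, the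
  generating function of the spectral projections: on the eigenspace of \<open>n + 2 m\<close> it is multiplication
  by \<open>r ^ m\<close>. This follows from the equation \<open>H N = 2 r \<partial>N/\<partial>r + n N\<close> of the kernel \<open>N\<close> alone, which forces
  the pairing of an eigenfunction with \<open>N\<close> to be a monomial in \<open>r\<close>, together with the convergence
  \<open>U r \<rightarrow> id\<close> as \<open>r \<rightarrow> 1\<close>. The kernel satisfies the semigroup law \<open>U r U s = U (r s)\<close>, so the \<open>L\<^sup>2\<close> bound of
  \<open>U r\<close> reduces to Schur's test for the positive kernel at \<open>\<bar>r\<bar>\<^sup>2\<close>, and it satisfies the dispersive bound
  \<open>\<bar>N\<bar> \<le> (\<pi> \<bar>1 - r\<^sup>2\<bar>) powr (-n/2)\<close>.

  An eigenfunction \<open>u\<close> is tested against \<open>f\<close> through an average \<open>V f\<close> of rotated \<open>U r f\<close> over points \<open>r\<close> on a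
  short arc close to the unit circle, and \<open>V\<^sup>* V\<close> is estimated on pairs of functions supported on level
  sets of \<open>u\<close>. Times at distance less than \<open>\<delta>\<close> are treated by the \<open>T T\<^sup>*\<close> argument for one of the two
  functions, the others by the dispersive bound. Optimizing \<open>\<delta>\<close> gives decay in the ratio of the
  measures of the two level sets, which makes the sum over all pairs converge at the endpoint exponent.
  The exponent \<open>p\<close> enters as the endpoint for the decay rate \<open>\<sigma> = p / (p - 2) \<ge> n / 2\<close>, so no
  interpolation is needed.
\<close>

section \<open>Square integrable functions, parameter integrals and Gaussians\<close>

text \<open>Interpolating the dispersive bound \<open>t powr - \<sigma>\<close> with the square
  integrable bound leaves the power \<open>- (\<sigma> * (1 - 2 / p))\<close> of the time
  difference, which for \<open>\<sigma> = p / (p - 2)\<close> is exactly -1. Summing this over times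
  diverges logarithmically: that is the obstacle at the endpoint. For functions living on sets of
  different measures the two bounds cross at different times, and a cut chosen between these times
  gains a power of the ratio of the measures.

  The constant is uniform in the eigenvalue because \<open>U r\<close> only multiplies an
  eigenfunction by \<open>r ^ m\<close>. Phases in the average undo the rotation, so all sample
  points contribute the same pairing and an arc of fixed length serves every \<open>m\<close>.

  The kernel is an absolutely convergent object only inside the disc, so the arc has a radius below
  1. The radius is chosen from \<open>m\<close> and the number of points from the measures of the
  level sets of \<open>u\<close>; neither choice enters the constant. The condition \<sigma> > 1,
  which makes the tails in time summable, expresses that \<open>p\<close> is finite.\<close>

definition l2norm :: "(real^'n::finite \<Rightarrow> complex) \<Rightarrow> real" where
  "l2norm f = sqrt (LBINT x. (norm (f x))\<^sup>2)"

lemma L2_measurable: "f \<in> L2 \<Longrightarrow> f \<in> borel_measurable borel"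
  by (simp add: L2_def)

lemma L2_square_integrable: "f \<in> L2 \<Longrightarrow> integrable lborel (\<lambda>x. (norm (f x))\<^sup>2)"
  by (simp add: L2_def)

lemma L2_dominated:
  assumes "f \<in> borel_measurable lborel" "integrable lborel g" "\<And>x. (norm (f x))\<^sup>2 \<le> g x"
  shows "f \<in> L2"
  unfolding L2_def using assms
  by (auto intro!: Bochner_Integration.integrable_bound[OF assms(2)] AE_I2 order_trans[OF assms(3)])

lemma L2_add: assumes "f \<in> L2" "g \<in> L2" shows "(\<lambda>x. f x + g x) \<in> L2"
proof (rule L2_dominated)
  show "(\<lambda>x. f x + g x) \<in> borel_measurable lborel"
    using assms[THEN L2_measurable] by simp
  show "integrable lborel (\<lambda>x. 2 * (norm (f x))\<^sup>2 + 2 * (norm (g x))\<^sup>2)"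
    using assms[THEN L2_square_integrable] by auto
  fix x
  have "(norm (f x + g x))\<^sup>2 \<le> (norm (f x) + norm (g x))\<^sup>2"
    by (intro power_mono norm_triangle_ineq) auto
  also have "\<dots> \<le> 2 * (norm (f x))\<^sup>2 + 2 * (norm (g x))\<^sup>2"
    using sum_squares_bound[of "norm (f x)" "norm (g x)"] by (simp add: power2_sum)
  finally show "(norm (f x + g x))\<^sup>2 \<le> 2 * (norm (f x))\<^sup>2 + 2 * (norm (g x))\<^sup>2" .
qed

lemma L2_scale: assumes "f \<in> L2" shows "(\<lambda>x. c * f x) \<in> L2"
  using assms unfolding L2_def by (auto simp: norm_mult power_mult_distrib)

lemma L2_cnj: assumes "f \<in> L2" shows "(\<lambda>x. cnj (f x)) \<in> L2"
  using assms unfolding L2_def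
  by (auto intro: measurable_compose[OF _ borel_measurable_continuous_onI] continuous_intros)

lemma L2_zero: "(\<lambda>x. 0) \<in> L2"
  by (simp add: L2_def)

lemma L2_diff: assumes "f \<in> L2" "g \<in> L2" shows "(\<lambda>x. f x - g x) \<in> L2"
  using L2_add[OF assms(1) L2_scale[OF assms(2), of "-1"]] by simp

lemma L2_sum: assumes "\<And>i. i \<in> I \<Longrightarrow> f i \<in> L2" shows "(\<lambda>x. \<Sum>i\<in>I. f i x) \<in> L2"
  using assms
proof (induction I rule: infinite_finite_induct)
  case (insert i I)
  then show ?case using L2_add[of "f i" "\<lambda>x. \<Sum>i\<in>I. f i x"] by simp
qed (auto simp: L2_zero)

lemma L2_mult_integrable: assumes "f \<in> L2" "g \<in> L2" shows "integrable lborel (\<lambda>x. f x * g x)"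
proof (rule Bochner_Integration.integrable_bound)
  show "integrable lborel (\<lambda>x. (norm (f x))\<^sup>2 + (norm (g x))\<^sup>2)"
    using assms[THEN L2_square_integrable] by auto
  show "(\<lambda>x. f x * g x) \<in> borel_measurable lborel"
    using assms[THEN L2_measurable] by simp
  show "AE x in lborel. norm (f x * g x) \<le> norm ((norm (f x))\<^sup>2 + (norm (g x))\<^sup>2)"
  proof (rule AE_I2)
    fix x
    have "norm (f x) * norm (g x) \<le> 2 * norm (f x) * norm (g x)" by simp
    also have "\<dots> \<le> (norm (f x))\<^sup>2 + (norm (g x))\<^sup>2" by (rule sum_squares_bound)
    finally show "norm (f x * g x) \<le> norm ((norm (f x))\<^sup>2 + (norm (g x))\<^sup>2)"
      by (simp add: norm_mult)
  qed
qed

lemma l2norm_nonneg [simp]: "0 \<le> l2norm f"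
  by (simp add: l2norm_def)

lemma l2norm_square: "(l2norm f)\<^sup>2 = (LBINT x. (norm (f x))\<^sup>2)"
  by (simp add: l2norm_def)

lemma l2norm_cnj [simp]: "l2norm (\<lambda>x. cnj (f x)) = l2norm f"
  by (simp add: l2norm_def)

lemma l2norm_scale: "l2norm (\<lambda>x. c * f x) = norm c * l2norm f"
  by (simp add: l2norm_def norm_mult power_mult_distrib real_sqrt_mult)

text \<open>The infimum over \<open>t\<close> of the right-hand side is the geometric mean, so a
  weighted inequality of arithmetic and geometric means integrates to Cauchy-Schwarz. If
  \<open>A\<close> or \<open>B\<close> vanishes, the infimum need not be attained, hence the
  argument with \<open>e\<close>.\<close>

lemma le_sqrt_prodI:
  fixes X A B :: real
  assumes "A \<ge> 0" "B \<ge> 0" and le: "\<And>t. t > 0 \<Longrightarrow> X \<le> (t * A + B / t) / 2"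
  shows "X \<le> sqrt A * sqrt B"
proof (cases "A = 0 \<or> B = 0")
  case False
  then have p: "A > 0" "B > 0" using assms by auto
  have "X \<le> (sqrt B / sqrt A * A + B / (sqrt B / sqrt A)) / 2"
    by (rule le) (use p in auto)
  also have "sqrt B / sqrt A * A = sqrt A * sqrt B"
    using p by (simp add: field_simps)
  also have "B / (sqrt B / sqrt A) = sqrt A * sqrt B"
    using p by (simp add: field_simps)
  finally show ?thesis by simp
next
  case True
  have "X \<le> 0"
  proof (rule field_le_epsilon)
    fix e :: real assume e: "e > 0"
    show "X \<le> 0 + e"
    proof (cases "A = 0")
      case True
      \<comment> \<open>A large \<open>t\<close> makes the surviving term at most
        \<open>e / 2\<close>; the added 1 keeps \<open>t\<close> positive when \<open>B\<close>
        vanishes too.\<close>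
      have "X \<le> ((B + 1) / e * A + B / ((B + 1) / e)) / 2"
        by (rule le) (use assms e in auto)
      also have "\<dots> = e * (B / (B + 1)) / 2" using True by simp
      also have "\<dots> \<le> e * 1 / 2" using assms e by (intro divide_right_mono mult_left_mono) (auto simp: field_simps)
      finally show ?thesis using e by simp
    next
      case False
      with True have B: "B = 0" by auto
      have "X \<le> (e / (A + 1) * A + B / (e / (A + 1))) / 2"
        by (rule le) (use assms e in \<open>auto simp: add_nonneg_pos\<close>)
      also have "\<dots> = e * (A / (A + 1)) / 2" using B by simp
      also have "\<dots> \<le> e * 1 / 2" using assms e by (intro divide_right_mono mult_left_mono) (auto simp: field_simps)
      finally show ?thesis using e by simp
    qed
  qed
  then show ?thesis using True by auto
qed

lemma L2_Cauchy_Schwarz_norm: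
  assumes "f \<in> L2" "g \<in> L2"
  shows "(LBINT x. norm (f x) * norm (g x)) \<le> l2norm f * l2norm g"
  unfolding l2norm_def
proof (rule le_sqrt_prodI)
  fix t :: real assume t: "t > 0"
  note [simp] = L2_square_integrable[OF assms(1)] L2_square_integrable[OF assms(2)]
  have i: "integrable lborel (\<lambda>x. norm (f x) * norm (g x))"
    using integrable_norm[OF L2_mult_integrable[OF assms]] by (simp add: norm_mult)
  have "(LBINT x. norm (f x) * norm (g x)) \<le>
     (LBINT x. (t * (norm (f x))\<^sup>2 + (norm (g x))\<^sup>2 / t) / 2)"
  proof (rule integral_mono[OF i])
    fix x
    have "2 * (sqrt t * norm (f x)) * (norm (g x) / sqrt t) \<le> (sqrt t * norm (f x))\<^sup>2 + (norm (g x) / sqrt t)\<^sup>2"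
      by (rule sum_squares_bound)
    then show "norm (f x) * norm (g x) \<le> (t * (norm (f x))\<^sup>2 + (norm (g x))\<^sup>2 / t) / 2"
      using t by (simp add: power_mult_distrib power_divide)
  qed simp
  also have "\<dots> = (t * (LBINT x. (norm (f x))\<^sup>2) + (LBINT x. (norm (g x))\<^sup>2) / t) / 2"
    by simp
  finally show "(LBINT x. norm (f x) * norm (g x)) \<le>
    (t * (LBINT x. (norm (f x))\<^sup>2) + (LBINT x. (norm (g x))\<^sup>2) / t) / 2" .
qed auto

lemma L2_Cauchy_Schwarz:
  assumes "f \<in> L2" "g \<in> L2"
  shows "norm (LBINT x. f x * g x) \<le> l2norm f * l2norm g"
proof -
  have "norm (LBINT x. f x * g x) \<le> (LBINT x. norm (f x * g x))"
    by (rule integral_norm_bound)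
  then show ?thesis using L2_Cauchy_Schwarz_norm[OF assms] by (simp add: norm_mult)
qed

lemma integral_mult_cnj_self:
  "(LBINT x. f x * cnj (f x)) = complex_of_real ((l2norm f)\<^sup>2)"
  unfolding l2norm_square by (simp add: complex_norm_square[symmetric] flip: of_real_power)

lemma Lp_norm_2: assumes "f \<in> L2" shows "Lp_norm 2 f = ennreal (l2norm f)"
proof -
  have i: "(\<integral>\<^sup>+x. ennreal (norm (f x) powr 2) \<partial>lborel) = ennreal ((l2norm f)\<^sup>2)"
    using L2_square_integrable[OF assms] by (simp add: nn_integral_eq_integral l2norm_square)
  have "real_of_ereal 2 = 2" "(2::ereal) \<noteq> \<infinity>"
    by (metis numeral_eq_ereal real_of_ereal.simps(1)) simp
  then show ?thesis
    unfolding Lp_norm_def Let_def by (simp only: i) (simp add: powr_half_sqrt)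
qed

lemma l2norm_eq_0_iff: assumes "f \<in> L2" shows "l2norm f = 0 \<longleftrightarrow> (AE x in lborel. f x = 0)"
  unfolding l2norm_def using integral_nonneg_eq_0_iff_AE[OF L2_square_integrable[OF assms]] by simp

lemma l2norm_cong_AE: assumes "f \<in> L2" "g \<in> L2" "AE x in lborel. f x = g x"
  shows "l2norm f = l2norm g"
  unfolding l2norm_def
  by (intro arg_cong[where f=sqrt] integral_cong_AE)
     (use assms in \<open>auto dest!: L2_measurable\<close>)

text \<open>The derivative of the integrand is dominated by Cauchy's estimate.\<close>
lemma has_field_derivative_lebesgue_integral:
  fixes f :: "complex \<Rightarrow> 'a \<Rightarrow> complex"
  assumes S: "open S" and hol: "\<And>x. (\<lambda>z. f z x) holomorphic_on S"
    and meas: "\<And>z. z \<in> S \<Longrightarrow> f z \<in> borel_measurable M"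
    and h: "integrable M h" and bd: "\<And>z x. z \<in> S \<Longrightarrow> norm (f z x) \<le> h x"
    and z: "z \<in> S"
  shows "integrable M (\<lambda>x. deriv (\<lambda>z. f z x) z)"
    and "((\<lambda>z. \<integral>x. f z x \<partial>M) has_field_derivative (\<integral>x. deriv (\<lambda>z. f z x) z \<partial>M)) (at z)"
proof -
  obtain e where e: "e > 0" "cball z e \<subseteq> S" using S z open_contains_cball by blast
  \<comment> \<open>Half the radius leaves room for Cauchy's estimate: discs of radius
    \<open>d\<close> around points of \<open>ball z d\<close> remain in \<open>S\<close>.\<close>
  define d where "d = e / 2"
  have d: "d > 0" using e by (simp add: d_def)
  have sub: "cball w d \<subseteq> S" if "w \<in> ball z d" for w
  proof
    fix y assume "y \<in> cball w d"
    then have "dist z y \<le> e" using dist_triangle[of z y w] that by (auto simp: d_def)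
    then show "y \<in> S" using e by auto
  qed
  have inS: "w \<in> S" if "w \<in> ball z d" for w using sub[OF that] d by auto
  have h0: "h x \<ge> 0" for x using bd[OF z] norm_ge_zero order_trans by blast
  have der: "norm (deriv (\<lambda>z. f z x) w) \<le> h x / d" if "w \<in> ball z d" for w x
  proof -
    have "norm ((deriv ^^ 1) (\<lambda>z. f z x) w) \<le> fact 1 * h x / d ^ 1"
    proof (rule Cauchy_inequality)
      show "(\<lambda>z. f z x) holomorphic_on ball w d"
        using sub[OF that] by (intro holomorphic_on_subset[OF hol]) auto
      show "continuous_on (cball w d) (\<lambda>z. f z x)"
        using sub[OF that] by (intro holomorphic_on_imp_continuous_on holomorphic_on_subset[OF hol])
      show "norm (f y x) \<le> h x" if "norm (w - y) = d" for y
        using sub[OF \<open>w \<in> ball z d\<close>] that by (intro bd) (auto simp: dist_norm)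
    qed (rule d)
    then show ?thesis by simp
  qed
  have lip: "norm (f w x - f z x) \<le> h x / d * norm (w - z)" if "w \<in> ball z d" for w x
  proof (rule field_differentiable_bound)
    show "convex (ball z d)" by simp
    show "((\<lambda>z. f z x) has_field_derivative deriv (\<lambda>z. f z x) y) (at y within ball z d)"
      if "y \<in> ball z d" for y
      using holomorphic_derivI[OF hol S inS[OF that]] by (rule has_field_derivative_at_within)
  qed (use der that d in auto)
  have int: "integrable M (f w)" if "w \<in> S" for w
    using bd that meas by (intro Bochner_Integration.integrable_bound[OF h]) (auto simp: abs_of_nonneg h0)
  have pt: "(\<lambda>n. (f (v n) x - f z x) / (v n - z)) \<longlonglongrightarrow> deriv (\<lambda>z. f z x) z"
    if "v \<longlonglongrightarrow> z" "\<And>n. v n \<noteq> z" for x and v :: "nat \<Rightarrow> complex"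
  proof -
    have "((\<lambda>y. (f y x - f z x) / (y - z)) \<longlongrightarrow> deriv (\<lambda>z. f z x) z) (at z)"
      using holomorphic_derivI[OF hol S z] unfolding has_field_derivative_iff .
    then show ?thesis
      by (rule filterlim_compose) (use that in \<open>auto simp: filterlim_at\<close>)
  qed
  have md: "(\<lambda>x. deriv (\<lambda>z. f z x) z) \<in> borel_measurable M"
  proof (rule borel_measurable_LIMSEQ_metric)
    \<comment> \<open>The derivative is measurable as a limit of difference quotients. The offset
      \<open>Suc (Suc n)\<close> keeps every increment strictly below \<open>d\<close>.\<close>
    define v where "v n = z + of_real (d * inverse (real (Suc (Suc n))))" for n
    have v: "v n \<in> ball z d" "v n \<noteq> z" for n
    proof -
      define e where "e = d * inverse (real (Suc (Suc n)))"
      have "e > 0" "e < d" using d by (auto simp: e_def field_simps add_pos_nonneg)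
      moreover have "v n = z + of_real e" by (simp only: v_def e_def)
      ultimately show "v n \<in> ball z d" "v n \<noteq> z" by (auto simp: dist_norm)
    qed
    have "v \<longlonglongrightarrow> z + of_real (d * 0)" unfolding v_def
      by (intro tendsto_intros LIMSEQ_Suc[OF LIMSEQ_inverse_real_of_nat])
    then show "(\<lambda>n. (f (v n) x - f z x) / (v n - z)) \<longlonglongrightarrow> deriv (\<lambda>z. f z x) z" for x
      using pt v(2) by simp
    show "(\<lambda>x. (f (v n) x - f z x) / (v n - z)) \<in> borel_measurable M" for n
      using meas[OF inS[OF v(1)]] meas[OF z] by measurable
  qed
  show "integrable M (\<lambda>x. deriv (\<lambda>z. f z x) z)"
  proof (rule Bochner_Integration.integrable_bound[OF _ md])
    show "integrable M (\<lambda>x. h x / d)" using h by simp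
    show "AE x in M. norm (deriv (\<lambda>z. f z x) z) \<le> norm (h x / d)"
      using der[of z] d h0 by (intro AE_I2) (simp add: abs_of_nonneg)
  qed
  show "((\<lambda>z. \<integral>x. f z x \<partial>M) has_field_derivative (\<integral>x. deriv (\<lambda>z. f z x) z \<partial>M)) (at z)"
    unfolding has_field_derivative_iff
  proof (rule LIMSEQ_SEQ_conv[THEN iffD1, rule_format])
    fix w :: "nat \<Rightarrow> complex"
    assume w: "(\<forall>n. w n \<noteq> z) \<and> w \<longlonglongrightarrow> z"
    then obtain N where N: "\<And>n. n \<ge> N \<Longrightarrow> w n \<in> ball z d"
      using d unfolding LIMSEQ_def by (metis dist_commute mem_ball)
    define v where "v n = w (n + N)" for n
    have v: "v n \<in> ball z d" "v n \<noteq> z" for n using N w by (auto simp: v_def)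
    have vz: "v \<longlonglongrightarrow> z" using w LIMSEQ_ignore_initial_segment unfolding v_def by blast
    have "(\<lambda>n. \<integral>x. (f (v n) x - f z x) / (v n - z) \<partial>M) \<longlonglongrightarrow> (\<integral>x. deriv (\<lambda>z. f z x) z \<partial>M)"
    proof (rule integral_dominated_convergence)
      show "(\<lambda>x. (f (v n) x - f z x) / (v n - z)) \<in> borel_measurable M" for n
        using meas[OF inS[OF v(1)]] meas[OF z] by measurable
      show "(\<lambda>x. deriv (\<lambda>z. f z x) z) \<in> borel_measurable M" by (rule md)
      show "integrable M (\<lambda>x. h x / d)" using h by simp
      show "AE x in M. norm ((f (v n) x - f z x) / (v n - z)) \<le> h x / d" for n
        using lip[OF v(1)] v(2) by (intro AE_I2) (simp add: norm_divide divide_le_eq)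
      show "AE x in M. (\<lambda>n. (f (v n) x - f z x) / (v n - z)) \<longlonglongrightarrow> deriv (\<lambda>z. f z x) z"
        using pt[OF vz v(2)] by auto
    qed
    also have "(\<lambda>n. \<integral>x. (f (v n) x - f z x) / (v n - z) \<partial>M) =
       (\<lambda>n. ((\<integral>x. f (v n) x \<partial>M) - (\<integral>x. f z x \<partial>M)) / (v n - z))"
      using int[OF inS[OF v(1)]] int[OF z] by (simp add: Bochner_Integration.integral_diff)
    finally show "(\<lambda>n. ((\<integral>x. f (w n) x \<partial>M) - (\<integral>x. f z x \<partial>M)) / (w n - z)) \<longlonglongrightarrow> (\<integral>x. deriv (\<lambda>z. f z x) z \<partial>M)"
      unfolding v_def by (rule LIMSEQ_offset)
  qed
qed

section \<open>Gaussian integrals\<close>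

lemma nn_integral_gaussian_1:
  fixes c m :: real assumes c: "c > 0"
  shows "(\<integral>\<^sup>+t. ennreal (exp (- c * (t - m)\<^sup>2)) \<partial>lborel) = ennreal (sqrt (pi / c))"
proof -
  \<comment> \<open>The Gaussian is a multiple of the normal density with variance
    \<open>s\<^sup>2 = 1 / (2 * c)\<close>, which has total mass one.\<close>
  define s where "s = 1 / sqrt (2 * c)"
  have s: "s > 0" "s\<^sup>2 = 1 / (2 * c)" using c by (auto simp: s_def power_divide)
  have "exp (- c * (t - m)\<^sup>2) = sqrt (pi / c) * normal_density m s t" for t
    unfolding normal_density_def s(2) using c by (simp add: field_simps real_sqrt_divide real_sqrt_mult)
  then have "(\<integral>\<^sup>+t. ennreal (exp (- c * (t - m)\<^sup>2)) \<partial>lborel)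
      = (\<integral>\<^sup>+t. ennreal (sqrt (pi / c)) * ennreal (normal_density m s t) \<partial>lborel)"
    using c by (simp add: ennreal_mult)
  also have "\<dots> = ennreal (sqrt (pi / c)) * (\<integral>\<^sup>+t. ennreal (normal_density m s t) \<partial>lborel)"
    by (subst nn_integral_cmult) auto
  also have "(\<integral>\<^sup>+t. ennreal (normal_density m s t) \<partial>lborel) = 1"
    using prob_space.emeasure_space_1[OF prob_space_normal_density[OF s(1), of m]]
    by (simp add: emeasure_density)
  finally show ?thesis by simp
qed

lemma nn_integral_gaussian:
  fixes y :: "real^'n::finite" assumes c: "c > 0"
  shows "(\<integral>\<^sup>+x. ennreal (exp (- c * (norm (x - y))\<^sup>2)) \<partial>lborel) = ennreal (sqrt (pi / c) ^ CARD('n))"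
proof -
  have "ennreal (exp (- c * (norm (x - y))\<^sup>2)) =
      (\<Prod>b\<in>Basis. ennreal (exp (- c * (x \<bullet> b - y \<bullet> b)\<^sup>2)))" for x
  proof -
    have "(norm (x - y))\<^sup>2 = (\<Sum>b\<in>Basis. (x \<bullet> b - y \<bullet> b)\<^sup>2)"
      unfolding power2_norm_eq_inner euclidean_inner[of "x - y" "x - y"]
      by (simp add: power2_eq_square inner_diff_left)
    then show ?thesis
      by (simp add: prod_ennreal sum_distrib_left exp_sum)
  qed
  then have "(\<integral>\<^sup>+x. ennreal (exp (- c * (norm (x - y))\<^sup>2)) \<partial>lborel) =
     (\<Prod>b\<in>(Basis::(real^'n) set). \<integral>\<^sup>+t. ennreal (exp (- c * (t - y \<bullet> b)\<^sup>2)) \<partial>lborel)"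
    by (simp only:, subst nn_integral_lborel_prod) auto
  also have "\<dots> = (\<Prod>b\<in>(Basis::(real^'n) set). ennreal (sqrt (pi / c)))"
    by (simp only: nn_integral_gaussian_1[OF c])
  also have "\<dots> = ennreal (sqrt (pi / c) ^ CARD('n))"
    using c by (simp add: ennreal_power)
  finally show ?thesis .
qed

lemma integrable_gaussian:
  fixes y :: "real^'n::finite" assumes c: "c > 0"
  shows "integrable lborel (\<lambda>x. exp (- c * (norm (x - y))\<^sup>2))"
  by (rule integrableI_nonneg) (auto simp: nn_integral_gaussian[OF c, simplified])

lemma integral_gaussian:
  fixes y :: "real^'n::finite" assumes c: "c > 0"
  shows "(LBINT x. exp (- c * (norm (x - y))\<^sup>2)) = sqrt (pi / c) ^ CARD('n)"
  using nn_integral_gaussian[OF c, of y] c by (intro integral_eq_nn_integral[THEN trans]) auto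

section \<open>The Mehler kernel\<close>

text \<open>For \<open>r = exp (- 2 t)\<close> this is \<open>exp (n t)\<close> times the kernel of \<open>exp (- t H)\<close>; the parameter \<open>r\<close> makes
  it single valued, since \<open>Re (1 - r\<^sup>2) > 0\<close> on the disc.\<close>
definition mehler :: "complex \<Rightarrow> real^'n::finite \<Rightarrow> real^'n \<Rightarrow> complex" where
  "mehler r x y = (1 / csqrt (of_real pi * (1 - r\<^sup>2))) ^ CARD('n) *
     exp (- ((1 - r) / (1 + r)) * of_real ((norm (x + y))\<^sup>2 / 4)
          - (1 + r) / (1 - r) * of_real ((norm (x - y))\<^sup>2 / 4))"

lemma unit_disc_facts:
  assumes "norm (r::complex) < 1"
  shows "1 - r \<noteq> 0" "1 + r \<noteq> 0" "1 - r\<^sup>2 \<noteq> 0" "Re (1 - r\<^sup>2) > 0"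
    "of_real pi * (1 - r\<^sup>2) \<notin> \<real>\<^sub>\<le>\<^sub>0"
proof -
  have *: "norm (r\<^sup>2) < 1"
    using assms power_strict_mono[of "norm r" 1 2] by (simp add: norm_power)
  then have "\<bar>Re (r\<^sup>2)\<bar> < 1" using abs_Re_le_cmod[of "r\<^sup>2"] by linarith
  then show 1: "Re (1 - r\<^sup>2) > 0" by simp
  show "1 - r \<noteq> 0" "1 + r \<noteq> 0"
    using assms by (auto dest: add_eq_0_iff[THEN iffD1])
  show "1 - r\<^sup>2 \<noteq> 0" using 1 by force
  show "of_real pi * (1 - r\<^sup>2) \<notin> \<real>\<^sub>\<le>\<^sub>0"
    using 1 by (auto simp: complex_nonpos_Reals_iff mult_le_0_iff dest: pi_gt_zero[THEN less_le_trans])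
qed

text \<open>The real part of the Cayley transform is
  \<open>(1 - (norm r)\<^sup>2) / (norm (1 + r))\<^sup>2\<close>, and the denominator is at most 4.
  Applied to \<open>- r\<close> it covers the reciprocal, so both coefficients in the exponent of
  the kernel are under control.\<close>

lemma Re_cayley:
  assumes "norm (r::complex) \<le> R" "R < 1"
  shows "Re ((1 - r) / (1 + r)) \<ge> (1 - R\<^sup>2) / 4"
proof -
  have r1: "norm r < 1" using assms by simp
  have "Re ((1 - r) / (1 + r)) = Re ((1 - r) * cnj (1 + r)) / (norm (1 + r))\<^sup>2"
    by (subst complex_div_cnj) (simp add: Re_divide_of_real flip: of_real_power)
  also have "Re ((1 - r) * cnj (1 + r)) = 1 - (norm r)\<^sup>2"
    unfolding cmod_power2 by (simp add: power2_eq_square algebra_simps)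
  finally have "Re ((1 - r) / (1 + r)) = (1 - (norm r)\<^sup>2) / (norm (1 + r))\<^sup>2" .
  moreover have "(norm (1 + r))\<^sup>2 \<le> 2\<^sup>2"
    using norm_triangle_ineq[of 1 r] r1 by (intro power_mono) auto
  moreover have "(norm r)\<^sup>2 \<le> R\<^sup>2" using assms(1) by (rule power_mono) simp
  moreover have "R\<^sup>2 < 1" using assms order_trans[OF norm_ge_zero assms(1)] by (simp add: abs_square_less_1)
  moreover have "(norm (1 + r))\<^sup>2 > 0" using unit_disc_facts[OF r1] by simp
  ultimately have "(1 - R\<^sup>2) * (norm (1 + r))\<^sup>2 \<le> (1 - (norm r)\<^sup>2) * 4"
    by (intro mult_mono) auto
  with \<open>(norm (1 + r))\<^sup>2 > 0\<close> show ?thesis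
    unfolding \<open>Re ((1 - r) / (1 + r)) = (1 - (norm r)\<^sup>2) / (norm (1 + r))\<^sup>2\<close> by (simp add: field_simps)
qed

lemma parallelogram_norm:
  fixes x y :: "'a::real_inner"
  shows "(norm (x + y))\<^sup>2 + (norm (x - y))\<^sup>2 = 2 * ((norm x)\<^sup>2 + (norm y)\<^sup>2)"
  unfolding power2_norm_eq_inner by (simp add: inner_simps inner_commute)

text \<open>Both coefficients have real part at least \<open>(1 - R\<^sup>2) / 4\<close>; the
  parallelogram law then trades decay in \<open>x + y\<close> and \<open>x - y\<close> for separate
  decay in \<open>x\<close> and in \<open>y\<close>.\<close>

lemma norm_mehler_exp:
  fixes r :: complex
  assumes "norm r \<le> R" "R < 1"
  shows "norm (exp (- ((1 - r) / (1 + r)) * of_real ((norm (x + y))\<^sup>2 / 4)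
          - (1 + r) / (1 - r) * of_real ((norm (x - y))\<^sup>2 / 4)))
     \<le> exp (- ((1 - R\<^sup>2) / 8) * ((norm (x::real^'n::finite))\<^sup>2 + (norm y)\<^sup>2))"
proof -
  have a: "Re ((1 - r) / (1 + r)) \<ge> (1 - R\<^sup>2) / 4" using Re_cayley[OF assms] .
  have b: "Re ((1 + r) / (1 - r)) \<ge> (1 - R\<^sup>2) / 4" using Re_cayley[of "-r" R] assms by simp
  have "(1 - R\<^sup>2) / 4 * ((norm (x + y))\<^sup>2 / 4) + (1 - R\<^sup>2) / 4 * ((norm (x - y))\<^sup>2 / 4)
     \<le> Re ((1 - r) / (1 + r)) * ((norm (x + y))\<^sup>2 / 4) + Re ((1 + r) / (1 - r)) * ((norm (x - y))\<^sup>2 / 4)"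
    by (intro add_mono mult_right_mono a b) auto
  also have "(1 - R\<^sup>2) / 4 * ((norm (x + y))\<^sup>2 / 4) + (1 - R\<^sup>2) / 4 * ((norm (x - y))\<^sup>2 / 4) =
     (1 - R\<^sup>2) / 16 * ((norm (x + y))\<^sup>2 + (norm (x - y))\<^sup>2)"
    by (simp add: algebra_simps)
  also have "\<dots> = (1 - R\<^sup>2) / 8 * ((norm x)\<^sup>2 + (norm y)\<^sup>2)"
    by (simp only: parallelogram_norm)
  finally show ?thesis
  proof -
    assume *: "(1 - R\<^sup>2) / 8 * ((norm x)\<^sup>2 + (norm y)\<^sup>2) \<le> Re ((1 - r) / (1 + r)) * ((norm (x + y))\<^sup>2 / 4)
         + Re ((1 + r) / (1 - r)) * ((norm (x - y))\<^sup>2 / 4)"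
    have "Re (- ((1 - r) / (1 + r)) * of_real ((norm (x + y))\<^sup>2 / 4)
          - (1 + r) / (1 - r) * of_real ((norm (x - y))\<^sup>2 / 4))
        = - (Re ((1 - r) / (1 + r)) * ((norm (x + y))\<^sup>2 / 4)) - Re ((1 + r) / (1 - r)) * ((norm (x - y))\<^sup>2 / 4)"
      by (simp only: minus_complex.sel mult_minus_left uminus_complex.sel Re_complex_of_real times_complex.sel Im_complex_of_real)
    with * show ?thesis unfolding norm_exp_eq_Re exp_le_cancel_iff by linarith
  qed
qed

lemma norm_mehler_le_dispersive:
  fixes x :: "real^'n::finite"
  assumes "norm r < 1"
  shows "norm (mehler r x y) \<le> (1 / sqrt (pi * norm (1 - r\<^sup>2))) ^ CARD('n)"
proof -
  have "(norm r)\<^sup>2 < 1" using assms by (simp add: abs_square_less_1)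
  then have "exp (- ((1 - (norm r)\<^sup>2) / 8) * ((norm x)\<^sup>2 + (norm y)\<^sup>2)) \<le> 1"
    by (simp add: mult_nonneg_nonneg)
  then have "norm (exp (- ((1 - r) / (1 + r)) * of_real ((norm (x + y))\<^sup>2 / 4)
          - (1 + r) / (1 - r) * of_real ((norm (x - y))\<^sup>2 / 4))) \<le> 1"
    using norm_mehler_exp[OF order_refl assms, of x y] by linarith
  then have "(1 / sqrt (pi * norm (1 - r\<^sup>2))) ^ CARD('n) *
      norm (exp (- ((1 - r) / (1 + r)) * of_real ((norm (x + y))\<^sup>2 / 4)
          - (1 + r) / (1 - r) * of_real ((norm (x - y))\<^sup>2 / 4))) \<le> (1 / sqrt (pi * norm (1 - r\<^sup>2))) ^ CARD('n)"
    by (intro mult_left_le) auto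
  then show ?thesis
    unfolding mehler_def norm_mult norm_power norm_divide norm_csqrt by simp
qed

text \<open>The bound is uniform over a smaller disc and factors in \<open>x\<close> and
  \<open>y\<close>. It supplies the dominating functions for differentiation under the integral and
  for Fubini's theorem.\<close>

lemma norm_mehler_le_gaussian:
  fixes x :: "real^'n::finite"
  assumes "norm r \<le> R" "R < 1"
  shows "norm (mehler r x y) \<le> (1 / sqrt (pi * (1 - R\<^sup>2))) ^ CARD('n) *
     (exp (- ((1 - R\<^sup>2) / 8) * (norm x)\<^sup>2) * exp (- ((1 - R\<^sup>2) / 8) * (norm y)\<^sup>2))"
proof -
  have R: "(norm r)\<^sup>2 \<le> R\<^sup>2" "R\<^sup>2 < 1"
    using assms(1) assms order_trans[OF norm_ge_zero assms(1)]
    by (auto intro!: power_mono simp: abs_square_less_1)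
  have "1 - R\<^sup>2 \<le> norm (1 - r\<^sup>2)"
    using norm_triangle_ineq2[of 1 "r\<^sup>2"] R by (simp add: norm_power)
  moreover from this have "0 < norm (1 - r\<^sup>2)" using R by linarith
  ultimately have *: "1 / sqrt (pi * norm (1 - r\<^sup>2)) \<le> 1 / sqrt (pi * (1 - R\<^sup>2))"
    using R by (intro divide_left_mono mult_left_mono mult_pos_pos) auto
  have "norm (mehler r x y) = (1 / sqrt (pi * norm (1 - r\<^sup>2))) ^ CARD('n) *
      norm (exp (- ((1 - r) / (1 + r)) * of_real ((norm (x + y))\<^sup>2 / 4)
          - (1 + r) / (1 - r) * of_real ((norm (x - y))\<^sup>2 / 4)))"
    unfolding mehler_def norm_mult norm_power norm_divide norm_csqrt by simp
  also have "\<dots> \<le> (1 / sqrt (pi * (1 - R\<^sup>2))) ^ CARD('n) *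
     exp (- ((1 - R\<^sup>2) / 8) * ((norm x)\<^sup>2 + (norm y)\<^sup>2))"
    by (intro mult_mono power_mono * norm_mehler_exp assms) (use R in auto)
  finally show ?thesis by (simp only: distrib_left exp_add)
qed

lemma mehler_commute: "mehler r x y = mehler r y x"
  by (simp add: mehler_def add.commute norm_minus_commute)

lemma cnj_mehler: assumes "norm r < 1" shows "cnj (mehler r x y) = mehler (cnj r) x y"
  unfolding mehler_def using cnj_csqrt[OF unit_disc_facts(5)[OF assms]]
  by (simp add: exp_cnj)

lemma measurable_mehler [measurable]:
  assumes "f \<in> borel_measurable M" "g \<in> borel_measurable M"
  shows "(\<lambda>w. mehler r (f w) (g w)) \<in> borel_measurable M"
proof -
  have "continuous_on UNIV (\<lambda>p. mehler r (fst p) (snd p :: real^'n::finite))"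
    unfolding mehler_def by (intro continuous_intros) auto
  from borel_measurable_continuous_onI[OF this]
  have "(\<lambda>p. mehler r (fst p) (snd p :: real^'n)) \<in> borel_measurable (borel \<Otimes>\<^sub>M borel)"
    by (simp add: borel_prod)
  from measurable_compose[OF measurable_Pair[OF assms] this] show ?thesis by simp
qed

text \<open>Logarithmic differentiation: the prefactor contributes the first summand, and the Cayley
  transforms contribute through their derivatives \<open>- 2 / (1 + r)\<^sup>2\<close> and
  \<open>2 / (1 - r)\<^sup>2\<close>. The square root is differentiable because its argument stays
  in the right half plane.\<close>

lemma mehler_has_field_derivative:
  fixes x y :: "real^'n::finite"
  assumes r: "norm r < 1"
  shows "((\<lambda>r. mehler r x y) has_field_derivative
     (of_nat CARD('n) * r / (1 - r\<^sup>2) + of_real ((norm (x + y))\<^sup>2 / 2) / (1 + r)\<^sup>2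
        - of_real ((norm (x - y))\<^sup>2 / 2) / (1 - r)\<^sup>2) * mehler r x y) (at r)"
proof -
  define s where "s = csqrt (of_real pi * (1 - r\<^sup>2))"
  define q :: "complex \<Rightarrow> complex" where "q r = 1 / csqrt (of_real pi * (1 - r\<^sup>2))" for r
  define e :: "complex \<Rightarrow> complex" where "e r = exp (- ((1 - r) / (1 + r)) * of_real ((norm (x + y))\<^sup>2 / 4)
          - (1 + r) / (1 - r) * of_real ((norm (x - y))\<^sup>2 / 4))" for r
  note d = unit_disc_facts[OF r]
  have s2: "s\<^sup>2 = of_real pi * (1 - r\<^sup>2)" "s \<noteq> 0" using d by (auto simp: s_def)
  have q: "(q has_field_derivative r / (1 - r\<^sup>2) * q r) (at r)"
  proof -
    have "((\<lambda>r. csqrt (of_real pi * (1 - r\<^sup>2))) has_field_derivative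
       (inverse (2 * s) * (of_real pi * (- (2 * r))))) (at r)"
      unfolding s_def
    proof (rule DERIV_chain2[where f=csqrt and g="\<lambda>r. of_real pi * (1 - r\<^sup>2)"])
      show "(csqrt has_field_derivative inverse (2 * csqrt (of_real pi * (1 - r\<^sup>2)))) (at (of_real pi * (1 - r\<^sup>2)))"
        by (rule has_field_derivative_csqrt[OF d(5)])
      show "((\<lambda>r. of_real pi * (1 - r\<^sup>2)) has_field_derivative of_real pi * (- (2 * r))) (at r)"
        by (auto intro!: derivative_eq_intros)
    qed
    then have "(q has_field_derivative ((0 * s - 1 * (inverse (2 * s) * (of_real pi * (- (2 * r))))) / (s * s))) (at r)"
      unfolding q_def s_def
      by (rule DERIV_divide[OF DERIV_const]) (use s2(2) in \<open>simp only: s_def not_False_eq_True\<close>)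
    then have "(q has_field_derivative (- (inverse (2 * s) * (of_real pi * (- (2 * r)))) / (s * s))) (at r)"
      by (simp only: mult_zero_left mult_1 diff_0)
    moreover have "- (inverse (2 * s) * (of_real pi * (- (2 * r)))) / (s * s) = r / (1 - r\<^sup>2) * (1 / s)"
    proof -
      have "- (inverse (2 * s) * (of_real pi * (- (2 * r)))) = of_real pi * (r / s)"
        using s2(2) by (simp add: field_simps)
      then show ?thesis
        by (simp only: power2_eq_square[symmetric] s2(1)) simp
    qed
    ultimately show ?thesis by (simp only: q_def s_def)
  qed
  have e: "(e has_field_derivative (of_real ((norm (x + y))\<^sup>2 / 2) / (1 + r)\<^sup>2
        - of_real ((norm (x - y))\<^sup>2 / 2) / (1 - r)\<^sup>2) * e r) (at r)"
  proof -
    have 1: "((\<lambda>r. (1 - r) / (1 + r)) has_field_derivative - 2 / (1 + r)\<^sup>2) (at r)"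
      by (rule DERIV_cong[OF DERIV_divide[OF DERIV_diff[OF DERIV_const DERIV_ident] DERIV_add[OF DERIV_const DERIV_ident] d(2)]])
         (simp add: power2_eq_square)
    have 2: "((\<lambda>r. (1 + r) / (1 - r)) has_field_derivative 2 / (1 - r)\<^sup>2) (at r)"
      by (rule DERIV_cong[OF DERIV_divide[OF DERIV_add[OF DERIV_const DERIV_ident] DERIV_diff[OF DERIV_const DERIV_ident] d(1)]])
         (simp add: power2_eq_square)
    show ?thesis
      unfolding e_def
      by (rule DERIV_cong[OF DERIV_chain2[OF DERIV_exp DERIV_diff[OF DERIV_cmult_right[OF DERIV_minus[OF 1]] DERIV_cmult_right[OF 2]]]])
         (simp add: algebra_simps)
  qed
  have "((\<lambda>r. q r ^ CARD('n) * e r) has_field_derivative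
    (of_nat CARD('n) * r / (1 - r\<^sup>2) + of_real ((norm (x + y))\<^sup>2 / 2) / (1 + r)\<^sup>2
        - of_real ((norm (x - y))\<^sup>2 / 2) / (1 - r)\<^sup>2) * (q r ^ CARD('n) * e r)) (at r)"
  proof (rule DERIV_cong[OF DERIV_mult[OF DERIV_power[OF q] e]])
    have "q r ^ CARD('n) = q r * q r ^ (CARD('n) - Suc 0)"
      by (metis One_nat_def Suc_pred power_Suc zero_less_card_finite)
    then show "of_nat CARD('n) * (r / (1 - r\<^sup>2) * q r * q r ^ (CARD('n) - Suc 0)) * e r +
      (of_real ((norm (x + y))\<^sup>2 / 2) / (1 + r)\<^sup>2 - of_real ((norm (x - y))\<^sup>2 / 2) / (1 - r)\<^sup>2) * e r * q r ^ CARD('n) =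
      (of_nat CARD('n) * r / (1 - r\<^sup>2) + of_real ((norm (x + y))\<^sup>2 / 2) / (1 + r)\<^sup>2
        - of_real ((norm (x - y))\<^sup>2 / 2) / (1 - r)\<^sup>2) * (q r ^ CARD('n) * e r)"
      by (simp add: algebra_simps)
  qed
  then show ?thesis by (simp add: mehler_def q_def e_def)
qed

lemma mehler_holomorphic: "(\<lambda>r. mehler r x y) holomorphic_on ball 0 1"
proof -
  have "\<exists>D. ((\<lambda>r. mehler r x y) has_field_derivative D) (at r)" if "r \<in> ball 0 1" for r
    using mehler_has_field_derivative[of r x y] that by auto
  then show ?thesis by (simp add: holomorphic_on_open)
qed

text \<open>Expanding the two squares gives the classical form of Mehler's kernel. Positivity is
  visible here, and the exponent is ready for completing the square.\<close>

lemma mehler_of_real: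
  fixes x y :: "real^'n::finite"
  assumes "0 \<le> r" "r < 1"
  shows "mehler (of_real r) x y = of_real (sqrt (1 / (pi * (1 - r\<^sup>2))) ^ CARD('n) *
     exp (- ((1 + r\<^sup>2) / (2 * (1 - r\<^sup>2))) * ((norm x)\<^sup>2 + (norm y)\<^sup>2) + 2 * r / (1 - r\<^sup>2) * (x \<bullet> y)))"
proof -
  have r2: "r\<^sup>2 < 1" using assms by (simp add: abs_square_less_1)
  have 1: "1 / csqrt (of_real pi * (1 - (of_real r)\<^sup>2)) = of_real (sqrt (1 / (pi * (1 - r\<^sup>2))))"
    using r2 csqrt_of_real[of "pi * (1 - r\<^sup>2)"] by (simp add: real_sqrt_divide)
  have p: "(norm (x + y))\<^sup>2 = (norm x)\<^sup>2 + (norm y)\<^sup>2 + 2 * (x \<bullet> y)"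
    "(norm (x - y))\<^sup>2 = (norm x)\<^sup>2 + (norm y)\<^sup>2 - 2 * (x \<bullet> y)"
    unfolding power2_norm_eq_inner by (simp_all add: inner_simps inner_commute)
  have ne: "1 + r \<noteq> 0" "1 - r \<noteq> 0" using assms by auto
  have f: "1 - r\<^sup>2 = (1 + r) * (1 - r)" by (simp add: power2_eq_square algebra_simps)
  have 2: "- ((1 - r) / (1 + r)) * ((norm (x + y))\<^sup>2 / 4) - (1 + r) / (1 - r) * ((norm (x - y))\<^sup>2 / 4)
     = - ((1 + r\<^sup>2) / (2 * (1 - r\<^sup>2))) * ((norm x)\<^sup>2 + (norm y)\<^sup>2) + 2 * r / (1 - r\<^sup>2) * (x \<bullet> y)"
    unfolding p f using ne by (simp add: divide_simps) (simp add: algebra_simps power2_eq_square)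
  show ?thesis
    unfolding mehler_def 1 2[symmetric] by (simp flip: exp_of_real)
qed

lemma mehler_of_real_pos:
  assumes "0 \<le> r" "r < 1"
  shows "mehler (of_real r) x y = of_real (norm (mehler (of_real r) x y))"
proof -
  have "r\<^sup>2 < 1" using assms by (simp add: abs_square_less_1)
  then show ?thesis
    unfolding mehler_of_real[OF assms] norm_of_real by (subst abs_of_nonneg) auto
qed

text \<open>The product is a Gaussian in \<open>z\<close>, so completing the square evaluates the
  integral. For real parameters only real Gaussian integrals occur; complex ones follow by analytic
  continuation.\<close>

lemma mehler_semigroup_real:
  fixes x y :: "real^'n::finite"
  assumes r: "0 < r" "r < 1" and s: "0 < s" "s < 1"
  shows "(LBINT z. mehler (of_real r) x z * mehler (of_real s) z y) = mehler (of_real (r * s)) x y"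
proof -
  \<comment> \<open>The total coefficient of \<open>- (norm z)\<^sup>2\<close> once the two
    exponents are added; \<open>A1\<close> confirms this.\<close>
  define A where "A = (1 - r\<^sup>2 * s\<^sup>2) / ((1 - r\<^sup>2) * (1 - s\<^sup>2))"
  have r2: "r\<^sup>2 < 1" and s2: "s\<^sup>2 < 1" and rs: "r * s < 1" "0 < r * s"
    using assms mult_strict_mono[of r 1 s 1] by (auto simp: abs_square_less_1)
  have rs2: "r\<^sup>2 * s\<^sup>2 < 1" using rs abs_square_less_1[of "r * s"] by (simp add: power_mult_distrib)
  have A: "A > 0" using r2 s2 rs2 by (simp add: A_def)
  have A1: "(1 + r\<^sup>2) / (2 * (1 - r\<^sup>2)) + (1 + s\<^sup>2) / (2 * (1 - s\<^sup>2)) = A"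
    unfolding A_def using r2 s2 by (simp add: divide_simps) (simp add: algebra_simps)
  have A2: "(2 * r / (1 - r\<^sup>2))\<^sup>2 / (4 * A) - (1 + r\<^sup>2) / (2 * (1 - r\<^sup>2)) = - ((1 + (r * s)\<^sup>2) / (2 * (1 - (r * s)\<^sup>2)))"
    unfolding A_def power_mult_distrib power_divide using r2 s2 rs2
    by (simp add: divide_simps) (simp add: algebra_simps power2_eq_square)
  have A3: "(2 * s / (1 - s\<^sup>2))\<^sup>2 / (4 * A) - (1 + s\<^sup>2) / (2 * (1 - s\<^sup>2)) = - ((1 + (r * s)\<^sup>2) / (2 * (1 - (r * s)\<^sup>2)))"
    unfolding A_def power_mult_distrib power_divide using r2 s2 rs2
    by (simp add: divide_simps) (simp add: algebra_simps power2_eq_square)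
  have A4: "2 * (2 * r / (1 - r\<^sup>2)) * (2 * s / (1 - s\<^sup>2)) / (4 * A) = 2 * (r * s) / (1 - (r * s)\<^sup>2)"
    unfolding A_def power_mult_distrib using r2 s2 rs2
    by (simp add: divide_simps)
  define a b c d where "a = (1 + r\<^sup>2) / (2 * (1 - r\<^sup>2))" and "b = 2 * r / (1 - r\<^sup>2)"
    and "c = (1 + s\<^sup>2) / (2 * (1 - s\<^sup>2))" and "d = 2 * s / (1 - s\<^sup>2)"
  \<comment> \<open>The centre of the Gaussian in \<open>z\<close>, found by completing the
    square.\<close>
  define w where "w = (1 / (2 * A)) *\<^sub>R (b *\<^sub>R x + d *\<^sub>R y)"
  define K where "K = sqrt (1 / (pi * (1 - r\<^sup>2))) ^ CARD('n) * sqrt (1 / (pi * (1 - s\<^sup>2))) ^ CARD('n)"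
  define e where "e = exp (- ((1 + (r * s)\<^sup>2) / (2 * (1 - (r * s)\<^sup>2))) * ((norm x)\<^sup>2 + (norm y)\<^sup>2) + 2 * (r * s) / (1 - (r * s)\<^sup>2) * (x \<bullet> y))"
  have sq: "(- a * ((norm x)\<^sup>2 + (norm z)\<^sup>2) + b * (x \<bullet> z)) + (- c * ((norm z)\<^sup>2 + (norm y)\<^sup>2) + d * (z \<bullet> y))
      = - A * (norm (z - w))\<^sup>2 + ((b\<^sup>2 / (4 * A) - a) * (norm x)\<^sup>2 + (d\<^sup>2 / (4 * A) - c) * (norm y)\<^sup>2
          + 2 * b * d / (4 * A) * (x \<bullet> y))" for z
  proof -
    have "A * (norm (z - w))\<^sup>2 = A * (z \<bullet> z) - (b * (x \<bullet> z) + d * (z \<bullet> y)) +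
        (b\<^sup>2 / (4 * A) * (x \<bullet> x) + 2 * b * d / (4 * A) * (x \<bullet> y) + d\<^sup>2 / (4 * A) * (y \<bullet> y))"
      unfolding power2_norm_eq_inner w_def using A
      by (simp add: inner_simps inner_commute power2_eq_square field_simps)
    moreover have "A = a + c" using A1 by (simp add: a_def c_def)
    ultimately show ?thesis
      unfolding power2_norm_eq_inner
      by (simp only: mult_minus_left) (simp add: algebra_simps)
  qed
  have "mehler (of_real r) x z * mehler (of_real s) z y = of_real (K * e * exp (- A * (norm (z - w))\<^sup>2))" for z
  proof -
    have "mehler (of_real r) x z * mehler (of_real s) z y =
      of_real (K * exp ((- a * ((norm x)\<^sup>2 + (norm z)\<^sup>2) + b * (x \<bullet> z)) + (- c * ((norm z)\<^sup>2 + (norm y)\<^sup>2) + d * (z \<bullet> y))))"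
      using r s by (simp add: mehler_of_real K_def exp_add a_def b_def c_def d_def flip: exp_of_real)
    also have "\<dots> = of_real (K * (exp (- A * (norm (z - w))\<^sup>2) * e))"
    proof -
      define g where "g = (1 + (r * s)\<^sup>2) / (2 * (1 - (r * s)\<^sup>2))"
      have "b\<^sup>2 / (4 * A) - a = - g" "d\<^sup>2 / (4 * A) - c = - g"
        using A2 A3 unfolding a_def b_def c_def d_def g_def by blast+
      moreover have "2 * b * d / (4 * A) = 2 * (r * s) / (1 - (r * s)\<^sup>2)"
        using A4 unfolding b_def d_def .
      ultimately have "(b\<^sup>2 / (4 * A) - a) * (norm x)\<^sup>2 + (d\<^sup>2 / (4 * A) - c) * (norm y)\<^sup>2 + 2 * b * d / (4 * A) * (x \<bullet> y)
        = - g * ((norm x)\<^sup>2 + (norm y)\<^sup>2) + 2 * (r * s) / (1 - (r * s)\<^sup>2) * (x \<bullet> y)"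
        by (simp only: distrib_left)
      then show ?thesis unfolding sq e_def g_def by (simp only: exp_add)
    qed
    finally show ?thesis by (simp add: mult_ac)
  qed
  then have "(LBINT z. mehler (of_real r) x z * mehler (of_real s) z y) =
     of_real (LBINT z. K * e * exp (- A * (norm (z - w))\<^sup>2))"
    by (simp only: integral_complex_of_real)
  also have "(LBINT z. K * e * exp (- A * (norm (z - w))\<^sup>2)) = K * e * sqrt (pi / A) ^ CARD('n)"
    using integral_gaussian[OF A, of w] by simp
  also have "\<dots> = sqrt (1 / (pi * (1 - (r * s)\<^sup>2))) ^ CARD('n) * e"
  proof -
    have "(1 / (pi * (1 - r\<^sup>2))) * (1 / (pi * (1 - s\<^sup>2))) * (pi / A) = 1 / (pi * (1 - (r * s)\<^sup>2))"
      unfolding A_def power_mult_distrib using r2 s2 rs2 by (simp add: divide_simps)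
    then have "K * sqrt (pi / A) ^ CARD('n) = sqrt (1 / (pi * (1 - (r * s)\<^sup>2))) ^ CARD('n)"
      by (simp only: K_def power_mult_distrib[symmetric] real_sqrt_mult[symmetric])
    then show ?thesis by (simp add: mult_ac)
  qed
  also have "of_real \<dots> = mehler (of_real (r * s)) x y"
    unfolding e_def by (subst mehler_of_real) (use rs in auto)
  finally show ?thesis .
qed

section \<open>Eigenfunctions and the Mehler kernel\<close>

lemma partial_eqI:
  fixes f :: "real^'n::finite \<Rightarrow> complex"
  assumes "(f has_derivative (\<lambda>h. \<Sum>j\<in>UNIV. c j * of_real (h $ j))) (at x)"
  shows "partial i f x = c i"
proof -
  have "partial i f x = (\<Sum>j\<in>UNIV. c j * of_real (axis i 1 $ j))"
    unfolding partial_def frechet_derivative_at[OF assms, symmetric] ..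
  also have "\<dots> = (\<Sum>j\<in>UNIV. if j = i then c j else 0)"
    by (rule sum.cong) (auto simp: axis_def)
  finally show ?thesis by simp
qed

section \<open>Polynomials times the kernel, and the Schwartz class\<close>

inductive cpoly :: "(real^'n::finite \<Rightarrow> complex) \<Rightarrow> bool" where
  cpoly_const: "cpoly (\<lambda>x. c)"
| cpoly_coord: "cpoly (\<lambda>x. of_real (x $ i))"
| cpoly_add: "cpoly f \<Longrightarrow> cpoly g \<Longrightarrow> cpoly (\<lambda>x. f x + g x)"
| cpoly_mult: "cpoly f \<Longrightarrow> cpoly g \<Longrightarrow> cpoly (\<lambda>x. f x * g x)"

lemma has_derivative_coord:
  "((\<lambda>x::real^'n::finite. complex_of_real (x $ i)) has_derivative
     (\<lambda>h. \<Sum>j\<in>UNIV. (if j = i then 1 else 0) * of_real (h $ j))) (at x)"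
proof -
  have "bounded_linear (\<lambda>h::real^'n. complex_of_real (h $ i))"
    by (intro bounded_linear_compose[OF bounded_linear_of_real] bounded_linear_vec_nth)
  moreover have "(\<Sum>j\<in>UNIV. (if j = i then 1 else 0) * complex_of_real (h $ j)) = of_real (h $ i)" for h :: "real^'n"
    by (simp add: if_distrib if_distribR cong: if_cong)
  ultimately show ?thesis by (simp add: bounded_linear_imp_has_derivative)
qed

lemma cpoly_has_derivative:
  assumes "cpoly P"
  shows "\<exists>D. (\<forall>i. cpoly (D i)) \<and> (\<forall>x. (P has_derivative (\<lambda>h. \<Sum>i\<in>UNIV. D i x * of_real (h $ i))) (at x))"
  using assms
proof induction
  case (cpoly_const c)
  show ?case
    by (rule exI[of _ "\<lambda>i x. 0"]) (auto intro: cpoly.intros)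
next
  case (cpoly_coord i)
  show ?case
    by (rule exI[of _ "\<lambda>j x. if j = i then 1 else 0"])
       (use has_derivative_coord in \<open>auto intro: cpoly.intros\<close>)
next
  case (cpoly_add f g)
  then obtain D E where D: "\<And>i. cpoly (D i)" "\<And>x. (f has_derivative (\<lambda>h. \<Sum>i\<in>UNIV. D i x * of_real (h $ i))) (at x)"
    and E: "\<And>i. cpoly (E i)" "\<And>x. (g has_derivative (\<lambda>h. \<Sum>i\<in>UNIV. E i x * of_real (h $ i))) (at x)"
    by blast
  have "((\<lambda>x. f x + g x) has_derivative (\<lambda>h. \<Sum>i\<in>UNIV. (D i x + E i x) * of_real (h $ i))) (at x)" for x
    using has_derivative_add[OF D(2) E(2), of x] by (simp add: distrib_right sum.distrib)
  then show ?case using D(1) E(1)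
    by (intro exI[of _ "\<lambda>i x. D i x + E i x"]) (auto intro: cpoly.intros)
next
  case (cpoly_mult f g)
  then obtain D E where D: "\<And>i. cpoly (D i)" "\<And>x. (f has_derivative (\<lambda>h. \<Sum>i\<in>UNIV. D i x * of_real (h $ i))) (at x)"
    and E: "\<And>i. cpoly (E i)" "\<And>x. (g has_derivative (\<lambda>h. \<Sum>i\<in>UNIV. E i x * of_real (h $ i))) (at x)"
    by blast
  have "((\<lambda>x. f x * g x) has_derivative (\<lambda>h. \<Sum>i\<in>UNIV. (f x * E i x + D i x * g x) * of_real (h $ i))) (at x)" for x
    using has_derivative_mult[OF D(2) E(2), of x]
    by (simp add: distrib_right distrib_left sum.distrib sum_distrib_left sum_distrib_right mult_ac)
  then show ?case using D(1) E(1) cpoly_mult.hyps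
    by (intro exI[of _ "\<lambda>i x. f x * E i x + D i x * g x"]) (auto intro!: cpoly.intros(3,4))
qed

lemma cpoly_bound:
  assumes "cpoly P"
  shows "\<exists>C d. C \<ge> 0 \<and> (\<forall>x. norm (P x) \<le> C * (1 + norm x) ^ d)"
  using assms
proof induction
  case (cpoly_const c)
  show ?case by (rule exI[of _ "norm c"], rule exI[of _ 0]) auto
next
  case (cpoly_coord i)
  have "norm (complex_of_real (x $ i)) \<le> 1 * (1 + norm x) ^ 1" for x
    using component_le_norm_cart[of x i] by simp
  then show ?case by (metis zero_le_one)
next
  case (cpoly_add f g)
  then obtain C d D e where *: "C \<ge> 0" "\<And>x. norm (f x) \<le> C * (1 + norm x) ^ d"
    "D \<ge> 0" "\<And>x. norm (g x) \<le> D * (1 + norm x) ^ e" by blast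
  have "norm (f x + g x) \<le> (C + D) * (1 + norm x) ^ (d + e)" for x
  proof -
    have "norm (f x + g x) \<le> C * (1 + norm x) ^ d + D * (1 + norm x) ^ e"
      using norm_triangle_ineq[of "f x" "g x"] *(2,4)[of x] by linarith
    also have "\<dots> \<le> C * (1 + norm x) ^ (d + e) + D * (1 + norm x) ^ (d + e)"
      by (intro add_mono mult_left_mono power_increasing) (use * in auto)
    finally show ?thesis by (simp add: distrib_right)
  qed
  then show ?case using * by (intro exI[of _ "C + D"] exI[of _ "d + e"]) auto
next
  case (cpoly_mult f g)
  then obtain C d D e where *: "C \<ge> 0" "\<And>x. norm (f x) \<le> C * (1 + norm x) ^ d"
    "D \<ge> 0" "\<And>x. norm (g x) \<le> D * (1 + norm x) ^ e" by blast
  have "norm (f x * g x) \<le> (C * D) * (1 + norm x) ^ (d + e)" for x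
    using mult_mono[OF *(2)[of x] *(4)[of x]] * by (simp add: norm_mult power_add mult_ac)
  then show ?case using * by (intro exI[of _ "C * D"] exI[of _ "d + e"]) auto
qed

text \<open>From \<open>(1 + s / n) ^ n \<le> exp s\<close> with \<open>n = Suc M\<close> and
  \<open>s = c * t\<^sup>2\<close>: the exponential dominates a power of
  \<open>1 + t\<^sup>2\<close> that beats \<open>(1 + t) ^ M\<close>.\<close>

lemma power_times_gaussian_bounded:
  fixes c :: real assumes c: "c > 0"
  shows "\<exists>K. \<forall>t\<ge>0. (1 + t) ^ M * exp (- c * t\<^sup>2) \<le> K"
proof -
  \<comment> \<open>Chosen so that
    \<open>k * (1 + t\<^sup>2) \<le> 1 + c * t\<^sup>2 / Suc M\<close>: the first entry handles the
    constant term, the second the quadratic one.\<close>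
  define k where "k = min 1 (c / real (Suc M))"
  have k: "k > 0" "k \<le> 1" "k \<le> c / real (Suc M)" using c by (auto simp: k_def)
  have "(1 + t) ^ M * exp (- c * t\<^sup>2) \<le> (2 / k) ^ Suc M" if "t \<ge> 0" for t
  proof -
    have "2 * t \<le> t\<^sup>2 + 1" using sum_squares_bound[of t 1] by simp
    then have 1: "1 + t \<le> 2 * (1 + t\<^sup>2)" using that zero_le_power2[of t] by (smt (verit))
    have "(1 + t) ^ M \<le> (1 + t) ^ Suc M" using that by (intro power_increasing) auto
    also have "\<dots> \<le> (2 / k * (k * (1 + t\<^sup>2))) ^ Suc M"
      using 1 k that by (intro power_mono) auto
    also have "\<dots> = (2 / k) ^ Suc M * (k * (1 + t\<^sup>2)) ^ Suc M"
      by (rule power_mult_distrib)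
    also have "\<dots> \<le> (2 / k) ^ Suc M * (1 + c * t\<^sup>2 / real (Suc M)) ^ Suc M"
    proof (intro mult_left_mono power_mono)
      have "k * t\<^sup>2 \<le> c / real (Suc M) * t\<^sup>2" using k by (intro mult_right_mono) auto
      then show "k * (1 + t\<^sup>2) \<le> 1 + c * t\<^sup>2 / real (Suc M)"
        using k by (simp add: distrib_left)
    qed (use k in auto)
    also have "\<dots> \<le> (2 / k) ^ Suc M * exp (c * t\<^sup>2)"
    proof (intro mult_left_mono)
      have "0 \<le> c * t\<^sup>2" using c by simp
      then show "(1 + c * t\<^sup>2 / real (Suc M)) ^ Suc M \<le> exp (c * t\<^sup>2)"
        by (intro exp_ge_one_plus_x_over_n_power_n) auto
    qed (use k in auto)
    finally have "(1 + t) ^ M * exp (- c * t\<^sup>2) \<le> (2 / k) ^ Suc M * exp (c * t\<^sup>2) * exp (- c * t\<^sup>2)"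
      by (rule mult_right_mono) auto
    also have "\<dots> = (2 / k) ^ Suc M" by (simp add: mult.assoc exp_add[symmetric] del: power_Suc)
    finally show ?thesis .
  qed
  then show ?thesis by blast
qed

text \<open>The logarithmic derivative of the kernel in the coordinate \<open>i\<close> of
  \<open>x\<close>; it is affine in \<open>x\<close>.\<close>

definition mehler_slope :: "complex \<Rightarrow> real^'n::finite \<Rightarrow> 'n \<Rightarrow> real^'n \<Rightarrow> complex" where
  "mehler_slope r y i x =
     - ((1 - r) / (1 + r)) / 2 * of_real (x $ i + y $ i) - (1 + r) / (1 - r) / 2 * of_real (x $ i - y $ i)"

lemma has_derivative_norm_square_shift:
  fixes y :: "real^'n::finite"
  shows "((\<lambda>x. complex_of_real ((norm (x + y))\<^sup>2 / 4)) has_derivative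
     (\<lambda>h. \<Sum>i\<in>UNIV. of_real ((x $ i + y $ i) / 2) * of_real (h $ i))) (at x)"
proof -
  have "((\<lambda>x. complex_of_real (((x + y) \<bullet> (x + y)) / 4)) has_derivative
      (\<lambda>h. of_real (((x + y) \<bullet> h + h \<bullet> (x + y)) / 4))) (at x)"
    by (auto intro!: derivative_eq_intros)
  moreover have "complex_of_real (((x + y) \<bullet> h + h \<bullet> (x + y)) / 4) =
     (\<Sum>i\<in>UNIV. of_real ((x $ i + y $ i) / 2) * of_real (h $ i))" for h
  proof -
    have "((x + y) \<bullet> h + h \<bullet> (x + y)) / 4 = ((x + y) \<bullet> h) / 2"
      by (simp add: inner_commute)
    also have "\<dots> = (\<Sum>i\<in>UNIV. (x $ i + y $ i) / 2 * (h $ i))"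
      by (simp add: inner_vec_def sum_divide_distrib)
    finally show ?thesis by simp
  qed
  ultimately show ?thesis by (simp only: power2_norm_eq_inner)
qed

lemma mehler_has_derivative:
  fixes y :: "real^'n::finite"
  shows "((\<lambda>x. mehler r x y) has_derivative
     (\<lambda>h. \<Sum>i\<in>UNIV. mehler_slope r y i x * mehler r x y * of_real (h $ i))) (at x)"
proof -
  define q where "q = (1 / csqrt (of_real pi * (1 - r\<^sup>2))) ^ CARD('n)"
  define a b where "a = (1 - r) / (1 + r)" and "b = (1 + r) / (1 - r)"
  define E where "E x = - a * of_real ((norm (x + y))\<^sup>2 / 4) - b * of_real ((norm (x + - y))\<^sup>2 / 4)" for x
  have m: "mehler r x y = q * exp (E x)" for x
    by (simp add: mehler_def q_def E_def a_def b_def)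
  have "(E has_derivative (\<lambda>h. - a * (\<Sum>i\<in>UNIV. of_real ((x $ i + y $ i) / 2) * of_real (h $ i))
      - b * (\<Sum>i\<in>UNIV. of_real ((x $ i + (- y) $ i) / 2) * of_real (h $ i)))) (at x)"
    unfolding E_def
    by (intro has_derivative_diff has_derivative_mult_right has_derivative_norm_square_shift)
  also have "(\<lambda>h. - a * (\<Sum>i\<in>UNIV. of_real ((x $ i + y $ i) / 2) * of_real (h $ i))
      - b * (\<Sum>i\<in>UNIV. of_real ((x $ i + (- y) $ i) / 2) * of_real (h $ i)))
     = (\<lambda>h. \<Sum>i\<in>UNIV. mehler_slope r y i x * of_real (h $ i))"
    unfolding mehler_slope_def a_def[symmetric] b_def[symmetric] sum_distrib_left sum_subtractf[symmetric]
    by (intro ext sum.cong refl) (simp add: algebra_simps add_divide_distrib diff_divide_distrib)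
  finally have E: "(E has_derivative (\<lambda>h. \<Sum>i\<in>UNIV. mehler_slope r y i x * of_real (h $ i))) (at x)" .
  have "((\<lambda>x. exp (E x)) has_derivative (\<lambda>h. (\<Sum>i\<in>UNIV. mehler_slope r y i x * of_real (h $ i)) * exp (E x))) (at x)"
    using has_derivative_compose[OF E DERIV_exp[THEN has_field_derivative_imp_has_derivative]]
    by (simp add: mult.commute)
  from has_derivative_mult_right[OF this, of q] show ?thesis
    unfolding m by (simp add: sum_distrib_left sum_distrib_right mult_ac)
qed

lemma cpoly_mehler_slope: "cpoly (mehler_slope r y i)"
proof -
  have "cpoly (\<lambda>x. (- ((1 - r) / (1 + r)) / 2) * (of_real (x $ i) + of_real (y $ i))
      + (- ((1 + r) / (1 - r)) / 2) * (of_real (x $ i) + of_real (- y $ i)))"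
    by (intro cpoly.intros)
  moreover have "mehler_slope r y i x = (- ((1 - r) / (1 + r)) / 2) * (of_real (x $ i) + of_real (y $ i))
      + (- ((1 + r) / (1 - r)) / 2) * (of_real (x $ i) + of_real (- y $ i))" for x
    by (simp add: mehler_slope_def)
  ultimately show ?thesis by presburger
qed

lemma cpoly_mehler_has_derivative:
  fixes y :: "real^'n::finite"
  assumes "(P has_derivative (\<lambda>h. \<Sum>i\<in>UNIV. D i * of_real (h $ i))) (at x)"
  shows "((\<lambda>x. P x * mehler r x y) has_derivative
     (\<lambda>h. \<Sum>i\<in>UNIV. (D i + P x * mehler_slope r y i x) * mehler r x y * of_real (h $ i))) (at x)"
  using has_derivative_mult[OF assms mehler_has_derivative[of r y x]]
  by (simp add: sum_distrib_left sum_distrib_right sum.distrib[symmetric] algebra_simps)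

text \<open>Polynomials times the kernel are closed under partial derivatives because the
  logarithmic derivative of the kernel is itself a polynomial. This reduces the Schwartz property to
  one Gaussian bound.\<close>

lemma partials_cpoly_mehler:
  fixes y :: "real^'n::finite"
  assumes "cpoly P"
  shows "\<exists>Q. cpoly Q \<and> partials is (\<lambda>x. P x * mehler r x y) = (\<lambda>x. Q x * mehler r x y)"
proof (induction "is")
  case Nil
  then show ?case using assms by (auto simp: partials_def)
next
  case (Cons i js)
  then obtain Q where Q: "cpoly Q" "partials js (\<lambda>x. P x * mehler r x y) = (\<lambda>x. Q x * mehler r x y)" by blast
  obtain D where D: "\<And>i. cpoly (D i)" "\<And>x. (Q has_derivative (\<lambda>h. \<Sum>i\<in>UNIV. D i x * of_real (h $ i))) (at x)"
    using cpoly_has_derivative[OF Q(1)] by blast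
  have "partials (i # js) (\<lambda>x. P x * mehler r x y) = partial i (\<lambda>x. Q x * mehler r x y)"
    using Q(2) by (simp add: partials_def)
  also have "\<dots> = (\<lambda>x. (D i x + Q x * mehler_slope r y i x) * mehler r x y)"
    by (rule ext, rule partial_eqI, rule cpoly_mehler_has_derivative, rule D)
  finally show ?case using D Q
    by (intro exI[of _ "\<lambda>x. D i x + Q x * mehler_slope r y i x"]) (auto intro!: cpoly.intros cpoly_mehler_slope)
qed

text \<open>The weak equation defining an eigenfunction may be tested only with Schwartz functions;
  this admits the kernel with \<open>y\<close> fixed as a test function.\<close>

lemma mehler_schwartz:
  fixes y :: "real^'n::finite"
  assumes r: "norm r < 1"
  shows "(\<lambda>x. mehler r x y) \<in> schwartz"
  unfolding schwartz_def
proof (intro CollectI allI conjI)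
  fix "is" :: "'n list"
  obtain Q where Q: "cpoly Q" "partials is (\<lambda>x. mehler r x y) = (\<lambda>x. Q x * mehler r x y)"
    using partials_cpoly_mehler[OF cpoly_const[of 1], of "is" r y] by auto
  show "partials is (\<lambda>x. mehler r x y) differentiable at x" for x
  proof -
    obtain D where "\<And>x. (Q has_derivative (\<lambda>h. \<Sum>i\<in>UNIV. D i x * of_real (h $ i))) (at x)"
      using cpoly_has_derivative[OF Q(1)] by blast
    from cpoly_mehler_has_derivative[OF this] show ?thesis
      unfolding Q(2) differentiable_def by blast
  qed
  fix N :: nat
  obtain C d where C: "C \<ge> 0" "\<And>x. norm (Q x) \<le> C * (1 + norm x) ^ d"
    using cpoly_bound[OF Q(1)] by blast
  define R where "R = norm r"
  define c where "c = (1 - R\<^sup>2) / 8"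
  have c: "c > 0" using r by (simp add: c_def R_def abs_square_less_1)
  define A where "A = (1 / sqrt (pi * (1 - R\<^sup>2))) ^ CARD('n) * exp (- c * (norm y)\<^sup>2)"
  have "R\<^sup>2 < 1" using r by (simp add: R_def abs_square_less_1)
  then have A: "A \<ge> 0" by (simp add: A_def)
  obtain K where K: "\<And>t. t \<ge> 0 \<Longrightarrow> (1 + t) ^ (N + d) * exp (- c * t\<^sup>2) \<le> K"
    using power_times_gaussian_bounded[OF c] by blast
  have "norm ((1 + norm x) ^ N *\<^sub>R (Q x * mehler r x y)) \<le> C * A * K" for x
  proof -
    have m: "norm (mehler r x y) \<le> A * exp (- c * (norm x)\<^sup>2)"
      using norm_mehler_le_gaussian[of r R x y] r unfolding A_def c_def R_def by (simp add: mult_ac)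
    have "norm ((1 + norm x) ^ N *\<^sub>R (Q x * mehler r x y)) = (1 + norm x) ^ N * (norm (Q x) * norm (mehler r x y))"
      by (simp add: norm_mult)
    also have "\<dots> \<le> (1 + norm x) ^ N * ((C * (1 + norm x) ^ d) * (A * exp (- c * (norm x)\<^sup>2)))"
      by (intro mult_left_mono mult_mono C m) (use C in auto)
    also have "\<dots> = C * A * ((1 + norm x) ^ (N + d) * exp (- c * (norm x)\<^sup>2))"
      by (simp add: power_add mult_ac)
    also have "\<dots> \<le> C * A * K"
      by (intro mult_left_mono K) (use C A in auto)
    finally show ?thesis .
  qed
  then show "bounded (range (\<lambda>x. (1 + norm x) ^ N *\<^sub>R partials is (\<lambda>x. mehler r x y) x))"
    unfolding Q(2) bounded_iff by blast
qed

section \<open>The evolution equation of the kernel\<close>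

lemma laplacian_mehler:
  fixes y :: "real^'n::finite"
  shows "laplacian (\<lambda>x. mehler r x y) x =
    (\<Sum>i\<in>UNIV. (- ((1 - r) / (1 + r)) / 2 - (1 + r) / (1 - r) / 2) + (mehler_slope r y i x)\<^sup>2) * mehler r x y"
proof -
  define k where "k = - ((1 - r) / (1 + r)) / 2 - (1 + r) / (1 - r) / 2"
  have 1: "partial i (\<lambda>x. mehler r x y) = (\<lambda>x. mehler_slope r y i x * mehler r x y)" for i
    by (rule ext, rule partial_eqI[OF mehler_has_derivative])
  have 2: "(mehler_slope r y i has_derivative (\<lambda>h. \<Sum>j\<in>UNIV. (if j = i then k else 0) * of_real (h $ j))) (at x)" for i
  proof -
    have "(\<lambda>x. k * of_real (x $ i) + mehler_slope r y i 0) = mehler_slope r y i"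
      by (rule ext) (simp add: mehler_slope_def k_def algebra_simps add_divide_distrib diff_divide_distrib)
    moreover have "((\<lambda>x. k * of_real (x $ i) + mehler_slope r y i 0) has_derivative
       (\<lambda>h. k * (\<Sum>j\<in>UNIV. (if j = i then 1 else 0) * of_real (h $ j)) + 0)) (at x)"
      by (intro has_derivative_add has_derivative_mult_right has_derivative_coord has_derivative_const)
    ultimately show ?thesis by (simp add: sum_distrib_left if_distrib if_distribR cong: if_cong)
  qed
  have "partial i (\<lambda>x. mehler_slope r y i x * mehler r x y) x = (k + (mehler_slope r y i x)\<^sup>2) * mehler r x y" for i
    using partial_eqI[OF cpoly_mehler_has_derivative[OF 2], of i i r y] by (simp add: power2_eq_square)
  then show ?thesis
    unfolding laplacian_def 1 by (simp add: k_def sum_distrib_right)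
qed

lemma hermite_mehler:
  fixes y :: "real^'n::finite"
  assumes r: "norm r < 1"
  shows "- laplacian (\<lambda>x. mehler r x y) x + of_real ((norm x)\<^sup>2) * mehler r x y
    = 2 * r * deriv (\<lambda>r. mehler r x y) r + of_nat CARD('n) * mehler r x y"
proof -
  note d = unit_disc_facts[OF r]
  define a b where "a = (1 - r) / (1 + r)" and "b = (1 + r) / (1 - r)"
  define P Q where "P = complex_of_real ((norm (x + y))\<^sup>2)" and "Q = complex_of_real ((norm (x - y))\<^sup>2)"
  \<comment> \<open>The coefficients are reciprocal, so the cross term in the squared gradient is
    free of \<open>r\<close>. Together with \<open>(norm x)\<^sup>2\<close> it becomes a multiple of
    \<open>P + Q\<close>, and only \<open>P\<close> and \<open>Q\<close> remain to be matched with
    the derivative in \<open>r\<close>.\<close>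
  have ab: "a * b = 1" using d by (simp add: a_def b_def)
  have sq: "(\<Sum>i\<in>UNIV. (mehler_slope r y i x)\<^sup>2) = a\<^sup>2 / 4 * P + b\<^sup>2 / 4 * Q + of_real ((norm x)\<^sup>2 - (norm y)\<^sup>2) / 2"
  proof -
    have "(mehler_slope r y i x)\<^sup>2 = a\<^sup>2 / 4 * of_real ((x $ i + y $ i)\<^sup>2) + b\<^sup>2 / 4 * of_real ((x $ i - y $ i)\<^sup>2)
        + of_real ((x $ i)\<^sup>2 - (y $ i)\<^sup>2) / 2" for i
    proof -
      have "(mehler_slope r y i x)\<^sup>2 = a\<^sup>2 / 4 * of_real ((x $ i + y $ i)\<^sup>2) + b\<^sup>2 / 4 * of_real ((x $ i - y $ i)\<^sup>2)
        + (a * b) * of_real ((x $ i)\<^sup>2 - (y $ i)\<^sup>2) / 2"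
        unfolding mehler_slope_def a_def[symmetric] b_def[symmetric]
        by (simp add: power2_eq_square field_simps)
      then show ?thesis by (simp add: ab)
    qed
    moreover have "P = (\<Sum>i\<in>UNIV. of_real ((x $ i + y $ i)\<^sup>2))" "Q = (\<Sum>i\<in>UNIV. of_real ((x $ i - y $ i)\<^sup>2))"
      "complex_of_real ((norm x)\<^sup>2 - (norm y)\<^sup>2) = (\<Sum>i\<in>UNIV. of_real ((x $ i)\<^sup>2 - (y $ i)\<^sup>2))"
      unfolding P_def Q_def power2_norm_eq_inner inner_vec_def
      by (simp_all add: power2_eq_square sum_subtractf)
    ultimately show ?thesis
      by (simp add: sum.distrib sum_distrib_left sum_divide_distrib)
  qed
  have PQ: "complex_of_real ((norm x)\<^sup>2) - of_real ((norm x)\<^sup>2 - (norm y)\<^sup>2) / 2 = (P + Q) / 4"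
  proof -
    have "P + Q = of_real (2 * ((norm x)\<^sup>2 + (norm y)\<^sup>2))"
      unfolding P_def Q_def parallelogram_norm[symmetric] by simp
    then show ?thesis by (simp add: field_simps)
  qed
  have f: "1 - r\<^sup>2 = (1 + r) * (1 - r)" by (simp add: power2_eq_square algebra_simps)
  have 1: "(1 - a\<^sup>2) / 4 = r / (1 + r)\<^sup>2" "(1 - b\<^sup>2) / 4 = - r / (1 - r)\<^sup>2"
    unfolding a_def b_def power_divide using d by (simp_all add: divide_simps) (simp_all add: power2_eq_square algebra_simps)
  have 2: "(a + b) / 2 = 2 * r * (r / (1 - r\<^sup>2)) + 1"
    unfolding a_def b_def f using d by (simp add: divide_simps) (simp add: power2_eq_square algebra_simps)
  have "- laplacian (\<lambda>x. mehler r x y) x + of_real ((norm x)\<^sup>2) * mehler r x y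
     = (of_nat CARD('n) * ((a + b) / 2) - (a\<^sup>2 / 4 * P + b\<^sup>2 / 4 * Q + of_real ((norm x)\<^sup>2 - (norm y)\<^sup>2) / 2) + of_real ((norm x)\<^sup>2)) * mehler r x y"
    unfolding laplacian_mehler a_def[symmetric] b_def[symmetric] sum.distrib sq
    by (simp add: algebra_simps add_divide_distrib)
  also have "\<dots> = (of_nat CARD('n) * ((a + b) / 2) + (1 - a\<^sup>2) / 4 * P + (1 - b\<^sup>2) / 4 * Q) * mehler r x y"
    using PQ by (simp add: algebra_simps add_divide_distrib diff_divide_distrib)
  also have "\<dots> = 2 * r * ((of_nat CARD('n) * r / (1 - r\<^sup>2) + of_real ((norm (x + y))\<^sup>2 / 2) / (1 + r)\<^sup>2
        - of_real ((norm (x - y))\<^sup>2 / 2) / (1 - r)\<^sup>2) * mehler r x y) + of_nat CARD('n) * mehler r x y"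
    unfolding 1 2 P_def Q_def by (simp add: algebra_simps)
  finally show ?thesis
    using DERIV_imp_deriv[OF mehler_has_field_derivative[OF r, of x y]] by simp
qed

text \<open>Differentiating the equation \<open>j\<close> times and evaluating at the origin kills every Taylor coefficient but one.\<close>
lemma euler_equation_solution:
  assumes hol: "F holomorphic_on ball 0 1"
    and ode: "\<And>r. r \<in> ball 0 1 \<Longrightarrow> 2 * r * deriv F r = (k - n) * F r"
  shows "\<And>m r. k = n + 2 * of_nat m \<Longrightarrow> r \<in> ball 0 1 \<Longrightarrow> F r = (deriv ^^ m) F 0 / fact m * r ^ m"
    and "\<And>r. (\<And>m. k \<noteq> n + 2 * of_nat m) \<Longrightarrow> r \<in> ball 0 1 \<Longrightarrow> F r = 0"
proof -
  have iter: "2 * r * (deriv ^^ Suc j) F r = (k - n - 2 * of_nat j) * (deriv ^^ j) F r" if "r \<in> ball 0 1" for j r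
    using that
  proof (induction j arbitrary: r)
    case 0
    then show ?case using ode by simp
  next
    case (Suc j)
    have h: "((deriv ^^ i) F has_field_derivative (deriv ^^ Suc i) F r) (at r)" for i
      using holomorphic_derivI[OF holomorphic_higher_deriv[OF hol] _ Suc.prems] by simp
    have "((\<lambda>r. 2 * r * (deriv ^^ Suc j) F r) has_field_derivative
        2 * (deriv ^^ Suc j) F r + 2 * r * (deriv ^^ Suc (Suc j)) F r) (at r)"
      by (rule DERIV_cong[OF DERIV_mult[OF DERIV_cmult[OF DERIV_ident] h]]) simp
    then have "((\<lambda>r. (k - n - 2 * of_nat j) * (deriv ^^ j) F r) has_field_derivative
        2 * (deriv ^^ Suc j) F r + 2 * r * (deriv ^^ Suc (Suc j)) F r) (at r)"
      by (rule has_field_derivative_transform_within_open[OF _ open_ball Suc.prems Suc.IH])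
    from DERIV_unique[OF this DERIV_cmult[OF h]] show ?case
      by (simp add: algebra_simps)
  qed
  have coeff: "(deriv ^^ j) F 0 = 0" if "k \<noteq> n + 2 * of_nat j" for j
  proof -
    have "(k - n - 2 * of_nat j) * (deriv ^^ j) F 0 = 0" using iter[of 0 j] by simp
    moreover have "k - n - 2 * of_nat j \<noteq> 0" using that by (auto simp: algebra_simps)
    ultimately show ?thesis by simp
  qed
  have series: "(\<lambda>j. (deriv ^^ j) F 0 / fact j * r ^ j) sums F r" if "r \<in> ball 0 1" for r
    using holomorphic_power_series[OF hol that] by simp
  show "F r = (deriv ^^ m) F 0 / fact m * r ^ m" if k: "k = n + 2 * of_nat m" and r: "r \<in> ball 0 1" for m r
  proof -
    have "(deriv ^^ j) F 0 / fact j * r ^ j = (if j = m then (deriv ^^ m) F 0 / fact m * r ^ m else 0)" for j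
      using coeff[of j] k by auto
    with series[OF r] have "(\<lambda>j. if j = m then (deriv ^^ m) F 0 / fact m * r ^ m else 0) sums F r"
      by simp
    from sums_unique2[OF this sums_single] show ?thesis .
  qed
  show "F r = 0" if "\<And>m. k \<noteq> n + 2 * of_nat m" and r: "r \<in> ball 0 1" for r
  proof -
    from series[OF r] have "(\<lambda>j. 0) sums F r" using coeff that by simp
    from sums_unique2[OF this sums_zero] show ?thesis .
  qed
qed

lemma mehler_L2: assumes "norm r < 1" shows "(\<lambda>x. mehler r x y) \<in> L2"
proof -
  define R where "R = norm r"
  have R: "R\<^sup>2 < 1" using assms by (simp add: R_def abs_square_less_1)
  define c where "c = (1 - R\<^sup>2) / 8"
  define A where "A = (1 / sqrt (pi * (1 - R\<^sup>2))) ^ CARD('a) * exp (- c * (norm y)\<^sup>2)"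
  have m: "norm (mehler r x y) \<le> A * exp (- c * (norm x)\<^sup>2)" for x
    using norm_mehler_le_gaussian[of r R x y] assms unfolding A_def c_def R_def by (simp add: mult_ac)
  show ?thesis
  proof (rule L2_dominated)
    show "(norm (mehler r x y))\<^sup>2 \<le> A\<^sup>2 * exp (- (2 * c) * (norm (x - 0))\<^sup>2)" for x
      using power_mono[OF m norm_ge_zero, of x 2] by (simp add: power_mult_distrib exp_double[symmetric] mult_ac)
    show "integrable lborel (\<lambda>x::real^'a. A\<^sup>2 * exp (- (2 * c) * (norm (x - 0))\<^sup>2))"
      using R by (intro integrable_mult_right integrable_gaussian) (simp add: c_def)
  qed measurable
qed

lemma gaussian_L2: assumes "c > 0" shows "(\<lambda>x::real^'n::finite. of_real (K * exp (- c * (norm x)\<^sup>2))) \<in> L2"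
proof (rule L2_dominated)
  show "(norm (complex_of_real (K * exp (- c * (norm x)\<^sup>2))))\<^sup>2 \<le> K\<^sup>2 * exp (- (2 * c) * (norm (x - 0))\<^sup>2)"
    for x :: "real^'n"
  proof -
    have "K\<^sup>2 * exp (- (2 * c) * (norm (x - 0))\<^sup>2) = (K * exp (- c * (norm x)\<^sup>2))\<^sup>2"
      by (simp add: power_mult_distrib exp_double[symmetric] mult_ac)
    then show ?thesis by (simp only: norm_of_real power2_abs)
  qed
  show "integrable lborel (\<lambda>x::real^'n. K\<^sup>2 * exp (- (2 * c) * (norm (x - 0))\<^sup>2))"
    using assms by (intro integrable_mult_right integrable_gaussian) simp
qed measurable

lemma mehler_integral_has_field_derivative:
  fixes u :: "real^'n::finite \<Rightarrow> complex"
  assumes u: "u \<in> L2" and r: "norm r < 1"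
  shows "integrable lborel (\<lambda>x. u x * deriv (\<lambda>r. mehler r x y) r)"
    and "((\<lambda>r. \<integral>x. u x * mehler r x y \<partial>lborel) has_field_derivative
     (LBINT x. u x * deriv (\<lambda>r. mehler r x y) r)) (at r)"
proof -
  \<comment> \<open>A radius strictly between gives one Gaussian dominating the kernel on a whole
    neighbourhood of \<open>r\<close>.\<close>
  obtain R where R: "norm r < R" "R < 1" using dense[OF r] by blast
  have R0: "R > 0" using R norm_ge_zero[of r] by linarith
  define c where "c = (1 - R\<^sup>2) / 8"
  define A where "A = (1 / sqrt (pi * (1 - R\<^sup>2))) ^ CARD('n) * exp (- c * (norm y)\<^sup>2)"
  have c: "c > 0" using R R0 by (simp add: c_def abs_square_less_1)
  have m: "norm (mehler z x y) \<le> A * exp (- c * (norm x)\<^sup>2)" if "z \<in> ball 0 R" for x z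
    using norm_mehler_le_gaussian[of z R x y] that R unfolding A_def c_def by (simp add: mult_ac)
  have A: "A \<ge> 0" using c by (simp add: A_def c_def)
  note um [measurable] = L2_measurable[OF u]
  have 1: "(\<lambda>z. u x * mehler z x y) holomorphic_on ball 0 R" for x
    using R by (intro holomorphic_intros holomorphic_on_subset[OF mehler_holomorphic]) auto
  have 2: "integrable lborel (\<lambda>x. norm (u x * of_real (A * exp (- c * (norm x)\<^sup>2))))"
    by (intro integrable_norm L2_mult_integrable[OF u gaussian_L2[OF c]])
  have 3: "norm (u x * mehler z x y) \<le> norm (u x * of_real (A * exp (- c * (norm x)\<^sup>2)))"
    if "z \<in> ball 0 R" for z x
    unfolding norm_mult norm_of_real using m[OF that] A by (intro mult_left_mono) auto
  have 4: "deriv (\<lambda>r. u x * mehler r x y) r = u x * deriv (\<lambda>r. mehler r x y) r" for x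
    using mehler_has_field_derivative[OF r] by (intro deriv_cmult) (auto simp: field_differentiable_def)
  have 5: "(\<lambda>x. u x * mehler z x y) \<in> borel_measurable lborel" for z
    by measurable
  note * = has_field_derivative_lebesgue_integral[OF open_ball 1 5 2 3, of r, unfolded 4]
  show "integrable lborel (\<lambda>x. u x * deriv (\<lambda>r. mehler r x y) r)"
    "((\<lambda>r. \<integral>x. u x * mehler r x y \<partial>lborel) has_field_derivative
     (LBINT x. u x * deriv (\<lambda>r. mehler r x y) r)) (at r)"
    using * R by auto
qed

lemma mehler_integral_holomorphic:
  assumes "u \<in> L2"
  shows "(\<lambda>r. \<integral>x. u x * mehler r x y \<partial>lborel) holomorphic_on ball 0 1"
proof -
  have "\<exists>D. ((\<lambda>r. \<integral>x. u x * mehler r x y \<partial>lborel) has_field_derivative D) (at r)" if "r \<in> ball 0 1" for r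
    using mehler_integral_has_field_derivative(2)[OF assms, of r y] that by auto
  then show ?thesis by (simp add: holomorphic_on_open)
qed

text \<open>Testing the weak equation with the kernel in \<open>x\<close>, for fixed
  \<open>y\<close>, moves \<open>H\<close> onto the kernel, where it acts as an Euler operator in
  \<open>r\<close>. Differentiation under the integral turns this into an ordinary differential
  equation for the pairing.\<close>

lemma mehler_integral_eigenfunction:
  fixes u :: "real^'n::finite \<Rightarrow> complex"
  assumes u: "u \<in> hermite_eigenspace k"
  shows "\<And>m r. k = of_nat CARD('n) + 2 * of_nat m \<Longrightarrow> norm r < 1 \<Longrightarrow>
      \<exists>c. \<forall>r. norm r < 1 \<longrightarrow> (LBINT x. u x * mehler r x y) = c * r ^ m"
    and "\<And>r. (\<And>m. k \<noteq> of_nat CARD('n) + 2 * of_nat m) \<Longrightarrow> norm r < 1 \<Longrightarrow> (LBINT x. u x * mehler r x y) = 0"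
proof -
  have uL: "u \<in> L2" using u by (simp add: hermite_eigenspace_def hermite_op_def)
  define F where "F r = (LBINT x. u x * mehler r x y)" for r
  have hol: "F holomorphic_on ball 0 1"
    unfolding F_def by (rule mehler_integral_holomorphic[OF uL])
  have ode: "2 * r * deriv F r = (k - of_nat CARD('n)) * F r" if "r \<in> ball 0 1" for r
  proof -
    have r: "norm r < 1" using that by simp
    have D: "deriv F r = (LBINT x. u x * deriv (\<lambda>r. mehler r x y) r)"
      unfolding F_def by (rule DERIV_imp_deriv[OF mehler_integral_has_field_derivative(2)[OF uL r]])
    have "(LBINT x. u x * (- laplacian (\<lambda>x. mehler r x y) x + of_real ((norm x)\<^sup>2) * mehler r x y))
       = (LBINT x. k * u x * mehler r x y)"
      using u mehler_schwartz[OF r, of y] unfolding hermite_eigenspace_def hermite_op_def by blast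
    also have "\<dots> = k * F r" by (simp add: F_def mult.assoc)
    also have "(LBINT x. u x * (- laplacian (\<lambda>x. mehler r x y) x + of_real ((norm x)\<^sup>2) * mehler r x y))
       = (LBINT x. 2 * r * (u x * deriv (\<lambda>r. mehler r x y) r) + of_nat CARD('n) * (u x * mehler r x y))"
      unfolding hermite_mehler[OF r] by (intro Bochner_Integration.integral_cong refl) (simp add: algebra_simps)
    finally have eq: "(LBINT x. 2 * r * (u x * deriv (\<lambda>r. mehler r x y) r) + of_nat CARD('n) * (u x * mehler r x y)) = k * F r" .
    have i1: "integrable lborel (\<lambda>x. u x * mehler r x y)"
      by (rule L2_mult_integrable[OF uL mehler_L2[OF r]])
    have "(LBINT x. 2 * r * (u x * deriv (\<lambda>r. mehler r x y) r) + of_nat CARD('n) * (u x * mehler r x y))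
       = 2 * r * deriv F r + of_nat CARD('n) * F r"
      unfolding D F_def using i1 mehler_integral_has_field_derivative(1)[OF uL r, of y] by simp
    with eq show ?thesis by (simp add: algebra_simps)
  qed
  show "\<exists>c. \<forall>r. norm r < 1 \<longrightarrow> (LBINT x. u x * mehler r x y) = c * r ^ m"
    if "k = of_nat CARD('n) + 2 * of_nat m" for m
    using euler_equation_solution(1)[OF hol ode that, folded F_def]
    by (intro exI[of _ "(deriv ^^ m) F 0 / fact m"]) (auto simp: F_def[symmetric])
  show "(LBINT x. u x * mehler r x y) = 0"
    if "\<And>m. k \<noteq> of_nat CARD('n) + 2 * of_nat m" "norm r < 1" for r
    using euler_equation_solution(2)[OF hol ode that(1)] that(2) by (auto simp: F_def)
qed

section \<open>The Mehler semigroup\<close>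

definition mehler_op :: "complex \<Rightarrow> (real^'n::finite \<Rightarrow> complex) \<Rightarrow> real^'n \<Rightarrow> complex" where
  "mehler_op r f y = (LBINT x. f x * mehler r x y)"

lemma mehler_op_scale: "mehler_op r (\<lambda>x. c * f x) y = c * mehler_op r f y"
  by (simp add: mehler_op_def mult.assoc)

lemma mehler_op_diff:
  assumes "norm r < 1" "f \<in> L2" "g \<in> L2"
  shows "mehler_op r (\<lambda>x. f x - g x) y = mehler_op r f y - mehler_op r g y"
  using L2_mult_integrable[OF assms(2) mehler_L2[OF assms(1)]] L2_mult_integrable[OF assms(3) mehler_L2[OF assms(1)]]
  by (simp add: mehler_op_def left_diff_distrib)

lemma cnj_mehler_op:
  assumes "norm r < 1"
  shows "cnj (mehler_op r f y) = mehler_op (cnj r) (\<lambda>x. cnj (f x)) y"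
  unfolding mehler_op_def by (simp add: cnj_mehler[OF assms] flip: Bochner_Integration.integral_cnj)

lemma mehler_op_measurable:
  assumes "f \<in> L2" shows "mehler_op r f \<in> borel_measurable borel"
proof -
  note [measurable] = L2_measurable[OF assms]
  show ?thesis unfolding mehler_op_def by measurable
qed

lemma mehler_gaussian_dominated:
  assumes "norm r < 1"
  obtains K c where "K > 0" "c > 0"
    "\<And>x y :: real^'n::finite. norm (mehler r x y) \<le> K * (exp (- c * (norm x)\<^sup>2) * exp (- c * (norm y)\<^sup>2))"
proof
  have R: "(norm r)\<^sup>2 < 1" using assms by (simp add: abs_square_less_1)
  show "(1 / sqrt (pi * (1 - (norm r)\<^sup>2))) ^ CARD('n) > 0" "(1 - (norm r)\<^sup>2) / 8 > 0"
    using R by simp_all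
  show "norm (mehler r x y) \<le> (1 / sqrt (pi * (1 - (norm r)\<^sup>2))) ^ CARD('n) *
      (exp (- ((1 - (norm r)\<^sup>2) / 8) * (norm x)\<^sup>2) * exp (- ((1 - (norm r)\<^sup>2) / 8) * (norm y)\<^sup>2))"
    for x y :: "real^'n"
    by (rule norm_mehler_le_gaussian[OF order_refl assms])
qed

lemma mehler_op_dominated:
  fixes f :: "real^'n::finite \<Rightarrow> complex"
  assumes r: "norm r < 1" and f: "f \<in> L2"
  obtains K c where "c > 0" "\<And>y. norm (mehler_op r f y) \<le> K * exp (- c * (norm y)\<^sup>2)"
proof -
  obtain K c where K: "K > 0" "c > 0"
    "\<And>x y :: real^'n. norm (mehler r x y) \<le> K * (exp (- c * (norm x)\<^sup>2) * exp (- c * (norm y)\<^sup>2))"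
    using mehler_gaussian_dominated[OF r] by metis
  define I where "I = (LBINT x. norm (f x * of_real (1 * exp (- c * (norm x)\<^sup>2))))"
  have i: "integrable lborel (\<lambda>x. norm (f x * of_real (1 * exp (- c * (norm x)\<^sup>2))))"
    by (intro integrable_norm L2_mult_integrable[OF f gaussian_L2] K)
  have "norm (mehler_op r f y) \<le> (K * I) * exp (- c * (norm y)\<^sup>2)" for y
  proof -
    have "norm (mehler_op r f y) \<le> (LBINT x. norm (f x * mehler r x y))"
      unfolding mehler_op_def by (rule integral_norm_bound)
    also have "\<dots> \<le> (LBINT x. K * exp (- c * (norm y)\<^sup>2) * norm (f x * of_real (1 * exp (- c * (norm x)\<^sup>2))))"
    proof (rule integral_mono)
      show "integrable lborel (\<lambda>x. norm (f x * mehler r x y))"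
        by (intro integrable_norm L2_mult_integrable[OF f mehler_L2[OF r]])
      show "norm (f x * mehler r x y) \<le> K * exp (- c * (norm y)\<^sup>2) * norm (f x * of_real (1 * exp (- c * (norm x)\<^sup>2)))" for x
        using mult_left_mono[OF K(3)[of x y] norm_ge_zero[of "f x"]] by (simp add: norm_mult mult_ac)
    qed (use i in auto)
    also have "\<dots> = (K * I) * exp (- c * (norm y)\<^sup>2)" by (simp add: I_def)
    finally show ?thesis .
  qed
  with K(2) that show ?thesis by blast
qed

lemma mehler_op_L2:
  fixes f :: "real^'n::finite \<Rightarrow> complex"
  assumes r: "norm r < 1" and f: "f \<in> L2" shows "mehler_op r f \<in> L2"
proof -
  obtain K c where K: "c > 0" "\<And>y. norm (mehler_op r f y) \<le> K * exp (- c * (norm y)\<^sup>2)"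
    using mehler_op_dominated[OF assms] by metis
  show ?thesis
  proof (rule L2_dominated)
    show "(norm (mehler_op r f y))\<^sup>2 \<le> (norm (complex_of_real (K * exp (- c * (norm y)\<^sup>2))))\<^sup>2" for y
      using K(2)[of y] unfolding norm_of_real power2_abs by (intro power_mono) auto
    show "integrable lborel (\<lambda>y::real^'n. (norm (complex_of_real (K * exp (- c * (norm y)\<^sup>2))))\<^sup>2)"
      by (rule L2_square_integrable[OF gaussian_L2[OF K(1)]])
  qed (use mehler_op_measurable[OF f] in simp)
qed

lemma integrable_lborel_pair_prod:
  fixes f g :: "real^'n::finite \<Rightarrow> complex"
  assumes "integrable lborel f" "integrable lborel g"
  shows "integrable (lborel \<Otimes>\<^sub>M lborel) (\<lambda>(x, y). f x * g y)"
proof (rule lborel_pair.Fubini_integrable)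
  note [measurable] = assms[THEN borel_measurable_integrable]
  show "(\<lambda>(x, y). f x * g y) \<in> borel_measurable (lborel \<Otimes>\<^sub>M lborel)" by measurable
qed (use assms in \<open>auto simp: norm_mult\<close>)

lemma integrable_mehler_pair:
  fixes f g :: "real^'n::finite \<Rightarrow> complex"
  assumes r: "norm r < 1" and f: "f \<in> borel_measurable borel" and g: "g \<in> borel_measurable borel"
    and fi: "\<And>c. c > 0 \<Longrightarrow> integrable lborel (\<lambda>x. f x * of_real (1 * exp (- c * (norm x)\<^sup>2)))"
    and gi: "\<And>c. c > 0 \<Longrightarrow> integrable lborel (\<lambda>x. g x * of_real (1 * exp (- c * (norm x)\<^sup>2)))"
  shows "integrable (lborel \<Otimes>\<^sub>M lborel) (\<lambda>(x, y). f x * mehler r x y * g y)"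
proof -
  obtain K c where K: "K > 0" "c > 0"
    "\<And>x y :: real^'n. norm (mehler r x y) \<le> K * (exp (- c * (norm x)\<^sup>2) * exp (- c * (norm y)\<^sup>2))"
    using mehler_gaussian_dominated[OF r] by metis
  note [measurable] = f g
  show ?thesis
  proof (rule Bochner_Integration.integrable_bound)
    show "integrable (lborel \<Otimes>\<^sub>M lborel) (\<lambda>p. of_real K *
      (\<lambda>(x, y). (f x * of_real (1 * exp (- c * (norm x)\<^sup>2))) * (g y * of_real (1 * exp (- c * (norm y)\<^sup>2)))) p)"
      by (intro integrable_mult_right integrable_lborel_pair_prod fi gi K)
    show "AE p in lborel \<Otimes>\<^sub>M lborel. norm ((\<lambda>(x, y). f x * mehler r x y * g y) p) \<le>
      norm (of_real K * (\<lambda>(x, y). (f x * of_real (1 * exp (- c * (norm x)\<^sup>2))) * (g y * of_real (1 * exp (- c * (norm y)\<^sup>2)))) p)"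
    proof (rule AE_I2, clarify)
      fix x y
      have "norm (f x) * norm (mehler r x y) * norm (g y) \<le>
        norm (f x) * (K * (exp (- c * (norm x)\<^sup>2) * exp (- c * (norm y)\<^sup>2))) * norm (g y)"
        by (intro mult_right_mono mult_left_mono K) auto
      then show "norm (f x * mehler r x y * g y) \<le>
        norm (of_real K * ((f x * of_real (1 * exp (- c * (norm x)\<^sup>2))) * (g y * of_real (1 * exp (- c * (norm y)\<^sup>2)))))"
        using K(1) by (simp add: norm_mult mult_ac)
    qed
  qed measurable
qed

text \<open>The pairing is bilinear, without conjugation: the kernel is symmetric in
  \<open>x\<close> and \<open>y\<close>, but for complex \<open>r\<close> it is not
  Hermitian.\<close>

lemma mehler_op_symmetric:
  fixes f g :: "real^'n::finite \<Rightarrow> complex"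
  assumes r: "norm r < 1" and f: "f \<in> L2" and g: "g \<in> L2"
  shows "(LBINT x. mehler_op r f x * g x) = (LBINT x. f x * mehler_op r g x)"
proof -
  have i: "integrable (lborel \<Otimes>\<^sub>M lborel) (\<lambda>(x, y). f x * mehler r x y * g y)"
    by (intro integrable_mehler_pair r f[THEN L2_measurable] g[THEN L2_measurable] L2_mult_integrable f g gaussian_L2)
  have "(LBINT y. mehler_op r f y * g y) = (LBINT y. (LBINT x. f x * mehler r x y * g y))"
    unfolding mehler_op_def by simp
  also have "\<dots> = (LBINT x. (LBINT y. f x * mehler r x y * g y))"
    by (rule lborel_pair.Fubini_integral[OF i])
  also have "\<dots> = (LBINT x. f x * mehler_op r g x)"
  proof (intro Bochner_Integration.integral_cong refl)
    fix x
    have "(LBINT y. f x * mehler r x y * g y) = (LBINT y. f x * (g y * mehler r y x))"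
      by (intro Bochner_Integration.integral_cong refl) (simp add: mehler_commute[of r x] mult_ac)
    then show "(LBINT y. f x * mehler r x y * g y) = f x * mehler_op r g x"
      by (simp add: mehler_op_def)
  qed
  finally show ?thesis .
qed

section \<open>Analytic continuation and the semigroup law\<close>

lemma of_real_unit_interval_islimpt: "(0::complex) islimpt (of_real ` {0<..<1})"
  unfolding islimpt_sequential
proof (intro exI conjI allI)
  let ?f = "\<lambda>n. complex_of_real (inverse (real (Suc (Suc n))))"
  show "?f n \<in> of_real ` {0<..<1} - {0}" for n
  proof -
    have "inverse (real (Suc (Suc n))) \<in> {0<..<1}" by (simp add: field_simps)
    then show ?thesis by (metis (no_types) DiffI image_eqI of_real_eq_0_iff greaterThanLessThan_iff less_irrefl singletonD)
  qed
  show "?f \<longlonglongrightarrow> 0"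
    using tendsto_of_real[OF LIMSEQ_Suc[OF LIMSEQ_inverse_real_of_nat], where 'a=complex] by simp
qed

lemma unit_disc_identity_theorem:
  fixes F G :: "complex \<Rightarrow> complex"
  assumes "F holomorphic_on ball 0 1" "G holomorphic_on ball 0 1"
    and "\<And>r. 0 < r \<Longrightarrow> r < 1 \<Longrightarrow> F (of_real r) = G (of_real r)" and "norm z < 1"
  shows "F z = G z"
proof -
  have "F z - G z = 0"
    by (rule analytic_continuation[where f="\<lambda>z. F z - G z" and S="ball 0 1" and U="of_real ` {0<..<1}" and \<xi>=0])
       (use assms of_real_unit_interval_islimpt in \<open>auto intro: holomorphic_intros\<close>)
  then show ?thesis by simp
qed

text \<open>Both sides are holomorphic in each parameter, so the law for real parameters extends to
  the disc one variable at a time.\<close>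

lemma mehler_semigroup:
  fixes x y :: "real^'n::finite"
  assumes r: "norm r < 1" and s: "norm s < 1"
  shows "mehler_op r (\<lambda>z. mehler s z y) x = mehler (r * s) x y"
proof -
  have rs: "norm (a * b) < 1" if "norm a < 1" "norm b < 1" for a b :: complex
    using mult_strict_mono[of "norm a" 1 "norm b" 1] that by (simp add: norm_mult)
  have hol: "(\<lambda>t. mehler_op t (\<lambda>z. mehler b z w) v) holomorphic_on ball 0 1" if "norm b < 1" for b and v w :: "real^'n"
    unfolding mehler_op_def by (rule mehler_integral_holomorphic[OF mehler_L2[OF that]])
  have hol2: "(\<lambda>t. mehler (t * b) v w) holomorphic_on ball 0 1" if "norm b < 1" for b and v w :: "real^'n"
  proof (rule holomorphic_on_compose_gen[of "\<lambda>t. t * b" _ "\<lambda>t. mehler t v w" "ball 0 1", unfolded o_def])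
    show "(\<lambda>t. t * b) ` ball 0 1 \<subseteq> ball 0 1" using rs[OF _ that] by auto
  qed (auto intro!: holomorphic_intros mehler_holomorphic)
  have real: "mehler_op (of_real a) (\<lambda>z. mehler (of_real b) z w) v = mehler (of_real a * of_real b) v w"
    if "0 < a" "a < 1" "0 < b" "b < 1" for a b and v w :: "real^'n"
    using mehler_semigroup_real[OF that, of v w]
    by (simp add: mehler_op_def mult.commute[of "mehler (of_real b) _ _"] mehler_commute[of _ _ v])
  have half: "mehler_op a (\<lambda>z. mehler (of_real b) z w) v = mehler (a * of_real b) v w"
    if "norm a < 1" "0 < b" "b < 1" for a b and v w :: "real^'n"
    by (rule unit_disc_identity_theorem[where F="\<lambda>a. mehler_op a (\<lambda>z. mehler (of_real b) z w) v", OF hol hol2])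
       (use real that in auto)
  \<comment> \<open>The integrand is symmetric under exchanging \<open>(a, v)\<close> with
    \<open>(b, w)\<close>. Hence continuation in the second parameter is continuation in the first
    with the roles exchanged.\<close>
  have sym: "mehler_op a (\<lambda>z. mehler b z w) v = mehler_op b (\<lambda>z. mehler a z v) w" for a b and v w :: "real^'n"
    unfolding mehler_op_def by (simp add: mult.commute)
  have "mehler_op s (\<lambda>z. mehler r z x) y = mehler (s * r) y x"
    by (rule unit_disc_identity_theorem[where F="\<lambda>s. mehler_op s (\<lambda>z. mehler r z x) y", OF hol[OF r] hol2[OF r]])
       (use half r s sym in \<open>auto simp: mult.commute mehler_commute[of _ y x]\<close>)
  then show ?thesis by (simp add: sym[of r] mult.commute mehler_commute[of _ y x])
qed

text \<open>The outer operator is a pairing with a kernel row; symmetry moves the inner operator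
  onto that row, where the law for kernels applies.\<close>

lemma mehler_op_semigroup:
  assumes r: "norm r < 1" and s: "norm s < 1" and f: "f \<in> L2"
  shows "mehler_op r (mehler_op s f) x = mehler_op (r * s) f x"
proof -
  have "mehler_op r (mehler_op s f) x = (LBINT y. f y * mehler_op s (\<lambda>z. mehler r z x) y)"
    unfolding mehler_op_def[of r] by (rule mehler_op_symmetric[OF s f mehler_L2[OF r]])
  also have "\<dots> = mehler_op (r * s) f x"
    unfolding mehler_semigroup[OF s r] mehler_op_def[of "r * s"] by (simp add: mult.commute)
  finally show ?thesis .
qed

section \<open>Boundedness on square integrable functions\<close>

lemma mehler_of_real_le:
  fixes x y :: "real^'n::finite"
  assumes "0 < r" "r < 1"
  shows "norm (mehler (of_real r) x y) \<le> sqrt (1 / (pi * (1 - r\<^sup>2))) ^ CARD('n) * exp (- (r / (1 - r\<^sup>2)) * (norm (x - y))\<^sup>2)"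
proof -
  have r2: "r\<^sup>2 < 1" using assms by (simp add: abs_square_less_1)
  \<comment> \<open>This splits off the coefficient that combines with the inner product into
    \<open>(norm (x - y))\<^sup>2\<close>; the remainder is nonnegative and is dropped.\<close>
  have 1: "(1 + r\<^sup>2) / (2 * (1 - r\<^sup>2)) = r / (1 - r\<^sup>2) + (1 - r)\<^sup>2 / (2 * (1 - r\<^sup>2))"
    using r2 by (simp add: divide_simps) (simp add: power2_eq_square algebra_simps)
  have 2: "(norm (x - y))\<^sup>2 = (norm x)\<^sup>2 + (norm y)\<^sup>2 - 2 * (x \<bullet> y)"
    unfolding power2_norm_eq_inner by (simp add: inner_simps inner_commute)
  have "- ((1 + r\<^sup>2) / (2 * (1 - r\<^sup>2))) * ((norm x)\<^sup>2 + (norm y)\<^sup>2) + 2 * r / (1 - r\<^sup>2) * (x \<bullet> y)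
     = - (r / (1 - r\<^sup>2)) * (norm (x - y))\<^sup>2 - (1 - r)\<^sup>2 / (2 * (1 - r\<^sup>2)) * ((norm x)\<^sup>2 + (norm y)\<^sup>2)"
  proof -
    define p q where "p = r / (1 - r\<^sup>2)" and "q = (1 - r)\<^sup>2 / (2 * (1 - r\<^sup>2))"
    have "2 * r / (1 - r\<^sup>2) = 2 * p" by (simp add: p_def)
    then show ?thesis unfolding 1 2 p_def[symmetric] q_def[symmetric] by (simp add: algebra_simps)
  qed
  also have "\<dots> \<le> - (r / (1 - r\<^sup>2)) * (norm (x - y))\<^sup>2"
    using r2 by simp
  finally show ?thesis
    unfolding mehler_of_real[OF less_imp_le[OF assms(1)] assms(2)] norm_of_real
    using r2 by (subst abs_of_nonneg) (auto intro!: mult_left_mono)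
qed

lemma integral_norm_mehler_of_real_le:
  fixes x :: "real^'n::finite"
  assumes r: "0 < r" "r < 1"
  shows "(LBINT y. norm (mehler (of_real r) x y)) \<le> (1 / sqrt r) ^ CARD('n)"
proof -
  have r2: "r\<^sup>2 < 1" using assms by (simp add: abs_square_less_1)
  have c: "r / (1 - r\<^sup>2) > 0" using r r2 by simp
  have "(LBINT y. norm (mehler (of_real r) x y)) \<le>
     (LBINT y. sqrt (1 / (pi * (1 - r\<^sup>2))) ^ CARD('n) * exp (- (r / (1 - r\<^sup>2)) * (norm (y - x))\<^sup>2))"
  proof (rule integral_mono')
    show "integrable lborel (\<lambda>y. sqrt (1 / (pi * (1 - r\<^sup>2))) ^ CARD('n) * exp (- (r / (1 - r\<^sup>2)) * (norm (y - x))\<^sup>2))"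
      by (intro integrable_mult_right integrable_gaussian c)
    show "norm (mehler (of_real r) x y) \<le> sqrt (1 / (pi * (1 - r\<^sup>2))) ^ CARD('n) * exp (- (r / (1 - r\<^sup>2)) * (norm (y - x))\<^sup>2)" for y
      using mehler_of_real_le[OF r, of x y] by (simp add: norm_minus_commute)
  qed (use r2 in auto)
  also have "\<dots> = sqrt (1 / (pi * (1 - r\<^sup>2))) ^ CARD('n) * sqrt (pi / (r / (1 - r\<^sup>2))) ^ CARD('n)"
    by (simp only: integral_mult_right_zero integral_gaussian[OF c])
  also have "\<dots> = (1 / sqrt r) ^ CARD('n)"
    unfolding power_mult_distrib[symmetric] real_sqrt_mult[symmetric] using r2
    by (simp add: real_sqrt_divide)
  finally show ?thesis .
qed

text \<open>Schur's test, using that the kernel is positive for real parameters.\<close>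
lemma mehler_op_of_real_form_bound:
  fixes f :: "real^'n::finite \<Rightarrow> complex"
  assumes r: "0 < r" "r < 1" and f: "f \<in> L2"
  shows "norm (LBINT x. f x * mehler_op (of_real r) (\<lambda>x. cnj (f x)) x) \<le> (1 / sqrt r) ^ CARD('n) * (l2norm f)\<^sup>2"
proof -
  have nr: "norm (complex_of_real r) < 1" using r by simp
  define N where "N x y = norm (mehler (of_real r) x y)" for x y :: "real^'n"
  have N: "mehler (of_real r) x y = of_real (N x y)" for x y
    unfolding N_def using mehler_of_real_pos[of r x y] r by simp
  have N0: "N x y \<ge> 0" for x y by (simp add: N_def)
  define F where "F x = complex_of_real ((norm (f x))\<^sup>2)" for x
  have Fi: "integrable lborel F" unfolding F_def by (rule integrable_of_real[OF L2_square_integrable[OF f]])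
  have fm [measurable]: "f \<in> borel_measurable borel" by (rule L2_measurable[OF f])
  have Fm [measurable]: "F \<in> borel_measurable borel" unfolding F_def by measurable
  have FG: "integrable lborel (\<lambda>x. F x * of_real (1 * exp (- c * (norm x)\<^sup>2)))" if "c > 0" for c
  proof (rule Bochner_Integration.integrable_bound[OF Fi])
    show "AE x in lborel. norm (F x * of_real (1 * exp (- c * (norm x)\<^sup>2))) \<le> norm (F x)"
      using that by (intro AE_I2) (simp add: norm_mult mult_left_le)
  qed measurable
  have 1: "integrable lborel (\<lambda>x. 1 * complex_of_real (1 * exp (- c * (norm (x::real^'n))\<^sup>2)))" if "c > 0" for c
    using integrable_gaussian[OF that, of "0::real^'n"] by (simp del: of_real_exp)
  let ?M = "lborel \<Otimes>\<^sub>M lborel :: ((real^'n) \<times> (real^'n)) measure"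
  let ?F = "\<lambda>(x, y). F x * mehler (of_real r) x y * 1"
  let ?G = "\<lambda>(x, y). 1 * mehler (of_real r) x y * F y"
  let ?H = "\<lambda>(x, y). f x * mehler (of_real r) x y * cnj (f y)"
  have i1: "integrable ?M ?F"
    by (intro integrable_mehler_pair nr Fm FG 1) auto
  have i2: "integrable ?M ?G"
    by (intro integrable_mehler_pair nr Fm FG 1) auto
  have i3: "integrable ?M ?H"
    by (intro integrable_mehler_pair nr L2_measurable L2_mult_integrable f L2_cnj gaussian_L2)
  have I1: "norm (\<integral>p. ?F p \<partial>?M) \<le> (1 / sqrt r) ^ CARD('n) * (l2norm f)\<^sup>2"
  proof -
    have "(\<integral>p. ?F p \<partial>?M) =
       (LBINT x. (LBINT y. F x * mehler (of_real r) x y * 1))"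
      using lborel_pair.integral_fst'[OF i1] by simp
    also have "\<dots> = (LBINT x. of_real ((norm (f x))\<^sup>2 * (LBINT y. N x y)))"
      unfolding N F_def by (simp del: of_real_power)
    also have "norm \<dots> \<le> (LBINT x. norm (complex_of_real ((norm (f x))\<^sup>2 * (LBINT y. N x y))))"
      by (rule integral_norm_bound)
    also have "\<dots> \<le> (LBINT x. (1 / sqrt r) ^ CARD('n) * (norm (f x))\<^sup>2)"
    proof (rule integral_mono')
      show "integrable lborel (\<lambda>x. (1 / sqrt r) ^ CARD('n) * (norm (f x))\<^sup>2)"
        using L2_square_integrable[OF f] by simp
      have I: "0 \<le> (LBINT y. N x y)" for x using N0 by (intro integral_nonneg_AE) auto
      show "norm (complex_of_real ((norm (f x))\<^sup>2 * (LBINT y. N x y))) \<le> (1 / sqrt r) ^ CARD('n) * (norm (f x))\<^sup>2" for x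
        unfolding norm_of_real using I integral_norm_mehler_of_real_le[OF r, of x, folded N_def]
        by (subst abs_of_nonneg) (auto simp: mult.commute[of "(1 / sqrt r) ^ CARD('n)"] intro!: mult_left_mono)
    qed (use r in auto)
    finally show ?thesis by (simp add: l2norm_square)
  qed
  have I2: "(\<integral>p. ?G p \<partial>?M) =
     (\<integral>p. ?F p \<partial>?M)"
  proof -
    have "(\<integral>p. ?G p \<partial>?M) =
       (LBINT y. (LBINT x. 1 * mehler (of_real r) x y * F y))"
      using lborel_pair.integral_snd[of "\<lambda>x y. 1 * mehler (of_real r) x y * F y"] i2 by simp
    also have "\<dots> = (LBINT y. (LBINT x. F y * mehler (of_real r) y x * 1))"
      by (simp add: mult.commute mehler_commute)
    also have "\<dots> = (\<integral>p. ?F p \<partial>?M)"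
      using lborel_pair.integral_fst'[OF i1] by simp
    finally show ?thesis .
  qed
  have "(LBINT x. f x * mehler_op (of_real r) (\<lambda>x. cnj (f x)) x) =
      (LBINT x. (LBINT y. f x * mehler (of_real r) x y * cnj (f y)))"
  proof (intro Bochner_Integration.integral_cong refl)
    fix x
    have "(LBINT y. f x * mehler (of_real r) x y * cnj (f y)) = (LBINT y. f x * (cnj (f y) * mehler (of_real r) y x))"
      by (intro Bochner_Integration.integral_cong refl) (simp add: mehler_commute[of _ x] mult_ac)
    then show "f x * mehler_op (of_real r) (\<lambda>x. cnj (f x)) x = (LBINT y. f x * mehler (of_real r) x y * cnj (f y))"
      by (simp add: mehler_op_def)
  qed
  also have "\<dots> = (\<integral>p. ?H p \<partial>?M)"
    using lborel_pair.integral_fst'[OF i3] by simp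
  also have "norm \<dots> \<le> (\<integral>p. norm (?H p) \<partial>?M)"
    by (rule integral_norm_bound)
  \<comment> \<open>Pointwise \<open>2 * norm (f x) * norm (f y)\<close> is at most the sum of the
    squares. Each square is then integrated first in the other variable, where only a row integral
    of the kernel is left.\<close>
  also have "\<dots> \<le> (\<integral>p. (norm (?F p) + norm (?G p)) / 2 \<partial>?M)"
  proof (rule integral_mono)
    show "norm (?H p) \<le>
      (norm (?F p) + norm (?G p)) / 2" for p
    proof (cases p)
      case (Pair x y)
      have "N x y * (2 * norm (f x) * norm (f y)) \<le> N x y * ((norm (f x))\<^sup>2 + (norm (f y))\<^sup>2)"
        by (intro mult_left_mono sum_squares_bound N0)
      then show ?thesis using N0[of x y] unfolding Pair N F_def by (simp add: norm_mult norm_power algebra_simps)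
    qed
  qed (use i1 i2 i3 in \<open>auto simp del: mult_1_right mult_1_left intro!: integrable_norm Bochner_Integration.integrable_add Bochner_Integration.integrable_divide\<close>)
  also have "\<dots> = (norm (\<integral>p. ?F p \<partial>?M) +
     norm (\<integral>p. ?G p \<partial>?M)) / 2"
  proof -
    have eq: "(\<integral>p. norm (G p) \<partial>?M) = norm (\<integral>p. G p \<partial>?M)"
      if "\<And>p. G p = of_real (norm (G p))" for G :: "(real^'n) \<times> (real^'n) \<Rightarrow> complex"
    proof -
      have "(\<integral>p. G p \<partial>?M) = of_real (\<integral>p. norm (G p) \<partial>?M)"
        by (subst that) (rule integral_complex_of_real)
      then show ?thesis by (simp add: integral_nonneg_AE)
    qed
    have "(\<integral>p. norm (?F p) \<partial>?M) =
      norm (\<integral>p. ?F p \<partial>?M)"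
      by (rule eq) (auto simp: N F_def norm_mult norm_power N0)
    moreover have "(\<integral>p. norm (?G p) \<partial>?M) =
      norm (\<integral>p. ?G p \<partial>?M)"
      by (rule eq) (auto simp: N F_def norm_mult norm_power N0)
    ultimately show ?thesis
      using Bochner_Integration.integral_add[OF integrable_norm[OF i1] integrable_norm[OF i2]]
      by (simp only: Bochner_Integration.integral_divide_zero)
  qed
  also have "\<dots> \<le> (1 / sqrt r) ^ CARD('n) * (l2norm f)\<^sup>2"
    using I1 unfolding I2 by (simp add: case_prod_unfold)
  finally show ?thesis .
qed

text \<open>The adjoint of \<open>U r\<close> is \<open>U (cnj r)\<close>, so the squared norm is
  the quadratic form of the kernel at \<open>(norm r)\<^sup>2\<close>. The constant tends to 1 as
  \<open>norm r\<close> tends to 1; the approximation of the identity depends on this.\<close>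

lemma l2norm_mehler_op:
  fixes f :: "real^'n::finite \<Rightarrow> complex"
  assumes r: "norm r < 1" "r \<noteq> 0" and f: "f \<in> L2"
  shows "(l2norm (mehler_op r f))\<^sup>2 \<le> (1 / norm r) ^ CARD('n) * (l2norm f)\<^sup>2"
proof -
  define \<rho> where "\<rho> = (norm r)\<^sup>2"
  have \<rho>: "0 < \<rho>" "\<rho> < 1" using r by (auto simp: \<rho>_def abs_square_less_1)
  have c: "norm (cnj r) < 1" using r by simp
  have "complex_of_real ((l2norm (mehler_op r f))\<^sup>2) = (LBINT x. mehler_op r f x * mehler_op (cnj r) (\<lambda>x. cnj (f x)) x)"
    unfolding integral_mult_cnj_self[symmetric] by (simp add: cnj_mehler_op[OF r(1)])
  also have "\<dots> = (LBINT x. f x * mehler_op r (mehler_op (cnj r) (\<lambda>x. cnj (f x))) x)"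
    by (rule mehler_op_symmetric[OF r(1) f mehler_op_L2[OF c L2_cnj[OF f]]])
  also have "\<dots> = (LBINT x. f x * mehler_op (of_real \<rho>) (\<lambda>x. cnj (f x)) x)"
    unfolding mehler_op_semigroup[OF r(1) c L2_cnj[OF f]] \<rho>_def complex_norm_square ..
  finally have "(l2norm (mehler_op r f))\<^sup>2 = norm (LBINT x. f x * mehler_op (of_real \<rho>) (\<lambda>x. cnj (f x)) x)"
    by (metis norm_of_real abs_of_nonneg zero_le_power2)
  also have "\<dots> \<le> (1 / sqrt \<rho>) ^ CARD('n) * (l2norm f)\<^sup>2"
    by (rule mehler_op_of_real_form_bound[OF \<rho> f])
  finally show ?thesis by (simp add: \<rho>_def)
qed

lemma mehler_op_dispersive:
  fixes f g :: "real^'n::finite \<Rightarrow> complex"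
  assumes r: "norm r < 1" and f: "f \<in> L2" "integrable lborel f" and g: "g \<in> L2" "integrable lborel g"
  shows "norm (LBINT x. mehler_op r f x * g x) \<le>
    (1 / sqrt (pi * norm (1 - r\<^sup>2))) ^ CARD('n) * (LBINT x. norm (f x)) * (LBINT x. norm (g x))"
proof -
  define B where "B = (1 / sqrt (pi * norm (1 - r\<^sup>2))) ^ CARD('n)"
  have b: "norm (mehler_op r f y) \<le> B * (LBINT x. norm (f x))" for y
  proof -
    have "norm (mehler_op r f y) \<le> (LBINT x. norm (f x * mehler r x y))"
      unfolding mehler_op_def by (rule integral_norm_bound)
    also have "\<dots> \<le> (LBINT x. B * norm (f x))"
    proof (rule integral_mono')
      fix x
      have "norm (mehler r x y) \<le> B" unfolding B_def by (rule norm_mehler_le_dispersive[OF r])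
      then show "norm (f x * mehler r x y) \<le> B * norm (f x)"
        by (simp add: norm_mult mult.commute[of B] mult_left_mono)
    qed (use f(2) in \<open>auto simp: B_def\<close>)
    finally show ?thesis by simp
  qed
  have "norm (LBINT x. mehler_op r f x * g x) \<le> (LBINT x. norm (mehler_op r f x * g x))"
    by (rule integral_norm_bound)
  also have "\<dots> \<le> (LBINT x. B * (LBINT x. norm (f x)) * norm (g x))"
  proof (rule integral_mono')
    have "0 \<le> B * (LBINT x. norm (f x))" using b[of 0] norm_ge_zero order_trans by blast
    then show "0 \<le> B * (LBINT x. norm (f x)) * norm (g x)" for x by simp
    show "norm (mehler_op r f x * g x) \<le> B * (LBINT x. norm (f x)) * norm (g x)" for x
      unfolding norm_mult by (rule mult_right_mono[OF b]) simp
  qed (use g(2) in auto)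
  finally show ?thesis by (simp add: B_def)
qed

section \<open>Approximation of the identity\<close>

lemma indicator_L2:
  fixes A :: "(real^'n::finite) set"
  assumes "A \<in> sets borel" "emeasure lborel A < \<infinity>"
  shows "(\<lambda>x. complex_of_real (indicator A x)) \<in> L2"
proof -
  have "integrable lborel (\<lambda>x. indicator A x :: real)" using assms by (simp add: integrable_indicator_iff)
  then show ?thesis
    using assms by (intro L2_dominated[of _ "indicator A"]) (auto simp: indicator_def)
qed

lemma l2norm_indicator:
  fixes A :: "(real^'n::finite) set"
  assumes "A \<in> sets borel" "emeasure lborel A < \<infinity>"
  shows "(l2norm (\<lambda>x. complex_of_real (indicator A x)))\<^sup>2 = measure lborel A"
proof -
  have "(norm (complex_of_real (indicator A x)))\<^sup>2 = indicator A x" for x by (auto simp: indicator_def)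
  then show ?thesis using assms by (simp add: l2norm_square)
qed

lemma integral_lborel_affine:
  fixes f :: "real^'n::finite \<Rightarrow> 'b::{banach, second_countable_topology}"
  assumes "c \<noteq> 0" "f \<in> borel_measurable borel"
  shows "(LBINT x. f x) = \<bar>c\<bar> ^ CARD('n) *\<^sub>R (LBINT x. f (t + c *\<^sub>R x))"
proof -
  note [measurable] = assms(2)
  have "(LBINT x. f x) = (\<integral>x. f x \<partial>density (distr lborel borel (\<lambda>x. t + c *\<^sub>R x)) (\<lambda>_. \<bar>c\<bar> ^ DIM(real^'n)))"
    using lborel_affine[OF assms(1), of t] by simp
  also have "\<dots> = (\<integral>x. \<bar>c\<bar> ^ CARD('n) *\<^sub>R f x \<partial>distr lborel borel (\<lambda>x. t + c *\<^sub>R x))"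
    by (subst integral_density) auto
  also have "\<dots> = \<bar>c\<bar> ^ CARD('n) *\<^sub>R (LBINT x. f (t + c *\<^sub>R x))"
    by (subst integral_distr) auto
  finally show ?thesis .
qed

text \<open>After the substitution \<open>y = x + t z\<close> with \<open>t\<^sup>2 = (1 - s\<^sup>2) / s\<close> the kernel becomes a fixed Gaussian
  in \<open>z\<close> times factors tending to 1.\<close>
lemma mehler_op_indicator_tendsto:
  fixes V :: "(real^'n::finite) set" and s :: "nat \<Rightarrow> real"
  assumes V: "open V" and x: "x \<in> V" and s: "\<And>j. 0 < s j" "\<And>j. s j < 1" "s \<longlonglongrightarrow> 1"
  shows "(\<lambda>j. mehler_op (of_real (s j)) (\<lambda>y. of_real (indicator V y)) x) \<longlonglongrightarrow> 1"
proof -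
  define N where "N = CARD('n)"
  define t where "t j = sqrt ((1 - (s j)\<^sup>2) / s j)" for j
  define m where "m j = (1 - s j) / (2 * (1 + s j))" for j
  define K where "K j = (1 / sqrt (s j * pi)) ^ N" for j
  have s2: "(s j)\<^sup>2 < 1" for j using s(1,2)[of j] by (simp add: abs_square_less_1)
  have t: "t j > 0" "(t j)\<^sup>2 = (1 - (s j)\<^sup>2) / s j" for j
    using s(1)[of j] s2[of j] by (auto simp: t_def)
  have sm: "s \<longlonglongrightarrow> 1" by (rule s(3))
  have tl: "t \<longlonglongrightarrow> 0"
  proof -
    have "t \<longlonglongrightarrow> sqrt ((1 - 1\<^sup>2) / 1)" unfolding t_def
      by (intro tendsto_intros sm) auto
    then show ?thesis by simp
  qed
  have ml: "m \<longlonglongrightarrow> 0"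
  proof -
    have "m \<longlonglongrightarrow> (1 - 1) / (2 * (1 + 1))" unfolding m_def
      by (intro tendsto_intros sm) auto
    then show ?thesis by simp
  qed
  have Kl: "K \<longlonglongrightarrow> (1 / sqrt pi) ^ N"
  proof -
    have "K \<longlonglongrightarrow> (1 / sqrt (1 * pi)) ^ N" unfolding K_def
      by (intro tendsto_intros sm) auto
    then show ?thesis by simp
  qed
  define g where "g j z = indicator V (x + t j *\<^sub>R z) * (exp (- (norm z)\<^sup>2) * exp (- m j * ((norm (x + t j *\<^sub>R z))\<^sup>2 + (norm x)\<^sup>2)))"
    for j and z :: "real^'n"
  have gm [measurable]: "g j \<in> borel_measurable borel" for j
    unfolding g_def using borel_open[OF V] by measurable
  have eq: "mehler_op (of_real (s j)) (\<lambda>y. of_real (indicator V y)) x = of_real (K j * (LBINT z. g j z))" for j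
  proof -
    have "mehler_op (of_real (s j)) (\<lambda>y. of_real (indicator V y)) x =
        of_real (\<bar>t j\<bar> ^ CARD('n)) * (LBINT z. of_real (indicator V (x + t j *\<^sub>R z)) * mehler (of_real (s j)) (x + t j *\<^sub>R z) x)"
      unfolding mehler_op_def
      using borel_open[OF V] t(1)[of j]
      by (subst integral_lborel_affine[where c="t j" and t=x]) (auto simp: scaleR_conv_of_real)
    also have "\<dots> = (LBINT z. of_real (\<bar>t j\<bar> ^ CARD('n)) * (of_real (indicator V (x + t j *\<^sub>R z)) * mehler (of_real (s j)) (x + t j *\<^sub>R z) x))"
      by simp
    also have "\<dots> = (LBINT z. complex_of_real (K j * g j z))"
    proof (intro Bochner_Integration.integral_cong refl)
      fix z
      define y where "y = x + t j *\<^sub>R z"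
      have "(norm (y - x))\<^sup>2 = (t j)\<^sup>2 * (norm z)\<^sup>2"
        by (simp add: y_def power_mult_distrib)
      then have nz: "(norm z)\<^sup>2 = s j / (1 - (s j)\<^sup>2) * (norm (y - x))\<^sup>2"
        unfolding t(2) using s(1)[of j] s2[of j] by simp
      have 1: "1 - (s j)\<^sup>2 = (1 + s j) * (1 - s j)" by (simp add: power2_eq_square algebra_simps)
      have 2: "(1 + (s j)\<^sup>2) / (2 * (1 - (s j)\<^sup>2)) = s j / (1 - (s j)\<^sup>2) + m j"
        unfolding m_def 1 using s(1,2)[of j] by (simp add: divide_simps) (simp add: power2_eq_square algebra_simps)
      have 3: "(norm (y - x))\<^sup>2 = (norm y)\<^sup>2 + (norm x)\<^sup>2 - 2 * (y \<bullet> x)"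
        unfolding power2_norm_eq_inner by (simp add: inner_simps inner_commute)
      define p where "p = s j / (1 - (s j)\<^sup>2)"
      have p2: "2 * s j / (1 - (s j)\<^sup>2) = 2 * p" by (simp add: p_def)
      have e: "- ((1 + (s j)\<^sup>2) / (2 * (1 - (s j)\<^sup>2))) * ((norm y)\<^sup>2 + (norm x)\<^sup>2) + 2 * s j / (1 - (s j)\<^sup>2) * (y \<bullet> x)
         = - (norm z)\<^sup>2 + - m j * ((norm y)\<^sup>2 + (norm x)\<^sup>2)"
        unfolding nz 2 3 p_def[symmetric] p2 by (simp add: algebra_simps)
      have k: "\<bar>t j\<bar> ^ CARD('n) * sqrt (1 / (pi * (1 - (s j)\<^sup>2))) ^ CARD('n) = K j"
      proof -
        have "(1 - (s j)\<^sup>2) / s j * (1 / (pi * (1 - (s j)\<^sup>2))) = 1 / (s j * pi)"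
          using s2[of j] by simp
        then have "sqrt ((1 - (s j)\<^sup>2) / s j) * sqrt (1 / (pi * (1 - (s j)\<^sup>2))) = sqrt (1 / (s j * pi))"
          by (simp only: real_sqrt_mult[symmetric])
        moreover have "\<bar>t j\<bar> = sqrt ((1 - (s j)\<^sup>2) / s j)" using t(1)[of j] by (simp add: t_def)
        moreover have "sqrt (1 / (s j * pi)) = 1 / sqrt (s j * pi)" by (simp add: real_sqrt_divide)
        ultimately show ?thesis by (simp only: K_def N_def power_mult_distrib[symmetric])
      qed
      have M: "mehler (of_real (s j)) y x = of_real (sqrt (1 / (pi * (1 - (s j)\<^sup>2))) ^ CARD('n) * (exp (- (norm z)\<^sup>2) * exp (- m j * ((norm y)\<^sup>2 + (norm x)\<^sup>2))))"
        unfolding mehler_of_real[OF less_imp_le[OF s(1)] s(2)] e exp_add ..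
      show "of_real (\<bar>t j\<bar> ^ CARD('n)) * (of_real (indicator V (x + t j *\<^sub>R z)) * mehler (of_real (s j)) (x + t j *\<^sub>R z) x)
         = complex_of_real (K j * g j z)"
        unfolding y_def[symmetric] M k[symmetric] g_def by simp
    qed
    also have "\<dots> = of_real (K j * (LBINT z. g j z))"
      by (simp only: integral_complex_of_real integral_mult_right_zero)
    finally show ?thesis .
  qed
  have "(\<lambda>j. \<integral>z. g j z \<partial>lborel) \<longlonglongrightarrow> (\<integral>z. exp (- 1 * (norm (z - 0))\<^sup>2) \<partial>(lborel :: (real^'n) measure))"
  proof (rule integral_dominated_convergence)
    show "integrable lborel (\<lambda>z::real^'n. exp (- 1 * (norm (z - 0))\<^sup>2))" by (rule integrable_gaussian) simp
    show "AE z in lborel. norm (g j z) \<le> exp (- 1 * (norm (z - 0))\<^sup>2)" for j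
    proof (rule AE_I2)
      fix z
      have "m j \<ge> 0" using s(1,2)[of j] by (simp add: m_def)
      then have "exp (- m j * ((norm (x + t j *\<^sub>R z))\<^sup>2 + (norm x)\<^sup>2)) \<le> 1" by simp
      then show "norm (g j z) \<le> exp (- 1 * (norm (z - 0))\<^sup>2)"
        by (auto simp: g_def indicator_def abs_mult mult_left_le)
    qed
    show "AE z in lborel. (\<lambda>j. g j z) \<longlonglongrightarrow> exp (- 1 * (norm (z - 0))\<^sup>2)"
    proof (rule AE_I2)
      fix z
      have y: "(\<lambda>j. x + t j *\<^sub>R z) \<longlonglongrightarrow> x + 0 *\<^sub>R z" by (intro tendsto_intros tl)
      \<comment> \<open>Since \<open>V\<close> is open, the indicator equals 1 along the rescaled
        points from some index on.\<close>
      have ev: "eventually (\<lambda>j. x + t j *\<^sub>R z \<in> V) sequentially"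
        using topological_tendstoD[OF y V] x by simp
      have "(\<lambda>j. exp (- (norm z)\<^sup>2) * exp (- m j * ((norm (x + t j *\<^sub>R z))\<^sup>2 + (norm x)\<^sup>2)))
         \<longlonglongrightarrow> exp (- (norm z)\<^sup>2) * exp (- 0 * ((norm (x + 0 *\<^sub>R z))\<^sup>2 + (norm x)\<^sup>2))"
        by (intro tendsto_intros ml y tl)
      then have "(\<lambda>j. exp (- (norm z)\<^sup>2) * exp (- m j * ((norm (x + t j *\<^sub>R z))\<^sup>2 + (norm x)\<^sup>2)))
         \<longlonglongrightarrow> exp (- 1 * (norm (z - 0))\<^sup>2)" by simp
      then show "(\<lambda>j. g j z) \<longlonglongrightarrow> exp (- 1 * (norm (z - 0))\<^sup>2)"
        by (rule Lim_transform_eventually) (use ev in \<open>auto elim!: eventually_mono simp: g_def\<close>)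
    qed
  qed measurable
  from tendsto_mult[OF Kl this]
  have "(\<lambda>j. K j * (LBINT z. g j z)) \<longlonglongrightarrow> (1 / sqrt pi) ^ N * sqrt (pi / 1) ^ CARD('n)"
    unfolding integral_gaussian[OF zero_less_one] .
  also have "(1 / sqrt pi) ^ N * sqrt (pi / 1) ^ CARD('n) = 1"
    by (simp add: N_def power_mult_distrib[symmetric])
  finally show ?thesis unfolding eq using tendsto_of_real by fastforce
qed

lemma mehler_op_indicator_le:
  fixes A :: "(real^'n::finite) set"
  assumes s: "0 < s" "s < 1" and A: "A \<in> sets borel"
  shows "norm (mehler_op (of_real s) (\<lambda>y. of_real (indicator A y)) x) \<le> (1 / sqrt s) ^ CARD('n)"
proof -
  have ns: "norm (complex_of_real s) < 1" using s by simp
  obtain K c where K: "K > 0" "c > 0"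
    "\<And>x y :: real^'n. norm (mehler (of_real s) x y) \<le> K * (exp (- c * (norm x)\<^sup>2) * exp (- c * (norm y)\<^sup>2))"
    using mehler_gaussian_dominated[OF ns] by metis
  have i: "integrable lborel (\<lambda>y. norm (mehler (of_real s) x y))"
  proof (rule Bochner_Integration.integrable_bound)
    show "integrable lborel (\<lambda>y::real^'n. K * exp (- c * (norm x)\<^sup>2) * exp (- c * (norm (y - 0))\<^sup>2))"
      by (intro integrable_mult_right integrable_gaussian K)
    show "AE y in lborel. norm (norm (mehler (of_real s) x y)) \<le> norm (K * exp (- c * (norm x)\<^sup>2) * exp (- c * (norm (y - 0))\<^sup>2))"
      using K(3)[of x] K(1) by (intro AE_I2) (simp add: mult.assoc)
  qed measurable
  have "norm (mehler_op (of_real s) (\<lambda>y. of_real (indicator A y)) x) \<le> (LBINT y. norm (of_real (indicator A y) * mehler (of_real s) y x))"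
    unfolding mehler_op_def by (rule integral_norm_bound)
  also have "\<dots> \<le> (LBINT y. norm (mehler (of_real s) x y))"
    by (rule integral_mono'[OF i]) (auto simp: indicator_def mehler_commute[of _ x])
  also have "\<dots> \<le> (1 / sqrt s) ^ CARD('n)" by (rule integral_norm_mehler_of_real_le[OF s])
  finally show ?thesis .
qed

text \<open>With \<open>h\<close> the indicator of \<open>V\<close>, the images \<open>U j\<close>
  converge to \<open>h\<close> in norm: the mixed terms converge by dominated convergence, for which
  limits at points of \<open>V\<close> suffice, and the norms are bounded in the limit by that of
  \<open>h\<close>. Symmetry moves the operator onto \<open>g\<close>, where it vanishes.\<close>

lemma mehler_op_zero_imp_integral_open_zero:
  fixes g :: "real^'n::finite \<Rightarrow> complex"
  assumes g: "g \<in> L2" and z: "\<And>s. 0 < s \<Longrightarrow> s < 1 \<Longrightarrow> AE x in lborel. mehler_op (of_real s) g x = 0"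
    and V: "open V" "bounded V"
  shows "(LBINT x. g x * of_real (indicator V x)) = 0"
proof -
  \<comment> \<open>The offset gives \<open>s j \<ge> 1/2\<close>, and so a dominating constant
    independent of \<open>j\<close>.\<close>
  define s where "s j = 1 - inverse (real (Suc (Suc j)))" for j
  have s: "0 < s j" "s j < 1" for j by (auto simp: s_def field_simps)
  have sl: "s \<longlonglongrightarrow> 1"
  proof -
    have "s \<longlonglongrightarrow> 1 - 0" unfolding s_def by (intro tendsto_intros LIMSEQ_Suc[OF LIMSEQ_inverse_real_of_nat])
    then show ?thesis by simp
  qed
  have ns: "norm (complex_of_real (s j)) < 1" "complex_of_real (s j) \<noteq> 0" for j using s[of j] by auto
  define h where "h x = complex_of_real (indicator V x)" for x
  have Om: "V \<in> sets borel" using V by auto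
  have Of: "emeasure lborel V < \<infinity>" using emeasure_bounded_finite[OF V(2)] .
  have h: "h \<in> L2" unfolding h_def by (rule indicator_L2[OF Om Of])
  have hn: "(l2norm h)\<^sup>2 = measure lborel V" unfolding h_def by (rule l2norm_indicator[OF Om Of])
  define U where "U j = mehler_op (of_real (s j)) h" for j
  have U: "U j \<in> L2" for j unfolding U_def by (rule mehler_op_L2[OF ns(1) h])
  have [measurable]: "U j \<in> borel_measurable borel" "h \<in> borel_measurable borel" "g \<in> borel_measurable borel" for j
    using U h g by (auto intro: L2_measurable)
  have lim: "(\<lambda>j. \<integral>x. U j x * h x \<partial>lborel) \<longlonglongrightarrow> (LBINT x. h x)"
  proof (rule integral_dominated_convergence)
    show "integrable lborel (\<lambda>x. (1 / sqrt (1/2)) ^ CARD('n) * (indicator V x :: real))"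
      using Om Of by (intro integrable_mult_right) (simp add: integrable_indicator_iff)
    show "AE x in lborel. norm (U j x * h x) \<le> (1 / sqrt (1/2)) ^ CARD('n) * (indicator V x :: real)" for j
    proof (rule AE_I2)
      fix x
      have "norm (U j x) \<le> (1 / sqrt (s j)) ^ CARD('n)"
        unfolding U_def h_def by (rule mehler_op_indicator_le[OF s Om])
      also have "\<dots> \<le> (1 / sqrt (1/2)) ^ CARD('n)"
      proof (intro power_mono divide_left_mono)
        have "1/2 \<le> s j" by (simp add: s_def field_simps)
        then show "sqrt (1/2) \<le> sqrt (s j)" by (rule real_sqrt_le_mono)
      qed (use s in \<open>auto intro: less_imp_le\<close>)
      finally show "norm (U j x * h x) \<le> (1 / sqrt (1/2)) ^ CARD('n) * (indicator V x :: real)"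
        by (auto simp: h_def indicator_def)
    qed
    show "AE x in lborel. (\<lambda>j. U j x * h x) \<longlonglongrightarrow> h x"
    proof (rule AE_I2)
      fix x
      show "(\<lambda>j. U j x * h x) \<longlonglongrightarrow> h x"
      proof (cases "x \<in> V")
        case True
        from mehler_op_indicator_tendsto[OF V(1) True s sl] True show ?thesis
          by (simp add: U_def h_def[abs_def])
      qed (simp add: h_def)
    qed
  qed measurable
  define D where "D j = (l2norm (\<lambda>x. U j x - h x))\<^sup>2" for j
  \<comment> \<open>The square is expanded using that \<open>h\<close> is real valued. In the limit
    all three terms are multiples of the measure of \<open>V\<close>, with coefficients 1, -2 and
    1.\<close>
  have Dle: "D j \<le> (1 / s j) ^ CARD('n) * (l2norm h)\<^sup>2 - 2 * Re (LBINT x. U j x * h x) + (l2norm h)\<^sup>2" for j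
  proof -
    have "D j = (LBINT x. (norm (U j x))\<^sup>2 - 2 * Re (U j x * h x) + (norm (h x))\<^sup>2)"
      unfolding D_def l2norm_square
    proof (intro Bochner_Integration.integral_cong refl)
      fix x
      show "(norm (U j x - h x))\<^sup>2 = (norm (U j x))\<^sup>2 - 2 * Re (U j x * h x) + (norm (h x))\<^sup>2"
        unfolding cmod_power2 by (auto simp: h_def indicator_def power2_eq_square algebra_simps)
    qed
    also have "\<dots> = (l2norm (U j))\<^sup>2 - 2 * (LBINT x. Re (U j x * h x)) + (l2norm h)\<^sup>2"
      unfolding l2norm_square using L2_square_integrable[OF U] L2_square_integrable[OF h]
        integrable_Re[OF L2_mult_integrable[OF U h]] by (simp del: times_complex.sel)
    also have "(LBINT x. Re (U j x * h x)) = Re (LBINT x. U j x * h x)"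
      by (rule integral_Re[OF L2_mult_integrable[OF U h]])
    also have "(l2norm (U j))\<^sup>2 \<le> (1 / s j) ^ CARD('n) * (l2norm h)\<^sup>2"
      using l2norm_mehler_op[OF ns h, of j] s[of j] unfolding U_def by simp
    finally show ?thesis by simp
  qed
  have "(\<lambda>j. (1 / s j) ^ CARD('n) * (l2norm h)\<^sup>2 - 2 * Re (LBINT x. U j x * h x) + (l2norm h)\<^sup>2)
     \<longlonglongrightarrow> (1 / 1) ^ CARD('n) * (l2norm h)\<^sup>2 - 2 * Re (LBINT x. h x) + (l2norm h)\<^sup>2"
    by (intro tendsto_intros sl lim) auto
  also have "(1 / 1) ^ CARD('n) * (l2norm h)\<^sup>2 - 2 * Re (LBINT x. h x) + (l2norm h)\<^sup>2 = 0"
  proof -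
    have "(LBINT x. h x) = of_real (LBINT x. indicator V x)"
      unfolding h_def by (rule integral_complex_of_real)
    then have "(LBINT x. h x) = of_real (measure lborel V)" using Om Of by simp
    then show ?thesis by (simp add: hn)
  qed
  finally have lim0: "(\<lambda>j. (1 / s j) ^ CARD('n) * (l2norm h)\<^sup>2 - 2 * Re (LBINT x. U j x * h x) + (l2norm h)\<^sup>2) \<longlonglongrightarrow> 0" .
  have "D \<longlonglongrightarrow> 0"
    by (rule tendsto_sandwich[OF _ _ tendsto_const lim0]) (auto simp: D_def intro!: always_eventually Dle[unfolded D_def])
  then have "(\<lambda>j. sqrt (D j)) \<longlonglongrightarrow> sqrt 0" by (intro tendsto_intros)
  then have Dl: "(\<lambda>j. l2norm g * l2norm (\<lambda>x. U j x - h x)) \<longlonglongrightarrow> l2norm g * 0"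
    unfolding D_def by (intro tendsto_intros) simp
  have "norm (LBINT x. g x * h x) \<le> l2norm g * l2norm (\<lambda>x. U j x - h x)" for j
  proof -
    have "(LBINT x. g x * U j x) = (LBINT x. mehler_op (of_real (s j)) g x * h x)"
      unfolding U_def by (rule mehler_op_symmetric[OF ns(1) g h, symmetric])
    also have "\<dots> = (\<integral>x. 0 \<partial>(lborel::(real^'n) measure))"
    proof (rule integral_cong_AE)
      show "AE x in lborel. mehler_op (of_real (s j)) g x * h x = 0"
        using z[OF s, of j] by eventually_elim simp
    qed (use mehler_op_measurable[OF g] in auto)
    finally have "(LBINT x. g x * (U j x - h x)) = - (LBINT x. g x * h x)"
      using L2_mult_integrable[OF g U] L2_mult_integrable[OF g h] by (simp add: right_diff_distrib)
    then show ?thesis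
      using L2_Cauchy_Schwarz[OF g L2_diff[OF U h], of j] by simp
  qed
  then have "norm (LBINT x. g x * h x) \<le> l2norm g * 0"
    by (intro LIMSEQ_le_const[OF Dl]) auto
  then show ?thesis by (simp add: h_def)
qed

text \<open>Open sets form an intersection-stable generator of the Borel sets, so vanishing
  integrals propagate to all Borel sets. Restricting to balls makes \<open>g\<close> integrable and
  keeps the open sets bounded.\<close>

lemma integral_open_zero_imp_AE_zero:
  fixes g :: "real^'n::finite \<Rightarrow> complex"
  assumes g: "g \<in> L2"
    and z: "\<And>V. open V \<Longrightarrow> bounded V \<Longrightarrow> (LBINT x. g x * of_real (indicator V x)) = 0"
  shows "AE x in lborel. g x = 0"
proof -
  note [measurable] = L2_measurable[OF g]
  have R: "AE x in lborel. indicator (ball 0 (real R)) x *\<^sub>R g x = 0" for R :: nat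
  proof -
    define B where "B = ball (0::real^'n) (real R)"
    define f where "f x = indicator B x *\<^sub>R g x" for x
    have Bf: "emeasure lborel B < \<infinity>" "B \<in> sets borel" unfolding B_def using emeasure_bounded_finite[of "ball (0::real^'n) (real R)"] by auto
    have fi: "integrable lborel f"
      using L2_mult_integrable[OF g indicator_L2[OF Bf(2,1)]] unfolding f_def
      by (simp add: scaleR_conv_of_real mult.commute)
    have si: "set_integrable lborel A f" if "A \<in> sets borel" for A
      unfolding set_integrable_def using that by (intro integrable_mult_indicator fi) auto
    have op: "set_lebesgue_integral lborel A f = 0" if "open A" for A
    proof -
      have "set_lebesgue_integral lborel A f = (LBINT x. g x * of_real (indicator (A \<inter> B) x))"
        unfolding set_lebesgue_integral_def f_def
        by (intro Bochner_Integration.integral_cong refl) (auto simp: indicator_def)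
      also have "\<dots> = 0"
        by (rule z) (use that in \<open>auto simp: B_def intro: bounded_Int\<close>)
      finally show ?thesis .
    qed
    have "set_lebesgue_integral lborel A f = 0" if "A \<in> sets borel" for A
    proof -

      have "Int_stable {S :: (real^'n) set. open S}" by (auto simp: Int_stable_def)
      moreover have "{S :: (real^'n) set. open S} \<subseteq> Pow UNIV" by simp
      moreover from that have "A \<in> sigma_sets UNIV {S :: (real^'n) set. open S}" by (simp add: sets_borel)
      ultimately show ?thesis
      proof (induction rule: sigma_sets_induct_disjoint)
        case (compl A)
        then have A: "A \<in> sets borel" by (simp add: sets_borel)
        have "set_lebesgue_integral lborel UNIV f = set_lebesgue_integral lborel A f + set_lebesgue_integral lborel (UNIV - A) f"
          using set_integral_Un[of A "UNIV - A" lborel f] si[OF A] si[of "UNIV - A"] A by (simp add: Un_UNIV_right)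
        with compl op[of UNIV] show ?case by simp
      next
        case (union A)
        then have A: "A i \<in> sets borel" for i by (auto simp: sets_borel)
        have "set_lebesgue_integral lborel (\<Union>i. A i) f = (\<Sum>i. set_lebesgue_integral lborel (A i) f)"
          using union(1) A by (intro lebesgue_integral_countable_add si) (auto simp: disjoint_family_on_def)
        with union show ?case by simp
      qed (use op in \<open>auto simp: set_lebesgue_integral_def\<close>)
    qed
    then have "AE x in lborel. f x = 0" by (intro sigma_finite_measure.density_zero[OF sigma_finite_lborel fi]) auto
    then show ?thesis by (simp add: f_def B_def)
  qed
  then have "AE x in lborel. \<forall>R::nat. indicator (ball 0 (real R)) x *\<^sub>R g x = 0" unfolding AE_all_countable by blast
  then show ?thesis
  proof eventually_elim
    fix x assume *: "\<forall>R::nat. indicator (ball 0 (real R)) x *\<^sub>R g x = 0"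
    obtain R :: nat where "norm x < real R" using reals_Archimedean2 by blast
    with *[rule_format, of R] show "g x = 0" by simp
  qed
qed

lemma mehler_op_injective:
  fixes g :: "real^'n::finite \<Rightarrow> complex"
  assumes "g \<in> L2" "\<And>s. 0 < s \<Longrightarrow> s < 1 \<Longrightarrow> AE x in lborel. mehler_op (of_real s) g x = 0"
  shows "AE x in lborel. g x = 0"
  using integral_open_zero_imp_AE_zero[OF assms(1)] mehler_op_zero_imp_integral_open_zero[OF assms] by blast

lemma hermite_eigenspace_L2: "u \<in> hermite_eigenspace k \<Longrightarrow> u \<in> L2"
  by (simp add: hermite_eigenspace_def hermite_op_def)

text \<open>The pairing with the kernel has the form \<open>c y * r ^ m\<close>, and
  \<open>c\<close> has to be identified with \<open>u\<close>. By the semigroup law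
  \<open>U s\<close> sends \<open>c\<close> to \<open>s ^ m * c\<close>, which is also the image of
  \<open>u\<close>; injectivity of the family gives \<open>u = c\<close> almost everywhere. The
  exponent depends on \<open>k\<close> only.\<close>

lemma hermite_eigenspace_mehler_op:
  obtains m where "\<And>(u :: real^'n::finite \<Rightarrow> complex) r. u \<in> hermite_eigenspace k \<Longrightarrow> norm r < 1 \<Longrightarrow>
     AE x in lborel. mehler_op r u x = r ^ m * u x"
proof (cases "\<exists>m. k = of_nat CARD('n) + 2 * of_nat m")
  case False
  show ?thesis
  \<comment> \<open>A default exponent: in this case every eigenfunction vanishes almost
    everywhere.\<close>
  proof (rule that[of 0])
    fix u :: "real^'n \<Rightarrow> complex" and r :: complex
    assume u: "u \<in> hermite_eigenspace k" and r: "norm r < 1"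
    have 0: "mehler_op s u x = 0" if "norm s < 1" for s x
      unfolding mehler_op_def using mehler_integral_eigenfunction(2)[OF u _ that] False by blast
    have "AE x in lborel. u x = 0"
      by (rule mehler_op_injective[OF hermite_eigenspace_L2[OF u]]) (use 0 in auto)
    then show "AE x in lborel. mehler_op r u x = r ^ 0 * u x"
      by eventually_elim (simp add: 0[OF r])
  qed
next
  case True
  then obtain m where m: "k = of_nat CARD('n) + 2 * of_nat m" by blast
  show ?thesis
  proof (rule that[of m])
    fix u :: "real^'n \<Rightarrow> complex" and r :: complex
    assume u: "u \<in> hermite_eigenspace k" and r: "norm r < 1"
    have uL: "u \<in> L2" by (rule hermite_eigenspace_L2[OF u])
    have "\<exists>c. \<forall>r. norm r < 1 \<longrightarrow> mehler_op r u y = c * r ^ m" for y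
      unfolding mehler_op_def using mehler_integral_eigenfunction(1)[OF u m, of 0 y] by simp
    then obtain c where c: "\<And>r y. norm r < 1 \<Longrightarrow> mehler_op r u y = c y * r ^ m" by metis
    \<comment> \<open>Any nonzero point of the disc would serve. Writing \<open>c\<close> as a value
      of \<open>mehler_op\<close> makes it measurable and square integrable.\<close>
    have ch: "c = (\<lambda>y. 2 ^ m * mehler_op (1/2) u y)"
      using c[of "1/2"] by (auto simp: fun_eq_iff field_simps)
    have h: "norm (1/2::complex) < 1" by simp
    have cL: "c \<in> L2" unfolding ch by (rule L2_scale[OF mehler_op_L2[OF h uL]])
    have cc: "mehler_op s c y = s ^ m * c y" if s: "norm s < 1" for s y
    proof -
      have s2: "norm (s * (1/2)) < 1" using s by (simp add: norm_mult)
      have "mehler_op s c y = 2 ^ m * mehler_op (s * (1/2)) u y"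
        unfolding ch mehler_op_scale mehler_op_semigroup[OF s h uL] ..
      also have "\<dots> = s ^ m * c y" unfolding c[OF s2] by (simp add: power_mult_distrib[symmetric])
      finally show ?thesis .
    qed
    have "AE x in lborel. u x - c x = 0"
    proof (rule mehler_op_injective[OF L2_diff[OF uL cL]])
      fix s :: real assume "0 < s" "s < 1"
      then have s: "norm (complex_of_real s) < 1" by simp
      show "AE x in lborel. mehler_op (of_real s) (\<lambda>x. u x - c x) x = 0"
        unfolding mehler_op_diff[OF s uL cL] c[OF s] cc[OF s] by simp
    qed
    then show "AE x in lborel. mehler_op r u x = r ^ m * u x"
      by eventually_elim (simp add: c[OF r])
  qed
qed

section \<open>The orthogonal projection\<close>

lemma L2_inner_cnj: "L2_inner g f = cnj (L2_inner f g)"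
  unfolding L2_inner_def by (simp add: mult.commute flip: Bochner_Integration.integral_cnj)

lemma L2_inner_self: "L2_inner f f = of_real ((l2norm f)\<^sup>2)"
  unfolding L2_inner_def by (rule integral_mult_cnj_self)

lemma L2_inner_scale_left: "L2_inner (\<lambda>x. c * f x) g = c * L2_inner f g"
  by (simp add: L2_inner_def mult.assoc)

lemma L2_inner_scale_right: "L2_inner f (\<lambda>x. c * g x) = cnj c * L2_inner f g"
  by (simp add: L2_inner_def mult.left_commute)

lemma L2_inner_diff_left:
  assumes "f \<in> L2" "g \<in> L2" "h \<in> L2"
  shows "L2_inner (\<lambda>x. f x - g x) h = L2_inner f h - L2_inner g h"
  using L2_mult_integrable[OF assms(1) L2_cnj[OF assms(3)]] L2_mult_integrable[OF assms(2) L2_cnj[OF assms(3)]]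
  by (simp add: L2_inner_def left_diff_distrib)

lemma L2_inner_diff_right:
  assumes "f \<in> L2" "g \<in> L2" "h \<in> L2"
  shows "L2_inner h (\<lambda>x. f x - g x) = L2_inner h f - L2_inner h g"
  by (simp add: L2_inner_cnj[of h] L2_inner_diff_left[OF assms])

lemma L2_inner_sum_left:
  assumes "\<And>i. i \<in> I \<Longrightarrow> f i \<in> L2" "g \<in> L2"
  shows "L2_inner (\<lambda>x. \<Sum>i\<in>I. f i x) g = (\<Sum>i\<in>I. L2_inner (f i) g)"
  unfolding L2_inner_def sum_distrib_right
  by (rule Bochner_Integration.integral_sum) (intro L2_mult_integrable assms L2_cnj)

lemma L2_inner_sum_right:
  assumes "\<And>i. i \<in> I \<Longrightarrow> f i \<in> L2" "g \<in> L2"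
  shows "L2_inner g (\<lambda>x. \<Sum>i\<in>I. f i x) = (\<Sum>i\<in>I. L2_inner g (f i))"
  by (simp add: L2_inner_cnj[of g] L2_inner_sum_left[OF assms])

lemma norm_L2_inner_le: "f \<in> L2 \<Longrightarrow> g \<in> L2 \<Longrightarrow> norm (L2_inner f g) \<le> l2norm f * l2norm g"
  using L2_Cauchy_Schwarz[OF _ L2_cnj, of f g] by (simp add: L2_inner_def)

definition L2_orthonormal :: "nat \<Rightarrow> (nat \<Rightarrow> real^'n::finite \<Rightarrow> complex) \<Rightarrow> bool" where
  "L2_orthonormal N u \<longleftrightarrow> (\<forall>i<N. u i \<in> L2) \<and> (\<forall>i<N. \<forall>j<N. L2_inner (u i) (u j) = (if i = j then 1 else 0))"

lemma L2_inner_orthonormal_sum: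
  assumes "L2_orthonormal N u" "j < N"
  shows "L2_inner (\<lambda>x. \<Sum>i<N. c i * u i x) (u j) = c j"
proof -
  have "L2_inner (\<lambda>x. \<Sum>i<N. c i * u i x) (u j) = (\<Sum>i<N. L2_inner (\<lambda>x. c i * u i x) (u j))"
    using assms by (intro L2_inner_sum_left L2_scale) (auto simp: L2_orthonormal_def)
  also have "\<dots> = (\<Sum>i<N. if i = j then c j else 0)"
    using assms by (intro sum.cong) (auto simp: L2_inner_scale_left L2_orthonormal_def)
  also have "\<dots> = c j" using assms by simp
  finally show ?thesis .
qed

lemma L2_Bessel:
  assumes on: "L2_orthonormal N u" and g: "g \<in> L2"
  shows "(\<Sum>i<N. (norm (L2_inner g (u i)))\<^sup>2) \<le> (l2norm g)\<^sup>2"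
proof -
  define c where "c i = L2_inner g (u i)" for i
  define s where "s x = (\<Sum>i<N. c i * u i x)" for x
  have u: "u i \<in> L2" if "i < N" for i using on that by (auto simp: L2_orthonormal_def)
  have s: "s \<in> L2" unfolding s_def by (intro L2_sum L2_scale u) auto
  have sj: "L2_inner s (u j) = c j" if "j < N" for j
    unfolding s_def by (rule L2_inner_orthonormal_sum[OF on that])
  have r: "L2_inner h s = (\<Sum>i<N. cnj (c i) * L2_inner h (u i))" if "h \<in> L2" for h
    unfolding s_def using u that by (subst L2_inner_sum_right) (auto simp: L2_inner_scale_right intro: L2_scale)
  have gs: "L2_inner g s = of_real (\<Sum>i<N. (norm (c i))\<^sup>2)"
    unfolding r[OF g] c_def[symmetric] by (simp add: mult.commute complex_norm_square[symmetric] del: of_real_power)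
  have ss: "L2_inner s s = of_real (\<Sum>i<N. (norm (c i))\<^sup>2)"
    unfolding r[OF s] using sj by (simp add: mult.commute complex_norm_square[symmetric] del: of_real_power)
  have "complex_of_real ((l2norm (\<lambda>x. g x - s x))\<^sup>2) = L2_inner g g - L2_inner g s - (cnj (L2_inner g s) - L2_inner s s)"
    unfolding L2_inner_self[symmetric]
    by (simp add: L2_inner_diff_left L2_inner_diff_right L2_diff g s L2_inner_cnj[of s g])
  also have "\<dots> = of_real ((l2norm g)\<^sup>2 - (\<Sum>i<N. (norm (c i))\<^sup>2))"
    unfolding gs ss unfolding L2_inner_self by simp
  finally have "(l2norm (\<lambda>x. g x - s x))\<^sup>2 = (l2norm g)\<^sup>2 - (\<Sum>i<N. (norm (c i))\<^sup>2)"
    by (simp only: of_real_eq_iff)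
  then show ?thesis using zero_le_power2[of "l2norm (\<lambda>x. g x - s x)"] by (simp add: c_def)
qed

section \<open>Square integrability of Schwartz functions\<close>

lemma integrable_inverse_one_plus_norm:
  "integrable lborel (\<lambda>x::real^'n::finite. inverse ((1 + norm x) ^ (2 * CARD('n))))"
proof -
  have 1: "(\<integral>\<^sup>+t. ennreal (inverse (1 + t\<^sup>2)) \<partial>lborel) < \<infinity>"
    using integrable_inverse_1_plus_square
    by (simp add: set_integrable_def integrable_iff_bounded indicator_def)
  have "(\<integral>\<^sup>+x. ennreal (inverse ((1 + norm x) ^ (2 * CARD('n)))) \<partial>(lborel :: (real^'n) measure))
     \<le> (\<integral>\<^sup>+x. (\<Prod>b\<in>Basis. ennreal (inverse (1 + (x \<bullet> b)\<^sup>2))) \<partial>(lborel :: (real^'n) measure))"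
  proof (rule nn_integral_mono)
    fix x :: "real^'n"
    \<comment> \<open>The exponent \<open>2 * CARD('n)\<close> allows comparison with a product of
      one-dimensional functions \<open>inverse (1 + t\<^sup>2)\<close>, whose integrals
      factor.\<close>
    have "(\<Prod>b\<in>(Basis::(real^'n) set). 1 + (x \<bullet> b)\<^sup>2) \<le> (\<Prod>b\<in>(Basis::(real^'n) set). (1 + norm x)\<^sup>2)"
    proof (intro prod_mono conjI)
      fix b :: "real^'n" assume "b \<in> Basis"
      then have "(x \<bullet> b)\<^sup>2 \<le> (norm x)\<^sup>2" using Basis_le_norm[of b x] by (metis abs_le_square_iff abs_norm_cancel)
      then show "1 + (x \<bullet> b)\<^sup>2 \<le> (1 + norm x)\<^sup>2" using norm_ge_zero[of x] unfolding power2_sum one_power2 by linarith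
    qed auto
    also have "\<dots> = (1 + norm x) ^ (2 * CARD('n))" by (simp add: power_mult)
    finally have "inverse ((1 + norm x) ^ (2 * CARD('n))) \<le> inverse (\<Prod>b\<in>(Basis::(real^'n) set). 1 + (x \<bullet> b)\<^sup>2)"
      by (intro le_imp_inverse_le prod_pos) (auto simp: add_pos_nonneg)
    also have "\<dots> = (\<Prod>b\<in>(Basis::(real^'n) set). inverse (1 + (x \<bullet> b)\<^sup>2))"
      using prod_dividef[of "\<lambda>_. 1" "\<lambda>b. 1 + (x \<bullet> b)\<^sup>2" "Basis::(real^'n) set"] by (simp add: inverse_eq_divide)
    finally show "ennreal (inverse ((1 + norm x) ^ (2 * CARD('n)))) \<le> (\<Prod>b\<in>Basis. ennreal (inverse (1 + (x \<bullet> b)\<^sup>2)))"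
      by (subst prod_ennreal) (auto intro: ennreal_leI)
  qed
  also have "\<dots> = (\<Prod>b\<in>(Basis::(real^'n) set). \<integral>\<^sup>+t. ennreal (inverse (1 + t\<^sup>2)) \<partial>lborel)"
    by (rule nn_integral_lborel_prod) auto
  also have "\<dots> < \<infinity>" using 1 by (simp add: power_less_top_ennreal)
  finally show ?thesis by (intro integrableI_nonneg) auto
qed

lemma rapid_decay_L2:
  fixes f :: "real^'n::finite \<Rightarrow> complex"
  assumes f: "f \<in> borel_measurable borel" and bd: "\<And>x. (1 + norm x) ^ CARD('n) * norm (f x) \<le> B"
  shows "f \<in> L2"
proof (rule L2_dominated)
  show "integrable lborel (\<lambda>x::real^'n. B\<^sup>2 * inverse ((1 + norm x) ^ (2 * CARD('n))))"
    by (intro integrable_mult_right integrable_inverse_one_plus_norm)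
  show "(norm (f x))\<^sup>2 \<le> B\<^sup>2 * inverse ((1 + norm x) ^ (2 * CARD('n)))" for x
  proof -
    have "((1 + norm x) ^ CARD('n) * norm (f x))\<^sup>2 \<le> B\<^sup>2" by (intro power_mono bd) auto
    then have "(1 + norm x) ^ (2 * CARD('n)) * (norm (f x))\<^sup>2 \<le> B\<^sup>2"
      by (simp add: power_mult_distrib power_mult[symmetric] mult.commute)
    moreover have "(1 + norm x) ^ (2 * CARD('n)) > 0" by (simp add: add_pos_nonneg)
    ultimately show ?thesis by (simp add: field_simps)
  qed
qed (use f in simp)

lemma schwartz_weighted_partials_L2:
  fixes \<psi> :: "real^'n::finite \<Rightarrow> complex"
  assumes "\<psi> \<in> schwartz"
  shows "(\<lambda>x. of_real ((norm x) ^ j) * partials is \<psi> x) \<in> L2"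
proof -
  have d: "partials is \<psi> differentiable (at x)" for x :: "real^'n"
    using assms by (simp add: schwartz_def)
  have "bounded (range (\<lambda>x. (1 + norm x) ^ (CARD('n) + j) *\<^sub>R partials is \<psi> x))"
    using assms by (simp add: schwartz_def)
  then obtain B where B: "\<And>x. norm ((1 + norm x) ^ (CARD('n) + j) *\<^sub>R partials is \<psi> x) \<le> B"
    unfolding bounded_iff by auto
  show ?thesis
  proof (rule rapid_decay_L2[where B=B])
    have "continuous_on UNIV (partials is \<psi>)"
      using d by (intro continuous_at_imp_continuous_on) (auto intro: differentiable_imp_continuous_within)
    then have [measurable]: "partials is \<psi> \<in> borel_measurable borel" by (rule borel_measurable_continuous_onI)
    show "(\<lambda>x. of_real ((norm x) ^ j) * partials is \<psi> x) \<in> borel_measurable borel" by measurable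
    fix x :: "real^'n"
    have "norm x ^ j \<le> (1 + norm x) ^ j" by (intro power_mono) auto
    then have "(1 + norm x) ^ CARD('n) * (norm x ^ j * norm (partials is \<psi> x)) \<le>
        (1 + norm x) ^ CARD('n) * ((1 + norm x) ^ j * norm (partials is \<psi> x))"
      by (intro mult_left_mono mult_right_mono) auto
    also have "\<dots> \<le> B" using B[of x] by (simp add: power_add mult_ac)
    finally show "(1 + norm x) ^ CARD('n) * norm (of_real ((norm x) ^ j) * partials is \<psi> x) \<le> B"
      by (simp add: norm_mult norm_power)
  qed
qed

lemma schwartz_L2: "\<psi> \<in> schwartz \<Longrightarrow> \<psi> \<in> L2"
  using schwartz_weighted_partials_L2[of \<psi> 0 "[]"] by (simp add: partials_def)

text \<open>Ensures that both sides of the weak equation converge absolutely for every square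
  integrable \<open>u\<close>, so that its integrals may be split when eigenfunctions are
  subtracted.\<close>

lemma schwartz_hermite_L2:
  fixes \<psi> :: "real^'n::finite \<Rightarrow> complex"
  assumes "\<psi> \<in> schwartz"
  shows "(\<lambda>x. - laplacian \<psi> x + of_real ((norm x)\<^sup>2) * \<psi> x) \<in> L2"
proof -
  have "(\<lambda>x. partial i (partial i \<psi>) x) \<in> L2" for i
    using schwartz_weighted_partials_L2[OF assms, of 0 "[i, i]"] by (simp add: partials_def)
  then have "laplacian \<psi> \<in> L2"
    using L2_sum[of UNIV "\<lambda>i. partial i (partial i \<psi>)"] by (simp add: laplacian_def[abs_def])
  from L2_add[OF L2_scale[OF this, of "-1"] schwartz_weighted_partials_L2[OF assms, of 2 "[]"]]
  show ?thesis by (simp add: partials_def)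
qed

section \<open>Linearity of the eigenspaces\<close>

lemma hermite_eigenspace_scale:
  assumes "u \<in> hermite_eigenspace k" shows "(\<lambda>x. c * u x) \<in> hermite_eigenspace k"
  unfolding hermite_eigenspace_def hermite_op_def
proof (intro CollectI conjI ballI)
  have u: "u \<in> L2" by (rule hermite_eigenspace_L2[OF assms])
  show "(\<lambda>x. c * u x) \<in> L2" "(\<lambda>x. k * (c * u x)) \<in> L2" by (intro L2_scale u)+
  fix \<psi> :: "real^'a \<Rightarrow> complex" assume "\<psi> \<in> schwartz"
  then have "(LBINT x. u x * (- laplacian \<psi> x + of_real ((norm x)\<^sup>2) * \<psi> x)) = (LBINT x. k * u x * \<psi> x)"
    using assms by (auto simp: hermite_eigenspace_def hermite_op_def)
  then have "c * (LBINT x. u x * (- laplacian \<psi> x + of_real ((norm x)\<^sup>2) * \<psi> x)) = c * (LBINT x. k * u x * \<psi> x)"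
    by simp
  then show "(LBINT x. c * u x * (- laplacian \<psi> x + of_real ((norm x)\<^sup>2) * \<psi> x)) = (LBINT x. k * (c * u x) * \<psi> x)"
    unfolding Bochner_Integration.integral_mult_right_zero[symmetric] by (simp add: mult_ac)
qed

lemma hermite_eigenspace_diff:
  assumes "u \<in> hermite_eigenspace k" "v \<in> hermite_eigenspace k"
  shows "(\<lambda>x. u x - v x) \<in> hermite_eigenspace k"
  unfolding hermite_eigenspace_def hermite_op_def
proof (intro CollectI conjI ballI)
  have u: "u \<in> L2" and v: "v \<in> L2" using assms by (auto intro: hermite_eigenspace_L2)
  show "(\<lambda>x. u x - v x) \<in> L2" "(\<lambda>x. k * (u x - v x)) \<in> L2" by (intro L2_scale L2_diff u v)+
  fix \<psi> :: "real^'a \<Rightarrow> complex" assume \<psi>: "\<psi> \<in> schwartz"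
  define h where "h x = - laplacian \<psi> x + of_real ((norm x)\<^sup>2) * \<psi> x" for x
  have h: "h \<in> L2" unfolding h_def by (rule schwartz_hermite_L2[OF \<psi>])
  have "(LBINT x. w x * h x) = (LBINT x. k * w x * \<psi> x)" if "w \<in> hermite_eigenspace k" for w
    using that \<psi> by (auto simp: hermite_eigenspace_def hermite_op_def h_def)
  then show "(LBINT x. (u x - v x) * (- laplacian \<psi> x + of_real ((norm x)\<^sup>2) * \<psi> x)) = (LBINT x. k * (u x - v x) * \<psi> x)"
    unfolding h_def[symmetric] using assms
    using L2_mult_integrable[OF u h] L2_mult_integrable[OF v h]
      L2_mult_integrable[OF L2_scale[OF u] schwartz_L2[OF \<psi>]] L2_mult_integrable[OF L2_scale[OF v] schwartz_L2[OF \<psi>]]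
    by (simp add: left_diff_distrib right_diff_distrib)
qed

lemma hermite_eigenspace_zero: "(\<lambda>x. 0) \<in> hermite_eigenspace k"
  by (simp add: hermite_eigenspace_def hermite_op_def L2_zero)

lemma hermite_eigenspace_add:
  assumes "u \<in> hermite_eigenspace k" "v \<in> hermite_eigenspace k"
  shows "(\<lambda>x. u x + v x) \<in> hermite_eigenspace k"
  using hermite_eigenspace_diff[OF assms(1) hermite_eigenspace_scale[OF assms(2), of "-1"]] by simp

lemma hermite_eigenspace_sum:
  assumes "\<And>i. i \<in> I \<Longrightarrow> f i \<in> hermite_eigenspace k"
  shows "(\<lambda>x. \<Sum>i\<in>I. f i x) \<in> hermite_eigenspace k"
  using assms
proof (induction I rule: infinite_finite_induct)
  case (insert i I)
  then show ?case using hermite_eigenspace_add[of "f i" k "\<lambda>x. \<Sum>i\<in>I. f i x"] by simp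
qed (auto simp: hermite_eigenspace_zero)

text \<open>The kernel is square integrable on the product, so Bessel's inequality bounds the number of
  orthonormal eigenfunctions.\<close>
lemma hermite_eigenspace_dimension_bound:
  obtains B :: real where "\<And>N (u :: nat \<Rightarrow> real^'n::finite \<Rightarrow> complex). L2_orthonormal N u \<Longrightarrow>
     (\<And>i. i < N \<Longrightarrow> u i \<in> hermite_eigenspace k) \<Longrightarrow> real N \<le> B"
proof -
  have h: "norm (1/2::complex) < 1" by simp
  obtain m where m: "\<And>(u :: real^'n \<Rightarrow> complex) r. u \<in> hermite_eigenspace k \<Longrightarrow> norm r < 1 \<Longrightarrow>
     AE x in lborel. mehler_op r u x = r ^ m * u x"
    using hermite_eigenspace_mehler_op[of k] by metis
  obtain K c where K: "K > 0" "c > 0"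
    "\<And>x y :: real^'n. norm (mehler (1/2) x y) \<le> K * (exp (- c * (norm x)\<^sup>2) * exp (- c * (norm y)\<^sup>2))"
    using mehler_gaussian_dominated[OF h] by metis
  define G where "G = (\<integral>y. exp (- (2 * c) * (norm (y - 0))\<^sup>2) \<partial>(lborel :: (real^'n) measure))"
  have gi: "integrable lborel (\<lambda>y::real^'n. exp (- (2 * c) * (norm (y - 0))\<^sup>2))"
    by (intro integrable_gaussian) (use K in simp)
  have M: "(l2norm (\<lambda>y. mehler (1/2) y x))\<^sup>2 \<le> K\<^sup>2 * G * exp (- (2 * c) * (norm (x - 0))\<^sup>2)" for x :: "real^'n"
  proof -
    have "(l2norm (\<lambda>y. mehler (1/2) y x))\<^sup>2 = (LBINT y. (norm (mehler (1/2) y x))\<^sup>2)"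
      by (rule l2norm_square)
    also have "\<dots> \<le> (\<integral>y. K\<^sup>2 * exp (- (2 * c) * (norm (x - 0))\<^sup>2) * exp (- (2 * c) * (norm (y - 0))\<^sup>2) \<partial>(lborel :: (real^'n) measure))"
    proof (rule integral_mono')
      show "(norm (mehler (1/2) y x))\<^sup>2 \<le> K\<^sup>2 * exp (- (2 * c) * (norm (x - 0))\<^sup>2) * exp (- (2 * c) * (norm (y - 0))\<^sup>2)" for y :: "real^'n"
        using power_mono[OF K(3)[of y x] norm_ge_zero, of 2]
        by (simp add: power_mult_distrib exp_double[symmetric] mult_ac)
    qed (use gi in auto)
    also have "\<dots> = K\<^sup>2 * G * exp (- (2 * c) * (norm (x - 0))\<^sup>2)" by (simp add: G_def)
    finally show ?thesis .
  qed
  show ?thesis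
  proof (rule that[of "4 ^ m * (K\<^sup>2 * G * G)"])
    fix N and u :: "nat \<Rightarrow> real^'n \<Rightarrow> complex"
    assume on: "L2_orthonormal N u" and E: "\<And>i. i < N \<Longrightarrow> u i \<in> hermite_eigenspace k"
    have uL: "u i \<in> L2" if "i < N" for i using hermite_eigenspace_L2[OF E[OF that]] .
    \<comment> \<open>For fixed \<open>x\<close> these values are, up to conjugation, the
      coefficients of the kernel row at \<open>x\<close>, so Bessel's inequality bounds them by the
      norm of that row.\<close>
    have pt: "(\<Sum>i<N. (norm (mehler_op (1/2) (u i) x))\<^sup>2) \<le> K\<^sup>2 * G * exp (- (2 * c) * (norm (x - 0))\<^sup>2)" for x
    proof -
      have "norm (L2_inner (\<lambda>y. mehler (1/2) y x) (u i)) = norm (mehler_op (1/2) (u i) x)" for i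
      proof -
        have "L2_inner (\<lambda>y. mehler (1/2) y x) (u i) = cnj (LBINT y. u i y * cnj (mehler (1/2) y x))"
          unfolding L2_inner_def by (simp add: mult.commute flip: Bochner_Integration.integral_cnj)
        also have "\<dots> = cnj (mehler_op (1/2) (u i) x)"
          by (simp add: cnj_mehler[OF h] mehler_op_def)
        finally show ?thesis by simp
      qed
      then show ?thesis using L2_Bessel[OF on mehler_L2[OF h], of x] M[of x] by simp
    qed
    have n1: "(l2norm (mehler_op (1/2) (u i)))\<^sup>2 = (1/4) ^ m" if "i < N" for i
    proof -
      have "l2norm (mehler_op (1/2) (u i)) = l2norm (\<lambda>x. (1/2) ^ m * u i x)"
        using m[OF E[OF that] h] by (intro l2norm_cong_AE mehler_op_L2 h uL that L2_scale)
      also have "\<dots> = (1/2) ^ m * l2norm (u i)"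
        unfolding l2norm_scale by (simp add: norm_power norm_divide)
      finally have "l2norm (mehler_op (1/2) (u i)) = (1/2) ^ m * l2norm (u i)" .
      moreover have "(l2norm (u i))\<^sup>2 = 1"
        using on that L2_inner_self[of "u i"] by (auto simp: L2_orthonormal_def simp flip: of_real_power)
      moreover have "((1/2::real) ^ m)\<^sup>2 = (1/4) ^ m"
        by (simp only: power_mult[symmetric] mult.commute[of m]) (simp add: power_mult power_divide)
      ultimately show ?thesis by (simp only: power_mult_distrib mult_1_right)
    qed
    \<comment> \<open>Every image has squared norm \<open>(1/4) ^ m\<close>; integrating the
      pointwise bound over \<open>x\<close> therefore counts the functions.\<close>
    have "real N * (1/4) ^ m = (\<Sum>i<N. \<integral>x. (norm (mehler_op (1/2) (u i) x))\<^sup>2 \<partial>lborel)"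
      using n1 by (simp add: l2norm_square)
    also have "\<dots> = (LBINT x. (\<Sum>i<N. (norm (mehler_op (1/2) (u i) x))\<^sup>2))"
      by (rule Bochner_Integration.integral_sum[symmetric]) (auto intro!: L2_square_integrable mehler_op_L2 uL)
    also have "\<dots> \<le> (\<integral>x. K\<^sup>2 * G * exp (- (2 * c) * (norm (x - 0))\<^sup>2) \<partial>(lborel :: (real^'n) measure))"
      by (rule integral_mono'[OF _ pt]) (use gi in \<open>auto simp: G_def intro!: mult_nonneg_nonneg integral_nonneg_AE\<close>)
    also have "\<dots> = K\<^sup>2 * G * G" by (simp add: G_def)
    finally show "real N \<le> 4 ^ m * (K\<^sup>2 * G * G)" by (simp add: power_divide field_simps)
  qed
qed

text \<open>The dimension bound provides a maximal finite orthonormal system of eigenfunctions, and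
  the usual finite sum is the projection. Existence is what makes the choice in
  \<open>hermite_proj\<close> meaningful.\<close>

lemma hermite_projection_exists:
  fixes \<phi> :: "real^'n::finite \<Rightarrow> complex"
  assumes \<phi>: "\<phi> \<in> L2"
  shows "\<exists>u. u \<in> hermite_eigenspace k \<and> (\<forall>v\<in>hermite_eigenspace k. L2_inner (\<lambda>x. \<phi> x - u x) v = 0)"
proof -
  define P where "P N \<longleftrightarrow> (\<exists>u :: nat \<Rightarrow> real^'n \<Rightarrow> complex. L2_orthonormal N u \<and> (\<forall>i<N. u i \<in> hermite_eigenspace k))" for N
  obtain B where B: "\<And>N (u :: nat \<Rightarrow> real^'n \<Rightarrow> complex). L2_orthonormal N u \<Longrightarrow>
     (\<And>i. i < N \<Longrightarrow> u i \<in> hermite_eigenspace k) \<Longrightarrow> real N \<le> B"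
    using hermite_eigenspace_dimension_bound[of k] by metis
  have "\<exists>N. P N \<and> \<not> P (Suc N)"
  proof (rule ccontr)
    assume "\<not> ?thesis"
    moreover have "P 0" by (auto simp: P_def L2_orthonormal_def)
    ultimately have "P N" for N by (induction N) auto
    then have "real N \<le> B" for N using B unfolding P_def by blast
    then show False using reals_Archimedean2[of B] not_less by blast
  qed
  then obtain N where "P N" and nP: "\<not> P (Suc N)" by blast
  from \<open>P N\<close> obtain u :: "nat \<Rightarrow> real^'n \<Rightarrow> complex"
    where on: "L2_orthonormal N u" and "\<forall>i<N. u i \<in> hermite_eigenspace k"
    unfolding P_def by blast
  then have E: "u i \<in> hermite_eigenspace k" if "i < N" for i using that by blast
  have uL: "u i \<in> L2" if "i < N" for i using hermite_eigenspace_L2[OF E[OF that]] .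
  define pr where "pr f x = (\<Sum>i<N. L2_inner f (u i) * u i x)" for f x
  have prE: "pr f \<in> hermite_eigenspace k" for f
    unfolding pr_def by (intro hermite_eigenspace_sum hermite_eigenspace_scale E) auto
  have prL: "pr f \<in> L2" for f by (rule hermite_eigenspace_L2[OF prE])
  have orth: "L2_inner (\<lambda>x. f x - pr f x) (u j) = 0" if "f \<in> L2" "j < N" for f j
    using L2_inner_diff_left[OF that(1) prL uL[OF that(2)], of f] L2_inner_orthonormal_sum[OF on that(2)]
    by (simp add: pr_def[abs_def])
  \<comment> \<open>A nonzero residual, once normalized, would extend the system to
    \<open>Suc N\<close> members. Equality can hold only up to null sets, since \<open>L2\<close>
    consists of functions.\<close>
  have span: "AE x in lborel. v x - pr v x = 0" if v: "v \<in> hermite_eigenspace k" for v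
  proof (rule ccontr)
    define w where "w x = v x - pr v x" for x
    have vL: "v \<in> L2" by (rule hermite_eigenspace_L2[OF v])
    have wE: "w \<in> hermite_eigenspace k" unfolding w_def by (rule hermite_eigenspace_diff[OF v prE])
    have wL: "w \<in> L2" by (rule hermite_eigenspace_L2[OF wE])
    assume "\<not> ?thesis"
    then have n: "l2norm w \<noteq> 0" using l2norm_eq_0_iff[OF wL] by (simp add: w_def)
    define z where "z x = of_real (1 / l2norm w) * w x" for x
    have zE: "z \<in> hermite_eigenspace k" unfolding z_def by (rule hermite_eigenspace_scale[OF wE])
    have zz: "L2_inner z z = 1"
      unfolding L2_inner_self z_def l2norm_scale using n by (simp add: norm_divide)
    have zu: "L2_inner z (u j) = 0" if "j < N" for j
      unfolding z_def L2_inner_scale_left using orth[OF vL that] by (simp add: w_def[abs_def])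
    have uz: "L2_inner (u j) z = 0" if "j < N" for j
      using zu[OF that] by (simp add: L2_inner_cnj[of "u j"])
    have "L2_orthonormal (Suc N) (u(N := z))"
      using on zz zu uz hermite_eigenspace_L2[OF zE] by (auto simp: L2_orthonormal_def less_Suc_eq)
    moreover have "\<forall>i<Suc N. (u(N := z)) i \<in> hermite_eigenspace k"
      using E zE by (auto simp: less_Suc_eq)
    ultimately show False using nP unfolding P_def by blast
  qed
  have "L2_inner (\<lambda>x. \<phi> x - pr \<phi> x) v = 0" if v: "v \<in> hermite_eigenspace k" for v
  proof -
    define d where "d x = \<phi> x - pr \<phi> x" for x
    have d: "d \<in> L2" unfolding d_def by (rule L2_diff[OF \<phi> prL])
    have vL: "v \<in> L2" by (rule hermite_eigenspace_L2[OF v])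
    have "L2_inner d v = L2_inner d (pr v)"
      unfolding L2_inner_def
    proof (rule integral_cong_AE)
      show "AE x in lborel. d x * cnj (v x) = d x * cnj (pr v x)"
        using span[OF v] by eventually_elim simp
    qed (use d vL prL in \<open>auto intro!: borel_measurable_times dest: L2_measurable L2_cnj\<close>)
    also have "\<dots> = (\<Sum>i<N. L2_inner d (\<lambda>x. L2_inner v (u i) * u i x))"
      unfolding pr_def by (rule L2_inner_sum_right) (auto intro: L2_scale uL d)
    also have "\<dots> = 0"
      using orth[OF \<phi>] by (intro sum.neutral) (auto simp: L2_inner_scale_right d_def[abs_def])
    finally show ?thesis by (simp add: d_def[abs_def])
  qed
  then show ?thesis using prE by blast
qed

text \<open>The residual is orthogonal to \<open>u\<close> itself, so
  \<open>(l2norm u)\<^sup>2\<close> is the inner product of \<phi> with \<open>u\<close>;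
  Cauchy-Schwarz then allows one factor to be cancelled.\<close>

lemma hermite_proj:
  assumes "\<phi> \<in> L2"
  shows hermite_proj_eigenspace: "hermite_proj k \<phi> \<in> hermite_eigenspace k"
    and l2norm_hermite_proj_le: "l2norm (hermite_proj k \<phi>) \<le> l2norm \<phi>"
proof -
  define u where "u = hermite_proj k \<phi>"
  have u: "u \<in> hermite_eigenspace k \<and> (\<forall>v\<in>hermite_eigenspace k. L2_inner (\<lambda>x. \<phi> x - u x) v = 0)"
    unfolding u_def hermite_proj_def by (rule someI_ex[OF hermite_projection_exists[OF assms]])
  then show "hermite_proj k \<phi> \<in> hermite_eigenspace k" by (simp add: u_def)
  have uL: "u \<in> L2" using u hermite_eigenspace_L2 by blast
  have "L2_inner \<phi> u = L2_inner u u"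
    using u L2_inner_diff_left[OF assms uL uL] by simp
  then have "(l2norm u)\<^sup>2 = norm (L2_inner \<phi> u)"
    unfolding L2_inner_self by (metis norm_of_real abs_of_nonneg zero_le_power2)
  also have "\<dots> \<le> l2norm \<phi> * l2norm u" by (rule norm_L2_inner_le[OF assms uL])
  finally have "l2norm u * l2norm u \<le> l2norm \<phi> * l2norm u" by (simp add: power2_eq_square)
  then show "l2norm (hermite_proj k \<phi>) \<le> l2norm \<phi>"
    using l2norm_nonneg[of u] l2norm_nonneg[of \<phi>] unfolding u_def[symmetric]
    by (cases "l2norm u = 0") auto
qed

section \<open>Bilinear estimates for time averages\<close>

lemma powr_tail_sum_le:
  fixes \<sigma> :: real
  assumes \<sigma>: "\<sigma> > 1" and J: "J \<ge> 1"
  shows "(\<Sum>d\<in>{J<..M}. real d powr - \<sigma>) \<le> real J powr (1 - \<sigma>) / (\<sigma> - 1)"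
proof (cases "J \<le> M")
  case True
  have "(\<Sum>d\<in>{J<..M}. real d powr - \<sigma>) \<le> (real J powr (1 - \<sigma>) - real M powr (1 - \<sigma>)) / (\<sigma> - 1)"
    using True
  proof (induction M rule: dec_induct)
    case (step M)
    have M: "real M > 0" using step J by simp
    \<comment> \<open>The mean value theorem bounds each term by a difference of values of
      \<open>x powr (1 - \<sigma>) / (\<sigma> - 1)\<close>, and the differences telescope.\<close>
    have "\<exists>z. real M < z \<and> z < real (Suc M) \<and> real (Suc M) powr (1 - \<sigma>) - real M powr (1 - \<sigma>)
        = (real (Suc M) - real M) * ((1 - \<sigma>) * z powr (1 - \<sigma> - 1))"
    proof (rule MVT2)
      fix x assume "real M \<le> x"
      with M have "x > 0" by linarith
      then show "((\<lambda>x. x powr (1 - \<sigma>)) has_real_derivative (1 - \<sigma>) * x powr (1 - \<sigma> - 1)) (at x)"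
        by (rule has_real_derivative_powr)
    qed simp
    then obtain z where z: "real M < z" "z < real (Suc M)"
      "real M powr (1 - \<sigma>) - real (Suc M) powr (1 - \<sigma>) = (\<sigma> - 1) * z powr (- \<sigma>)"
      by (auto simp: algebra_simps)
    have "real (Suc M) powr - \<sigma> \<le> z powr - \<sigma>"
      using z M \<sigma> by (intro powr_mono2') auto
    then have "(\<sigma> - 1) * real (Suc M) powr - \<sigma> \<le> real M powr (1 - \<sigma>) - real (Suc M) powr (1 - \<sigma>)"
      unfolding z(3) using \<sigma> by (intro mult_left_mono) auto
    then have "real (Suc M) powr - \<sigma> \<le> (real M powr (1 - \<sigma>) - real (Suc M) powr (1 - \<sigma>)) / (\<sigma> - 1)"
      using \<sigma> by (simp add: pos_le_divide_eq mult.commute)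
    moreover have "{J<..Suc M} = insert (Suc M) {J<..M}" using step by auto
    ultimately show ?case using step by (simp add: diff_divide_distrib)
  qed simp
  also have "\<dots> \<le> real J powr (1 - \<sigma>) / (\<sigma> - 1)"
    using \<sigma> by (intro divide_right_mono) auto
  finally show ?thesis .
next
  case False
  then show ?thesis using \<sigma> by simp
qed

lemma far_sum_le:
  fixes \<sigma> :: real
  assumes \<sigma>: "\<sigma> > 1" and J: "J \<ge> 1"
  shows "(\<Sum>l\<in>{l. l < N \<and> real J < \<bar>real j - real l\<bar>}. \<bar>real j - real l\<bar> powr - \<sigma>)
     \<le> 2 * (real J powr (1 - \<sigma>) / (\<sigma> - 1))"
proof -
  define A where "A = {l. l < N \<and> j + J < l}"
  define B where "B = {l. l < N \<and> l + J < j}"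
  have AB: "{l. l < N \<and> real J < \<bar>real j - real l\<bar>} = A \<union> B" "A \<inter> B = {}" "finite A" "finite B"
    unfolding A_def B_def by auto
  have "(\<Sum>l\<in>A. \<bar>real j - real l\<bar> powr - \<sigma>) \<le> (\<Sum>d\<in>{J<..N}. real d powr - \<sigma>)"
  proof -
    have "(\<Sum>l\<in>A. \<bar>real j - real l\<bar> powr - \<sigma>) = (\<Sum>d\<in>(\<lambda>l. l - j) ` A. real d powr - \<sigma>)"
      by (subst sum.reindex) (auto simp: A_def inj_on_def of_nat_diff intro!: sum.cong)
    also have "\<dots> \<le> (\<Sum>d\<in>{J<..N}. real d powr - \<sigma>)"
      by (rule sum_mono2) (auto simp: A_def)
    finally show ?thesis .
  qed
  moreover have "(\<Sum>l\<in>B. \<bar>real j - real l\<bar> powr - \<sigma>) \<le> (\<Sum>d\<in>{J<..j}. real d powr - \<sigma>)"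
  proof -
    have "(\<Sum>l\<in>B. \<bar>real j - real l\<bar> powr - \<sigma>) = (\<Sum>d\<in>(\<lambda>l. j - l) ` B. real d powr - \<sigma>)"
      by (subst sum.reindex) (auto simp: B_def inj_on_def of_nat_diff intro!: sum.cong)
    also have "\<dots> \<le> (\<Sum>d\<in>{J<..j}. real d powr - \<sigma>)"
      by (rule sum_mono2) (auto simp: B_def)
    finally show ?thesis .
  qed
  ultimately show ?thesis
    using powr_tail_sum_le[OF assms, of N] powr_tail_sum_le[OF assms, of j] AB
    by (simp add: sum.union_disjoint)
qed

lemma card_near_le:
  assumes "J \<ge> 1"
  shows "finite {l. l < N \<and> \<not> real J < \<bar>real j - real l\<bar>}"
    and "real (card {l. l < N \<and> \<not> real J < \<bar>real j - real l\<bar>}) \<le> 3 * real J"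
proof -
  have sub: "{l. l < N \<and> \<not> real J < \<bar>real j - real l\<bar>} \<subseteq> {j - J..j + J}" by auto
  have "card {l. l < N \<and> \<not> real J < \<bar>real j - real l\<bar>} \<le> card {j - J..j + J}"
    by (rule card_mono[OF _ sub]) simp
  \<comment> \<open>The interval has at most \<open>2 * J + 1\<close> elements, and
    \<open>J \<ge> 1\<close> absorbs the one.\<close>
  also have "\<dots> \<le> 3 * J" using assms by simp
  finally show "real (card {l. l < N \<and> \<not> real J < \<bar>real j - real l\<bar>}) \<le> 3 * real J" by simp
qed simp

text \<open>Indices within distance \<open>J\<close> of \<open>j\<close> are counted and bounded by
  \<open>b\<close>; the others are summed by their decay. The cut \<open>J\<close> stays free, to be
  placed where the two bounds balance.\<close>

lemma row_sum_le:
  fixes \<sigma> :: real and h :: "nat \<Rightarrow> real"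
  assumes \<sigma>: "\<sigma> > 1" and J: "J \<ge> 1" and "b \<ge> 0" "c \<ge> 0"
    and b: "\<And>l. l < N \<Longrightarrow> h l \<le> b"
    and c: "\<And>l. l < N \<Longrightarrow> l \<noteq> j \<Longrightarrow> h l \<le> c * \<bar>real j - real l\<bar> powr - \<sigma>"
  shows "(\<Sum>l<N. h l) \<le> 3 * real J * b + c * (2 * (real J powr (1 - \<sigma>) / (\<sigma> - 1)))"
proof -
  define A where "A = {l. l < N \<and> \<not> real J < \<bar>real j - real l\<bar>}"
  define B where "B = {l. l < N \<and> real J < \<bar>real j - real l\<bar>}"
  have "{..<N} = A \<union> B" "A \<inter> B = {}" "finite A" "finite B" by (auto simp: A_def B_def)
  then have "(\<Sum>l<N. h l) = (\<Sum>l\<in>A. h l) + (\<Sum>l\<in>B. h l)" by (simp add: sum.union_disjoint)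
  also have "(\<Sum>l\<in>A. h l) \<le> real (card A) * b"
    using b by (intro sum_bounded_above) (auto simp: A_def)
  also have "real (card A) * b \<le> 3 * real J * b"
    unfolding A_def by (intro mult_right_mono card_near_le J assms)
  also have "(\<Sum>l\<in>B. h l) \<le> (\<Sum>l\<in>B. c * \<bar>real j - real l\<bar> powr - \<sigma>)"
    using c J by (intro sum_mono) (auto simp: B_def)
  also have "\<dots> \<le> c * (2 * (real J powr (1 - \<sigma>) / (\<sigma> - 1)))"
    unfolding sum_distrib_left[symmetric] B_def by (intro mult_left_mono far_sum_le \<sigma> J assms)
  finally show ?thesis by simp
qed

lemma l2norm_sum_square_le:
  assumes "\<And>i. i \<in> W \<Longrightarrow> g i \<in> L2"
  shows "(l2norm (\<lambda>x. \<Sum>i\<in>W. g i x))\<^sup>2 \<le> (\<Sum>i\<in>W. \<Sum>j\<in>W. norm (L2_inner (g i) (g j)))"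
proof -
  have "complex_of_real ((l2norm (\<lambda>x. \<Sum>i\<in>W. g i x))\<^sup>2) = (\<Sum>i\<in>W. \<Sum>j\<in>W. L2_inner (g i) (g j))"
    unfolding L2_inner_self[symmetric] using assms
    by (simp add: L2_inner_sum_left L2_inner_sum_right L2_sum)
  then have "(l2norm (\<lambda>x. \<Sum>i\<in>W. g i x))\<^sup>2 = norm (\<Sum>i\<in>W. \<Sum>j\<in>W. L2_inner (g i) (g j))"
    by (metis norm_of_real abs_of_nonneg zero_le_power2)
  also have "\<dots> \<le> (\<Sum>i\<in>W. \<Sum>j\<in>W. norm (L2_inner (g i) (g j)))"
    by (intro order_trans[OF norm_sum] sum_mono norm_sum)
  finally show ?thesis .
qed

text \<open>The adjoint of \<open>U b\<close> is \<open>U (cnj b)\<close>, so by the semigroup law a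
  Gram entry is a single operator at \<open>a * cnj b\<close>. For sample points this depends on the
  difference of the times only.\<close>

lemma L2_inner_mehler_op:
  assumes a: "norm a < 1" and b: "norm b < 1" and f: "f \<in> L2" and g: "g \<in> L2"
  shows "L2_inner (mehler_op a f) (mehler_op b g) = (LBINT x. mehler_op (a * cnj b) f x * cnj (g x))"
proof -
  have b': "norm (cnj b) < 1" using b by simp
  have "L2_inner (mehler_op a f) (mehler_op b g) = (LBINT x. mehler_op a f x * mehler_op (cnj b) (\<lambda>x. cnj (g x)) x)"
    unfolding L2_inner_def cnj_mehler_op[OF b] ..
  also have "\<dots> = (LBINT x. mehler_op (cnj b) (mehler_op a f) x * cnj (g x))"
    by (rule mehler_op_symmetric[OF b' mehler_op_L2[OF a f] L2_cnj[OF g], symmetric])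
  also have "\<dots> = (LBINT x. mehler_op (a * cnj b) f x * cnj (g x))"
    unfolding mehler_op_semigroup[OF b' a f] by (simp add: mult.commute)
  finally show ?thesis .
qed

text \<open>Sample points on an arc of the circle of radius \<open>\<rho>\<close>; the products of two of them stay away from
  the singularity \<open>-1\<close> of the kernel.\<close>
definition sample :: "real \<Rightarrow> nat \<Rightarrow> nat \<Rightarrow> complex" where
  "sample \<rho> N j = of_real \<rho> * cis (real j / (2 * real N))"

lemma norm_sample: "0 \<le> \<rho> \<Longrightarrow> norm (sample \<rho> N j) = \<rho>"
  by (simp add: sample_def norm_mult)

lemma l2norm_mehler_op_sample:
  fixes f :: "real^'n::finite \<Rightarrow> complex"
  assumes \<rho>: "0 < \<rho>" "\<rho> < 1" "1/2 \<le> \<rho> ^ 4" and f: "f \<in> L2"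
  shows "l2norm (mehler_op (sample \<rho> N j) f) \<le> 2 ^ CARD('n) * l2norm f"
proof -
  have r: "norm (sample \<rho> N j) = \<rho>" using \<rho> by (simp add: norm_sample)
  have \<rho>2: "1/2 \<le> \<rho>" using \<rho> power_decreasing[of 1 4 \<rho>] by simp
  have "(l2norm (mehler_op (sample \<rho> N j) f))\<^sup>2 \<le> (1 / norm (sample \<rho> N j)) ^ CARD('n) * (l2norm f)\<^sup>2"
    by (rule l2norm_mehler_op) (use r \<rho> f in auto)
  also have "\<dots> \<le> 2 ^ CARD('n) * (l2norm f)\<^sup>2"
    unfolding r using \<rho> \<rho>2 by (intro mult_right_mono power_mono) (auto simp: field_simps)
  also have "\<dots> \<le> (2 ^ CARD('n))\<^sup>2 * (l2norm f)\<^sup>2"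
    by (intro mult_right_mono) (auto simp: power2_eq_square)
  also have "\<dots> = (2 ^ CARD('n) * l2norm f)\<^sup>2" by (simp add: power_mult_distrib)
  finally show ?thesis by (rule power2_le_imp_le) simp
qed

text \<open>The imaginary part alone suffices: it has modulus
  \<open>\<rho> ^ 4 * \<bar>sin t\<bar>\<close>, where the sine is comparable to \<open>t\<close> on
  a short arc and the power of \<rho> is at least 1/2.\<close>

lemma norm_one_minus_sample_square:
  assumes \<rho>: "0 < \<rho>" "\<rho> < 1" "1/2 \<le> \<rho> ^ 4" and N: "j < N" "l < N" "j \<noteq> l"
  shows "\<bar>real j - real l\<bar> / (2 * real N) \<le> pi * norm (1 - (sample \<rho> N j * cnj (sample \<rho> N l))\<^sup>2)"
proof -
  \<comment> \<open>The angle of the squared product: the sample angles differ by half of this, so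
    it stays within [-1, 1].\<close>
  define t where "t = (real j - real l) / real N"
  have t: "\<bar>t\<bar> \<le> 1" using N by (auto simp: t_def field_simps abs_if)
  have "sample \<rho> N j * cnj (sample \<rho> N l) = of_real (\<rho>\<^sup>2) * cis (real j / (2 * real N) - real l / (2 * real N))"
    by (simp add: sample_def cis_cnj cis_mult power2_eq_square)
  also have "real j / (2 * real N) - real l / (2 * real N) = t / 2"
    by (simp add: t_def diff_divide_distrib)
  finally have "(sample \<rho> N j * cnj (sample \<rho> N l))\<^sup>2 = of_real (\<rho> ^ 4) * cis t"
    by (simp add: power_mult_distrib power_mult[symmetric] Complex.DeMoivre)
  then have im: "Im (1 - (sample \<rho> N j * cnj (sample \<rho> N l))\<^sup>2) = - (\<rho> ^ 4 * sin t)"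
    by simp
  have sin: "\<bar>t\<bar> / 2 \<le> \<bar>sin t\<bar>"
  proof -
    have "t / 2 \<le> sin t" if "0 \<le> t" "t \<le> 1" for t :: real
    proof -
      have "\<bar>sin t - (\<Sum>m<3. sin_coeff m * t ^ m)\<bar> \<le> inverse (fact 3) * \<bar>t\<bar> ^ 3"
        by (rule Maclaurin_sin_bound)
      then have "\<bar>sin t - t\<bar> \<le> t ^ 3 / 6"
        using that by (simp add: sin_coeff_def numeral_eq_Suc fact_numeral divide_simps)
      moreover have "t ^ 3 \<le> t" using that power_decreasing[of 1 3 t] by simp
      ultimately show ?thesis using that by linarith
    qed
    from this[of "\<bar>t\<bar>"] t show ?thesis by (cases "t \<ge> 0") auto
  qed
  have "1/2 * (\<bar>t\<bar> / 2) \<le> \<rho> ^ 4 * \<bar>sin t\<bar>"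
    using \<rho> sin by (intro mult_mono) auto
  also have "\<dots> = \<bar>Im (1 - (sample \<rho> N j * cnj (sample \<rho> N l))\<^sup>2)\<bar>"
    unfolding im using \<rho> by (simp add: abs_mult)
  also have "\<dots> \<le> norm (1 - (sample \<rho> N j * cnj (sample \<rho> N l))\<^sup>2)" by (rule abs_Im_le_cmod)
  \<comment> \<open>The inequality \<open>2 \<le> pi\<close> makes up for the factor 1/2 lost to
    \<open>\<rho> ^ 4\<close>.\<close>
  finally have "2 * (1/2 * (\<bar>t\<bar> / 2)) \<le> pi * norm (1 - (sample \<rho> N j * cnj (sample \<rho> N l))\<^sup>2)"
    using pi_ge_two by (intro mult_mono) auto
  moreover have "\<bar>real j - real l\<bar> / (2 * real N) = 2 * (1/2 * (\<bar>t\<bar> / 2))" by (simp add: t_def)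
  ultimately show ?thesis by simp
qed

lemma L2_inner_mehler_op_sample:
  fixes f g :: "real^'n::finite \<Rightarrow> complex"
  assumes \<rho>: "0 < \<rho>" "\<rho> < 1" "1/2 \<le> \<rho> ^ 4" and \<sigma>: "real CARD('n) / 2 \<le> \<sigma>"
    and f: "f \<in> L2" "integrable lborel f" and g: "g \<in> L2" "integrable lborel g"
    and N: "j < N" "l < N" "j \<noteq> l"
  shows "norm (L2_inner (mehler_op (sample \<rho> N j) f) (mehler_op (sample \<rho> N l) g)) \<le>
    (2 * real N) powr \<sigma> * ((LBINT x. norm (f x)) * (LBINT x. norm (g x))) * \<bar>real j - real l\<bar> powr - \<sigma>"
proof -
  define z where "z = sample \<rho> N j * cnj (sample \<rho> N l)"
  define d where "d = \<bar>real j - real l\<bar>"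
  have d: "0 < d" "d \<le> 2 * real N" using N by (auto simp: d_def)
  have s: "norm (sample \<rho> N j) < 1" "norm (sample \<rho> N l) < 1" using \<rho> by (auto simp: norm_sample)
  have z: "norm z < 1"
    using \<rho> by (simp add: z_def norm_mult norm_sample power2_eq_square[symmetric] abs_square_less_1)
  have "(1 / sqrt (pi * norm (1 - z\<^sup>2))) ^ CARD('n) \<le> (1 / sqrt (d / (2 * real N))) ^ CARD('n)"
  proof (intro power_mono divide_left_mono)
    have pos: "0 < d / (2 * real N)" using d by simp
    have le: "d / (2 * real N) \<le> pi * norm (1 - z\<^sup>2)"
      unfolding z_def d_def by (rule norm_one_minus_sample_square[OF \<rho> N])
    show "sqrt (d / (2 * real N)) \<le> sqrt (pi * norm (1 - z\<^sup>2))" using le by (rule real_sqrt_le_mono)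
    show "0 < sqrt (pi * norm (1 - z\<^sup>2)) * sqrt (d / (2 * real N))"
      using pos le by (intro mult_pos_pos) auto
  qed auto
  also have "\<dots> = (2 * real N / d) powr (real CARD('n) / 2)"
  proof -
    have "1 / sqrt (d / (2 * real N)) = (2 * real N / d) powr (1/2)"
      using d by (simp add: powr_half_sqrt real_sqrt_divide)
    then show ?thesis using d by (simp add: powr_realpow[symmetric] powr_powr)
  qed
  \<comment> \<open>The base is at least 1 because all times lie on a bounded arc, so the decay rate
    may be weakened from half the dimension to \<sigma>.\<close>
  also have "\<dots> \<le> (2 * real N / d) powr \<sigma>"
    using d \<sigma> by (intro powr_mono) auto
  also have "\<dots> = (2 * real N) powr \<sigma> * d powr - \<sigma>"
    using d by (simp add: powr_divide powr_minus_divide)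
  finally have K: "(1 / sqrt (pi * norm (1 - z\<^sup>2))) ^ CARD('n) \<le> (2 * real N) powr \<sigma> * d powr - \<sigma>" .
  have gc: "integrable lborel (\<lambda>x. cnj (g x))" using g(2) by simp
  have "norm (L2_inner (mehler_op (sample \<rho> N j) f) (mehler_op (sample \<rho> N l) g)) \<le>
    (1 / sqrt (pi * norm (1 - z\<^sup>2))) ^ CARD('n) * (LBINT x. norm (f x)) * (LBINT x. norm (g x))"
    using mehler_op_dispersive[OF z f L2_cnj[OF g(1)] gc]
    unfolding L2_inner_mehler_op[OF s f(1) g(1)] z_def by simp
  also have "\<dots> \<le> (2 * real N) powr \<sigma> * d powr - \<sigma> * (LBINT x. norm (f x)) * (LBINT x. norm (g x))"
    by (intro mult_right_mono K) (auto intro: integral_nonneg_AE)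
  finally show ?thesis by (simp add: d_def mult_ac)
qed

text \<open>An atom of height \<open>h\<close> on a set of finite measure: the pair of
  \<open>h\<close> and the measure of \<open>E\<close> controls both the integral norm and the
  square norm.\<close>

definition bounded_supp :: "(real^'n::finite \<Rightarrow> complex) \<Rightarrow> real \<Rightarrow> (real^'n) set \<Rightarrow> bool" where
  "bounded_supp f h E \<longleftrightarrow> f \<in> borel_measurable borel \<and> E \<in> sets borel \<and> emeasure lborel E < \<infinity> \<and> 0 \<le> h \<and>
     (\<forall>x. norm (f x) \<le> h * indicator E x)"

lemma bounded_suppD:
  fixes f :: "real^'n::finite \<Rightarrow> complex"
  assumes "bounded_supp f h E"
  shows "f \<in> L2" "integrable lborel f" "l2norm f \<le> h * sqrt (measure lborel E)"
    "(LBINT x. norm (f x)) \<le> h * measure lborel E"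
proof -
  have f [measurable]: "f \<in> borel_measurable borel" and E: "E \<in> sets borel" "emeasure lborel E < \<infinity>" and h: "0 \<le> h"
    and bd: "\<And>x. norm (f x) \<le> h * indicator E x"
    using assms by (auto simp: bounded_supp_def)
  have i: "integrable lborel (\<lambda>x. indicator E x :: real)" using E by (simp add: integrable_indicator_iff)
  have sq: "(norm (f x))\<^sup>2 \<le> h\<^sup>2 * indicator E x" for x
    using power_mono[OF bd norm_ge_zero, of x 2] by (cases "x \<in> E") (auto simp: power_mult_distrib)
  show "f \<in> L2" by (rule L2_dominated[OF _ _ sq]) (use i in auto)
  show "integrable lborel f"
    by (rule Bochner_Integration.integrable_bound[of _ "\<lambda>x. h * indicator E x"])
       (use i bd h in \<open>auto intro!: AE_I2 simp: abs_mult\<close>)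
  have "(LBINT x. (norm (f x))\<^sup>2) \<le> (LBINT x. h\<^sup>2 * indicator E x)"
    by (rule integral_mono'[OF _ sq]) (use i in auto)
  then have "(l2norm f)\<^sup>2 \<le> h\<^sup>2 * measure lborel E" using E by (simp add: l2norm_square)
  then have "(l2norm f)\<^sup>2 \<le> (h * sqrt (measure lborel E))\<^sup>2" by (simp add: power_mult_distrib)
  then show "l2norm f \<le> h * sqrt (measure lborel E)" by (rule power2_le_imp_le) (use h in auto)
  have "(LBINT x. norm (f x)) \<le> (LBINT x. h * indicator E x)"
    by (rule integral_mono'[OF _ bd]) (use i h in auto)
  then show "(LBINT x. norm (f x)) \<le> h * measure lborel E" using E by simp
qed

text \<open>The weights \<open>b\<close> will have modulus \<open>1 / N\<close> and carry phases
  matched to the eigenvalue. A finite sum replaces the integral over the arc.\<close>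

definition time_average :: "real \<Rightarrow> nat \<Rightarrow> (nat \<Rightarrow> complex) \<Rightarrow> (real^'n::finite \<Rightarrow> complex) \<Rightarrow> real^'n \<Rightarrow> complex" where
  "time_average \<rho> N b f x = (\<Sum>j<N. b j * mehler_op (sample \<rho> N j) f x)"

lemma nat_ceiling_bounds:
  fixes t :: real assumes "t \<ge> 1"
  shows "nat \<lceil>t\<rceil> \<ge> 1" "t \<le> real (nat \<lceil>t\<rceil>)" "real (nat \<lceil>t\<rceil>) \<le> 2 * t"
proof -
  have 1: "real (nat \<lceil>t\<rceil>) = of_int \<lceil>t\<rceil>" using assms by simp
  show "t \<le> real (nat \<lceil>t\<rceil>)" unfolding 1 by (rule le_of_int_ceiling)
  then show "nat \<lceil>t\<rceil> \<ge> 1" using assms by linarith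
  have "of_int \<lceil>t\<rceil> < t + 1" using ceiling_correct[of t] by linarith
  then show "real (nat \<lceil>t\<rceil>) \<le> 2 * t" unfolding 1 using assms by linarith
qed

text \<open>Squaring produces a Gram matrix whose rows are split at a separation depending on
  \<open>e\<close> alone, so a row sum is of order
  \<open>N * h\<^sup>2 * e powr (1 + 1 / \<sigma>)\<close> irrespective of the window. The window
  enters through the number of rows, which yields exactly one factor \<delta>.\<close>

lemma window_average_bound:
  fixes f :: "real^'n::finite \<Rightarrow> complex"
  assumes \<rho>: "0 < \<rho>" "\<rho> < 1" "1/2 \<le> \<rho> ^ 4" and \<sigma>: "1 < \<sigma>" "real CARD('n) / 2 \<le> \<sigma>"
    and f: "bounded_supp f h E" and e: "e = measure lborel E" "0 < e"
    and N: "1 \<le> real N * e powr (1 / \<sigma>)" and b: "\<And>j. j < N \<Longrightarrow> norm (b j) \<le> 1 / real N"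
    and W: "W \<subseteq> {..<N}" "real (card W) \<le> 3 * (2 * \<delta> * real N)"
  shows "(l2norm (\<lambda>x. \<Sum>j\<in>W. b j * mehler_op (sample \<rho> N j) f x))\<^sup>2 \<le>
    6 * (6 * 4 ^ CARD('n) + 2 * 2 powr \<sigma> / (\<sigma> - 1)) * \<delta> * h\<^sup>2 * e powr (1 + 1 / \<sigma>)"
proof -
  let ?U = "\<lambda>j. mehler_op (sample \<rho> N j)"
  note F = bounded_suppD[OF f]
  have h: "0 \<le> h" using f by (simp add: bounded_supp_def)
  have N0: "real N > 0" using N by (cases "N = 0") auto
  \<comment> \<open>At separation \<open>s\<close> the dispersive bound
    \<open>s powr - \<sigma> * (h * e)\<^sup>2\<close> equals the square bound
    \<open>h\<^sup>2 * e\<close>; below it the latter is better, above it the former.\<close>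
  define s where "s = e powr (1 / \<sigma>)"
  have s: "0 < s" using e by (simp add: s_def)
  define J where "J = nat \<lceil>real N * s\<rceil>"
  have J: "J \<ge> 1" "real N * s \<le> real J" "real J \<le> 2 * (real N * s)"
    using nat_ceiling_bounds[OF N] by (auto simp: J_def s_def)
  define G where "G j l = norm (L2_inner (?U j f) (?U l f))" for j l
  have sm: "norm (sample \<rho> N j) < 1" for j using \<rho> by (simp add: norm_sample)
  have UL: "?U j f \<in> L2" for j by (rule mehler_op_L2[OF sm F(1)])
  have D2: "(l2norm f)\<^sup>2 \<le> h\<^sup>2 * e"
    using power_mono[OF F(3) l2norm_nonneg, of 2] e by (simp add: power_mult_distrib)
  have G1: "G j l \<le> 4 ^ CARD('n) * (h\<^sup>2 * e)" for j l
  proof -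
    have "G j l \<le> l2norm (?U j f) * l2norm (?U l f)"
      unfolding G_def by (rule norm_L2_inner_le[OF UL UL])
    also have "\<dots> \<le> (2 ^ CARD('n) * l2norm f) * (2 ^ CARD('n) * l2norm f)"
      by (intro mult_mono l2norm_mehler_op_sample \<rho> F) auto
    also have "\<dots> = 4 ^ CARD('n) * (l2norm f)\<^sup>2"
      by (simp add: power2_eq_square power_mult_distrib[symmetric])
    also have "\<dots> \<le> 4 ^ CARD('n) * (h\<^sup>2 * e)" by (intro mult_left_mono D2) auto
    finally show ?thesis .
  qed
  have A2: "(LBINT x. norm (f x)) * (LBINT x. norm (f x)) \<le> (h * e) * (h * e)"
    using F(4) e h by (intro mult_mono) (auto intro: integral_nonneg_AE)
  have G2: "G j l \<le> (2 * real N) powr \<sigma> * ((h * e) * (h * e)) * \<bar>real j - real l\<bar> powr - \<sigma>"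
    if "j < N" "l < N" "l \<noteq> j" for j l
  proof -
    have "G j l \<le> (2 * real N) powr \<sigma> * ((LBINT x. norm (f x)) * (LBINT x. norm (f x))) * \<bar>real j - real l\<bar> powr - \<sigma>"
      unfolding G_def by (rule L2_inner_mehler_op_sample[OF \<rho> \<sigma>(2) F(1,2) F(1,2)]) (use that in auto)
    also have "\<dots> \<le> (2 * real N) powr \<sigma> * ((h * e) * (h * e)) * \<bar>real j - real l\<bar> powr - \<sigma>"
      by (intro mult_right_mono mult_left_mono A2) auto
    finally show ?thesis .
  qed
  define T where "T = 2 * 2 powr \<sigma> / (\<sigma> - 1)"
  have row: "(\<Sum>l<N. G j l) \<le> real N * ((6 * 4 ^ CARD('n) + T) * (h\<^sup>2 * e powr (1 + 1 / \<sigma>)))" if "j < N" for j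
  proof -
    have "(\<Sum>l<N. G j l) \<le> 3 * real J * (4 ^ CARD('n) * (h\<^sup>2 * e)) +
       (2 * real N) powr \<sigma> * ((h * e) * (h * e)) * (2 * (real J powr (1 - \<sigma>) / (\<sigma> - 1)))"
      by (rule row_sum_le[OF \<sigma>(1) J(1)]) (use G1 G2 that e in auto)
    also have "\<dots> \<le> 3 * (2 * (real N * s)) * (4 ^ CARD('n) * (h\<^sup>2 * e)) +
       (2 * real N) powr \<sigma> * ((h * e) * (h * e)) * (2 * ((real N * s) powr (1 - \<sigma>) / (\<sigma> - 1)))"
    proof (intro add_mono mult_right_mono mult_left_mono divide_right_mono)
      show "real J powr (1 - \<sigma>) \<le> (real N * s) powr (1 - \<sigma>)"
        using J N0 s \<sigma> by (intro powr_mono2') auto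
    qed (use J \<sigma> e in auto)
    also have "3 * (2 * (real N * s)) * (4 ^ CARD('n) * (h\<^sup>2 * e)) = real N * (6 * 4 ^ CARD('n) * (h\<^sup>2 * (e * s)))"
      by (simp add: mult_ac)
    also have "e * s = e powr (1 + 1 / \<sigma>)" using e by (simp add: s_def powr_add)
    also have "(2 * real N) powr \<sigma> * ((h * e) * (h * e)) * (2 * ((real N * s) powr (1 - \<sigma>) / (\<sigma> - 1)))
       = real N * (T * (h\<^sup>2 * (e\<^sup>2 * s powr (1 - \<sigma>))))"
    proof -
      have "(2 * real N) powr \<sigma> * (real N * s) powr (1 - \<sigma>) = real N * (2 powr \<sigma> * s powr (1 - \<sigma>))"
        using N0 s by (simp add: powr_mult powr_add[symmetric])
      then show ?thesis by (simp add: T_def power2_eq_square mult_ac)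
    qed
    also have "e\<^sup>2 * s powr (1 - \<sigma>) = e powr (1 + 1 / \<sigma>)"
    proof -
      have "e\<^sup>2 * s powr (1 - \<sigma>) = e powr (2 + 1 / \<sigma> * (1 - \<sigma>))"
      proof -
        have "s powr (1 - \<sigma>) = e powr (1 / \<sigma> * (1 - \<sigma>))" by (simp only: s_def powr_powr)
        moreover have "e\<^sup>2 = e powr 2" using e by simp
        ultimately show ?thesis by (simp only: powr_add)
      qed
      also have "2 + 1 / \<sigma> * (1 - \<sigma>) = 1 + 1 / \<sigma>" using \<sigma> by (simp add: field_simps)
      finally show ?thesis .
    qed
    finally show ?thesis by (simp add: algebra_simps)
  qed
  have G0: "0 \<le> G j l" for j l by (simp add: G_def)

  have "(l2norm (\<lambda>x. \<Sum>j\<in>W. b j * ?U j f x))\<^sup>2 \<le>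
     (\<Sum>j\<in>W. \<Sum>l\<in>W. norm (L2_inner (\<lambda>x. b j * ?U j f x) (\<lambda>x. b l * ?U l f x)))"
    by (rule l2norm_sum_square_le) (intro L2_scale UL)
  also have "\<dots> = (\<Sum>j\<in>W. \<Sum>l\<in>W. norm (b j) * (norm (b l) * G j l))"
    by (simp add: L2_inner_scale_left L2_inner_scale_right norm_mult G_def)
  also have "\<dots> \<le> (\<Sum>j\<in>W. \<Sum>l\<in>W. 1 / real N * (1 / real N * G j l))"
    using W b G0 by (intro sum_mono mult_mono) (auto simp: subset_eq)
  \<comment> \<open>The inner sum is enlarged to all times, where the row bound applies; only the
    outer sum keeps the window.\<close>
  also have "\<dots> \<le> (\<Sum>j\<in>W. \<Sum>l<N. 1 / real N * (1 / real N * G j l))"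
    using W G0 by (intro sum_mono sum_mono2) auto
  also have "\<dots> = (\<Sum>j\<in>W. 1 / real N * (1 / real N * (\<Sum>l<N. G j l)))"
    by (simp add: sum_distrib_left)
  also have "\<dots> \<le> real (card W) * (1 / real N * ((6 * 4 ^ CARD('n) + T) * (h\<^sup>2 * e powr (1 + 1 / \<sigma>))))"
  proof (rule sum_bounded_above)
    fix j assume "j \<in> W"
    then have "(\<Sum>l<N. G j l) \<le> real N * ((6 * 4 ^ CARD('n) + T) * (h\<^sup>2 * e powr (1 + 1 / \<sigma>)))"
      using W by (intro row) auto
    then have "1 / real N * (\<Sum>l<N. G j l) \<le> (6 * 4 ^ CARD('n) + T) * (h\<^sup>2 * e powr (1 + 1 / \<sigma>))"
      using N0 by (simp add: field_simps)
    then show "1 / real N * (1 / real N * (\<Sum>l<N. G j l)) \<le> 1 / real N * ((6 * 4 ^ CARD('n) + T) * (h\<^sup>2 * e powr (1 + 1 / \<sigma>)))"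
      by (intro mult_left_mono) auto
  qed
  also have "\<dots> \<le> (3 * (2 * \<delta> * real N)) * (1 / real N * ((6 * 4 ^ CARD('n) + T) * (h\<^sup>2 * e powr (1 + 1 / \<sigma>))))"
    using \<sigma> by (intro mult_right_mono W mult_nonneg_nonneg add_nonneg_nonneg) (auto simp: T_def)
  also have "\<dots> = 6 * (6 * 4 ^ CARD('n) + T) * \<delta> * h\<^sup>2 * e powr (1 + 1 / \<sigma>)"
    using N0 by (simp add: mult_ac)
  finally show ?thesis by (simp add: T_def)
qed

text \<open>The estimate is made for each sample time \<open>l\<close> of \<open>g\<close> and then
  averaged. Times of \<open>f\<close> within \<delta> form a window, to which Cauchy-Schwarz
  applies; the remaining times are summed by the dispersive bound and leave
  \<open>\<delta> powr (1 - \<sigma>)\<close>. The two functions enter asymmetrically. The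
  conditions on \<open>N\<close> make both cuts at least one sample step long.\<close>

lemma time_average_bilinear_bound:
  fixes f g :: "real^'n::finite \<Rightarrow> complex"
  assumes \<rho>: "0 < \<rho>" "\<rho> < 1" "1/2 \<le> \<rho> ^ 4" and \<sigma>: "1 < \<sigma>" "real CARD('n) / 2 \<le> \<sigma>"
    and f: "bounded_supp f h E" and e: "e = measure lborel E" "0 < e"
    and g: "bounded_supp g h' E'" and e': "e' = measure lborel E'"
    and N: "1 \<le> real N * e powr (1 / \<sigma>)" "1 \<le> real N * \<delta>" and b: "\<And>j. j < N \<Longrightarrow> norm (b j) \<le> 1 / real N"
  shows "norm (L2_inner (time_average \<rho> N b f) (time_average \<rho> N b g)) \<le>
    (sqrt (6 * (6 * 4 ^ CARD('n) + 2 * 2 powr \<sigma> / (\<sigma> - 1))) * 2 ^ CARD('n) + 2 * 2 powr \<sigma> / (\<sigma> - 1)) * (h * h') *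
     (\<delta> powr (1/2) * e powr (1/2 + 1 / (2 * \<sigma>)) * e' powr (1/2) + \<delta> powr (1 - \<sigma>) * (e * e'))"
proof -
  let ?U = "\<lambda>j. mehler_op (sample \<rho> N j)"
  note F = bounded_suppD[OF f] and G = bounded_suppD[OF g]
  have h: "0 \<le> h" "0 \<le> h'" using f g by (simp_all add: bounded_supp_def)
  have e'0: "0 \<le> e'" using e' by simp
  have N0: "real N > 0" using N by (cases "N = 0") auto
  have \<delta>: "\<delta> > 0" using N N0 by (metis less_le_trans zero_less_one zero_less_mult_pos)
  define J where "J = nat \<lceil>real N * \<delta>\<rceil>"
  have J: "J \<ge> 1" "real N * \<delta> \<le> real J" "real J \<le> 2 * (real N * \<delta>)"
    using nat_ceiling_bounds[OF N(2)] by (auto simp: J_def)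
  have sm: "norm (sample \<rho> N j) < 1" for j using \<rho> by (simp add: norm_sample)
  have Uf: "?U j f \<in> L2" and Ug: "?U j g \<in> L2" for j
    by (rule mehler_op_L2[OF sm F(1)], rule mehler_op_L2[OF sm G(1)])
  define T where "T = 2 * 2 powr \<sigma> / (\<sigma> - 1)"
  have T: "T \<ge> 0" using \<sigma> by (simp add: T_def)
  define C where "C = 6 * (6 * 4 ^ CARD('n) + T)"
  have C: "C \<ge> 0" using T by (simp add: C_def)
  define X where "X = sqrt C * (\<delta> powr (1/2) * h * e powr (1/2 + 1 / (2 * \<sigma>))) * (2 ^ CARD('n) * (h' * e' powr (1/2)))
     + T * (\<delta> powr (1 - \<sigma>) * ((h * e) * (h' * e')))"
  have Vf: "time_average \<rho> N b f \<in> L2"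
    unfolding time_average_def[abs_def] by (intro L2_sum L2_scale Uf)
  have row: "norm (L2_inner (time_average \<rho> N b f) (?U l g)) \<le> X" if l: "l < N" for l
  proof -
    \<comment> \<open>The near times are kept together as one function \<open>w\<close>. Estimating
      its norm as a whole saves a factor \<open>\<delta> powr (1/2)\<close> with a power of
      \<open>e\<close>, which termwise bounds would lose.\<close>
    define A where "A = {j. j < N \<and> \<not> real J < \<bar>real l - real j\<bar>}"
    define B where "B = {j. j < N \<and> real J < \<bar>real l - real j\<bar>}"
    have AB: "{..<N} = A \<union> B" "A \<inter> B = {}" "finite A" "finite B" by (auto simp: A_def B_def)
    define w where "w x = (\<Sum>j\<in>A. b j * ?U j f x)" for x
    have w: "w \<in> L2" unfolding w_def by (intro L2_sum L2_scale Uf)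
    have "L2_inner (time_average \<rho> N b f) (?U l g) =
       (\<Sum>j<N. b j * L2_inner (?U j f) (?U l g))"
      unfolding time_average_def[abs_def] by (subst L2_inner_sum_left) (auto intro: L2_scale Uf Ug simp: L2_inner_scale_left)
    also have "\<dots> = (\<Sum>j\<in>A. b j * L2_inner (?U j f) (?U l g)) +
       (\<Sum>j\<in>B. b j * L2_inner (?U j f) (?U l g))"
      unfolding AB(1) using AB by (intro sum.union_disjoint) auto
    also have "(\<Sum>j\<in>A. b j * L2_inner (?U j f) (?U l g)) = L2_inner w (?U l g)"
      unfolding w_def by (subst L2_inner_sum_left) (auto intro: L2_scale Uf Ug simp: L2_inner_scale_left)
    finally have "norm (L2_inner (time_average \<rho> N b f) (?U l g)) = norm (L2_inner w (?U l g) +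
       (\<Sum>j\<in>B. b j * L2_inner (?U j f) (?U l g)))"
      by (rule arg_cong)
    also have "\<dots> \<le> norm (L2_inner w (?U l g)) +
       norm (\<Sum>j\<in>B. b j * L2_inner (?U j f) (?U l g))"
      by (rule norm_triangle_ineq)
    finally have split: "norm (L2_inner (time_average \<rho> N b f) (?U l g)) \<le>
       norm (L2_inner w (?U l g)) +
       norm (\<Sum>j\<in>B. b j * L2_inner (?U j f) (?U l g))" .
    have near: "norm (L2_inner w (?U l g)) \<le>
       sqrt C * (\<delta> powr (1/2) * h * e powr (1/2 + 1 / (2 * \<sigma>))) * (2 ^ CARD('n) * (h' * e' powr (1/2)))"
    proof -
      have "(l2norm w)\<^sup>2 \<le> C * \<delta> * h\<^sup>2 * e powr (1 + 1 / \<sigma>)"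
        unfolding w_def C_def T_def
      proof (rule window_average_bound[OF \<rho> \<sigma> f e N(1) b])
        have "real (card A) \<le> 3 * real J" unfolding A_def by (rule card_near_le[OF J(1)])
        also have "\<dots> \<le> 3 * (2 * \<delta> * real N)" using J by (simp add: mult_ac)
        finally show "real (card A) \<le> 3 * (2 * \<delta> * real N)" .
      qed (auto simp: A_def)
      also have "\<dots> = (sqrt C * (\<delta> powr (1/2) * h * e powr (1/2 + 1 / (2 * \<sigma>))))\<^sup>2"
      proof -
        have "(\<delta> powr (1/2))\<^sup>2 = \<delta>" using \<delta> by (simp add: powr_half_sqrt)
        moreover have "(e powr (1/2 + 1 / (2 * \<sigma>)))\<^sup>2 = e powr (1 + 1 / \<sigma>)"
          using e by (simp add: power2_eq_square powr_add[symmetric])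
        ultimately show ?thesis using C by (simp add: power_mult_distrib)
      qed
      finally have lw: "l2norm w \<le> sqrt C * (\<delta> powr (1/2) * h * e powr (1/2 + 1 / (2 * \<sigma>)))"
        by (rule power2_le_imp_le) (use C h in auto)
      have "l2norm (?U l g) \<le> 2 ^ CARD('n) * l2norm g"
        by (rule l2norm_mehler_op_sample[OF \<rho> G(1)])
      also have "\<dots> \<le> 2 ^ CARD('n) * (h' * e' powr (1/2))"
        using G(3) e' by (intro mult_left_mono) (auto simp: powr_half_sqrt)
      finally have lg: "l2norm (?U l g) \<le> 2 ^ CARD('n) * (h' * e' powr (1/2))" .
      have "norm (L2_inner w (?U l g)) \<le> l2norm w * l2norm (?U l g)"
        by (rule norm_L2_inner_le[OF w Ug])
      also have "\<dots> \<le> sqrt C * (\<delta> powr (1/2) * h * e powr (1/2 + 1 / (2 * \<sigma>))) * (2 ^ CARD('n) * (h' * e' powr (1/2)))"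
        by (intro mult_mono lw lg) (use C h in auto)
      finally show ?thesis .
    qed
    have far: "norm (\<Sum>j\<in>B. b j * L2_inner (?U j f) (?U l g)) \<le>
       T * (\<delta> powr (1 - \<sigma>) * ((h * e) * (h' * e')))"
    proof -
      have AA: "(LBINT x. norm (f x)) * (LBINT x. norm (g x)) \<le> (h * e) * (h' * e')"
        using F(4) G(4) e e' h by (intro mult_mono) (auto intro: integral_nonneg_AE)
      have "norm (\<Sum>j\<in>B. b j * L2_inner (?U j f) (?U l g)) \<le>
         (\<Sum>j\<in>B. norm (b j) * norm (L2_inner (?U j f) (?U l g)))"
        by (intro order_trans[OF norm_sum]) (simp add: norm_mult)
      also have "\<dots> \<le> (\<Sum>j\<in>B. 1 / real N * ((2 * real N) powr \<sigma> * ((h * e) * (h' * e')) * \<bar>real l - real j\<bar> powr - \<sigma>))"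
      proof (intro sum_mono mult_mono)
        fix j assume j: "j \<in> B"
        then have jN: "j < N" "j \<noteq> l" by (auto simp: B_def)
        show "norm (b j) \<le> 1 / real N" by (rule b[OF jN(1)])
        have "norm (L2_inner (?U j f) (?U l g)) \<le>
          (2 * real N) powr \<sigma> * ((LBINT x. norm (f x)) * (LBINT x. norm (g x))) * \<bar>real j - real l\<bar> powr - \<sigma>"
          by (rule L2_inner_mehler_op_sample[OF \<rho> \<sigma>(2) F(1,2) G(1,2) jN(1) l jN(2)])
        also have "\<dots> \<le> (2 * real N) powr \<sigma> * ((h * e) * (h' * e')) * \<bar>real j - real l\<bar> powr - \<sigma>"
          by (intro mult_right_mono mult_left_mono AA) auto
        finally show "norm (L2_inner (?U j f) (?U l g)) \<le>
          (2 * real N) powr \<sigma> * ((h * e) * (h' * e')) * \<bar>real l - real j\<bar> powr - \<sigma>"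
          by (simp add: abs_minus_commute)
      qed auto
      also have "\<dots> = 1 / real N * ((2 * real N) powr \<sigma> * ((h * e) * (h' * e'))) * (\<Sum>j\<in>B. \<bar>real l - real j\<bar> powr - \<sigma>)"
        unfolding sum_distrib_left by (intro sum.cong refl) (simp only: mult.assoc)
      also have "\<dots> \<le> 1 / real N * ((2 * real N) powr \<sigma> * ((h * e) * (h' * e'))) * (2 * (real J powr (1 - \<sigma>) / (\<sigma> - 1)))"
        unfolding B_def using h e e'0 by (intro mult_left_mono far_sum_le \<sigma> J) auto
      also have "\<dots> \<le> 1 / real N * ((2 * real N) powr \<sigma> * ((h * e) * (h' * e'))) * (2 * ((real N * \<delta>) powr (1 - \<sigma>) / (\<sigma> - 1)))"
      proof (intro mult_left_mono divide_right_mono)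
        show "real J powr (1 - \<sigma>) \<le> (real N * \<delta>) powr (1 - \<sigma>)"
          using J N0 \<delta> \<sigma> by (intro powr_mono2') auto
      qed (use h e e'0 \<sigma> in auto)
      also have "\<dots> = T * (\<delta> powr (1 - \<sigma>) * ((h * e) * (h' * e')))"
      proof -
        have "(2 * real N) powr \<sigma> * (real N * \<delta>) powr (1 - \<sigma>) = real N * (2 powr \<sigma> * \<delta> powr (1 - \<sigma>))"
          using N0 \<delta> by (simp add: powr_mult powr_add[symmetric])
        then have "1 / real N * ((2 * real N) powr \<sigma> * (real N * \<delta>) powr (1 - \<sigma>)) = 2 powr \<sigma> * \<delta> powr (1 - \<sigma>)"
          using N0 by simp
        moreover have "1 / real N * ((2 * real N) powr \<sigma> * ((h * e) * (h' * e'))) * (2 * ((real N * \<delta>) powr (1 - \<sigma>) / (\<sigma> - 1)))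
          = 1 / real N * ((2 * real N) powr \<sigma> * (real N * \<delta>) powr (1 - \<sigma>)) * (2 / (\<sigma> - 1) * ((h * e) * (h' * e')))"
          by simp
        ultimately show ?thesis by (simp add: T_def)
      qed
      finally show ?thesis .
    qed
    show ?thesis using split near far unfolding X_def by linarith
  qed
  have X0: "X \<ge> 0" using row[of 0] N0 norm_ge_zero order_trans by (metis of_nat_0_less_iff)
  have "L2_inner (time_average \<rho> N b f) (time_average \<rho> N b g) =
     (\<Sum>l<N. cnj (b l) * L2_inner (time_average \<rho> N b f) (?U l g))"
  proof -
    have "time_average \<rho> N b g = (\<lambda>x. \<Sum>l<N. b l * ?U l g x)"
      by (rule ext) (rule time_average_def)
    then show ?thesis
      by (simp only:, subst L2_inner_sum_right) (auto intro: L2_scale Vf Ug simp: L2_inner_scale_right)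
  qed
  also have "norm \<dots> \<le> (\<Sum>l<N. norm (b l) * norm (L2_inner (time_average \<rho> N b f) (?U l g)))"
    by (intro order_trans[OF norm_sum]) (simp add: norm_mult)
  also have "\<dots> \<le> (\<Sum>l<N. 1 / real N * X)"
    using b row X0 by (intro sum_mono mult_mono) auto
  also have "\<dots> = X" using N0 by simp
  also have "X \<le> (sqrt C * 2 ^ CARD('n) + T) * (h * h') *
     (\<delta> powr (1/2) * e powr (1/2 + 1 / (2 * \<sigma>)) * e' powr (1/2) + \<delta> powr (1 - \<sigma>) * (e * e'))"
  proof -
    define P Q where "P = \<delta> powr (1/2) * e powr (1/2 + 1 / (2 * \<sigma>)) * e' powr (1/2)" and "Q = \<delta> powr (1 - \<sigma>) * (e * e')"
    have PQ: "P \<ge> 0" "Q \<ge> 0" using e e'0 by (auto simp: P_def Q_def)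
    have "X = (h * h') * (sqrt C * 2 ^ CARD('n) * P + T * Q)"
      unfolding X_def P_def Q_def by (simp add: algebra_simps)
    also have "\<dots> \<le> (h * h') * ((sqrt C * 2 ^ CARD('n) + T) * (P + Q))"
      using h PQ C T by (intro mult_left_mono) (auto simp: algebra_simps)
    finally show ?thesis unfolding P_def Q_def by (simp add: mult_ac)
  qed
  finally show ?thesis by (simp add: C_def T_def)
qed

section \<open>The endpoint estimate\<close>

text \<open>With \<open>\<delta> = e' powr (1 / \<sigma>)\<close> the first term gains nothing over
  the product of the powers, and with \<delta> the geometric mean of
  \<open>e powr (1 / \<sigma>)\<close> and \<open>e' powr (1 / \<sigma>)\<close> the second gains
  nothing. The exponents 1/4 and 3/4 lie halfway between these extremes, so both terms gain a power
  of \<open>e / e'\<close>.\<close>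

lemma optimized_split_bound:
  fixes e e' \<sigma> :: real
  assumes \<sigma>: "1 < \<sigma>" and e: "0 < e" "e \<le> e'"
    and \<delta>: "\<delta> = e powr (1 / (4 * \<sigma>)) * e' powr (3 / (4 * \<sigma>))"
    and \<eta>: "\<eta> \<le> 1 / (8 * \<sigma>)" "\<eta> \<le> (\<sigma> - 1) / (4 * \<sigma>)"
  shows "\<delta> powr (1/2) * e powr (1/2 + 1 / (2 * \<sigma>)) * e' powr (1/2) + \<delta> powr (1 - \<sigma>) * (e * e')
    \<le> 2 * ((e powr (1/2 + 1 / (2 * \<sigma>)) * e' powr (1/2 + 1 / (2 * \<sigma>))) * (e / e') powr \<eta>)"
proof -
  \<comment> \<open>In logarithms each claim is a linear identity between exponents.\<close>
  define a b where "a = ln e" and "b = ln e'"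
  have e': "0 < e'" using e by simp
  have ab: "a \<le> b" using e by (simp add: a_def b_def)
  have ea: "e = exp a" "e' = exp b" using e e' by (auto simp: a_def b_def)
  have E: "exp x powr y = exp (x * y)" for x y :: real by (simp add: powr_def mult.commute)
  have \<delta>e: "\<delta> = exp (a * (1 / (4 * \<sigma>)) + b * (3 / (4 * \<sigma>)))" unfolding \<delta> ea E by (simp add: exp_add)
  define R where "R = (e powr (1/2 + 1 / (2 * \<sigma>)) * e' powr (1/2 + 1 / (2 * \<sigma>))) * (e / e') powr \<eta>"
  have R: "R = exp (a * (1/2 + 1 / (2 * \<sigma>)) + b * (1/2 + 1 / (2 * \<sigma>)) + (a - b) * \<eta>)"
  proof -
    have "e / e' = exp (a - b)" unfolding ea by (simp add: exp_diff)
    then show ?thesis unfolding R_def ea by (simp add: E exp_add)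
  qed
  have c1: "(a - b) * (1 / (8 * \<sigma>)) \<le> (a - b) * \<eta>" and c2: "(a - b) * ((\<sigma> - 1) / (4 * \<sigma>)) \<le> (a - b) * \<eta>"
    using ab by (auto intro!: mult_left_mono_neg \<eta> simp del: times_divide_eq_right)
  have "\<delta> powr (1/2) * e powr (1/2 + 1 / (2 * \<sigma>)) * e' powr (1/2) =
     exp ((a * (1 / (4 * \<sigma>)) + b * (3 / (4 * \<sigma>))) * (1/2) + a * (1/2 + 1 / (2 * \<sigma>)) + b * (1/2))"
    unfolding \<delta>e unfolding ea unfolding E unfolding exp_add ..
  also have "(a * (1 / (4 * \<sigma>)) + b * (3 / (4 * \<sigma>))) * (1/2) + a * (1/2 + 1 / (2 * \<sigma>)) + b * (1/2) =
     a * (1/2 + 1 / (2 * \<sigma>)) + b * (1/2 + 1 / (2 * \<sigma>)) + (a - b) * (1 / (8 * \<sigma>))"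
    using \<sigma> by (simp add: field_simps)
  also have "exp \<dots> \<le> R" unfolding R using c1 by simp
  finally have 1: "\<delta> powr (1/2) * e powr (1/2 + 1 / (2 * \<sigma>)) * e' powr (1/2) \<le> R" .
  have "\<delta> powr (1 - \<sigma>) * (e * e') = exp ((a * (1 / (4 * \<sigma>)) + b * (3 / (4 * \<sigma>))) * (1 - \<sigma>) + (a + b))"
    unfolding \<delta>e unfolding ea unfolding E unfolding exp_add ..
  also have "(a * (1 / (4 * \<sigma>)) + b * (3 / (4 * \<sigma>))) * (1 - \<sigma>) + (a + b) =
     a * (1/2 + 1 / (2 * \<sigma>)) + b * (1/2 + 1 / (2 * \<sigma>)) + (a - b) * ((\<sigma> - 1) / (4 * \<sigma>))"
    using \<sigma> by (simp add: field_simps)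
  also have "exp \<dots> \<le> R" unfolding R using c2 by simp
  finally have 2: "\<delta> powr (1 - \<sigma>) * (e * e') \<le> R" .
  show ?thesis using 1 2 unfolding R_def by linarith
qed

text \<open>Either the smaller level set is so small that the two weights differ geometrically, or the ratio
  of the measures provides the geometric factor.\<close>
lemma level_interaction_decay:
  fixes e e' :: real
  assumes pos: "0 < e" "0 < e'" and "0 < q" "0 < \<kappa>" "0 \<le> \<eta>" and d: "0 \<le> d"
    and a: "a = 2 powr (y + d * q) * e powr \<kappa>" and a': "a' = 2 powr y * e' powr \<kappa>"
    and g: "2 powr (- q / 2) \<le> g" "2 powr (- (q * \<eta> / (2 * \<kappa>))) \<le> g"
  shows "a * a' * (min e e' / max e e') powr \<eta> \<le> (a\<^sup>2 + a'\<^sup>2) * g powr d"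
proof -

  have a0: "0 < a" "0 < a'" using pos by (auto simp: a a')
  have le1: "(min e e' / max e e') powr \<eta> \<le> 1"
    using pos assms(5) by (intro powr_le1) (auto simp: min_def max_def)
  show ?thesis
  \<comment> \<open>The threshold spends half of the gap \<open>d * q\<close> between the weights.
    Below it \<open>a'\<close> is still smaller than \<open>a\<close> by
    \<open>2 powr (- d * q / 2)\<close>; above it \<open>e / e'\<close> is at most
    \<open>2 powr (- d * q / (2 * \<kappa>))\<close>.\<close>
  proof (cases "e' \<le> e * 2 powr (d * q / (2 * \<kappa>))")
    case True
    have "e' powr \<kappa> \<le> (e * 2 powr (d * q / (2 * \<kappa>))) powr \<kappa>"
      using True pos assms(4) by (intro powr_mono2) auto
    also have "\<dots> = e powr \<kappa> * 2 powr (d * q / 2)"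
      using pos assms(4) by (simp add: powr_mult powr_powr)
    finally have "a' \<le> 2 powr y * (e powr \<kappa> * 2 powr (d * q / 2))"
      unfolding a' by (intro mult_left_mono) auto
    also have "\<dots> = 2 powr (y + d * q + (- q / 2) * d) * e powr \<kappa>"
      by (simp add: powr_add[symmetric] mult_ac add.commute)
    also have "\<dots> = a * (2 powr (- q / 2)) powr d"
      unfolding a powr_powr powr_add by (simp add: mult_ac)
    also have "\<dots> \<le> a * g powr d"
      using a0 d g by (intro mult_left_mono powr_mono2) auto
    finally have a'_le: "a' \<le> a * g powr d" .
    have "a * a' * (min e e' / max e e') powr \<eta> \<le> a * a'"
      using a0 le1 by (intro mult_left_le) auto
    also have "\<dots> \<le> a * (a * g powr d)" using a0 a'_le by (intro mult_left_mono) auto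
    also have "\<dots> \<le> (a\<^sup>2 + a'\<^sup>2) * g powr d" by (simp add: power2_eq_square distrib_right)
    finally show ?thesis .
  next
    case False
    then have F: "e * 2 powr (d * q / (2 * \<kappa>)) < e'" by simp
    have "1 \<le> (2::real) powr (d * q / (2 * \<kappa>))" using d assms(3,4) by (intro ge_one_powr_ge_zero) auto
    then have "e * 1 \<le> e * 2 powr (d * q / (2 * \<kappa>))" using pos by (intro mult_left_mono) auto
    with F have le: "e \<le> e'" by simp
    have "e / e' \<le> 2 powr (- (d * q / (2 * \<kappa>)))"
      using F pos by (simp add: powr_minus field_simps)
    then have "(e / e') powr \<eta> \<le> (2 powr (- (d * q / (2 * \<kappa>)))) powr \<eta>"
      using pos assms(5) by (intro powr_mono2) auto
    also have "\<dots> = (2 powr (- (q * \<eta> / (2 * \<kappa>)))) powr d" unfolding powr_powr by (simp add: mult_ac)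
    also have "\<dots> \<le> g powr d" using d g by (intro powr_mono2) auto
    finally have r: "(min e e' / max e e') powr \<eta> \<le> g powr d" using le by (simp add: min_def max_def)
    have "a * a' \<le> 2 * a * a'" using a0 by simp
    also have "\<dots> \<le> a\<^sup>2 + a'\<^sup>2" by (rule sum_squares_bound)
    finally show ?thesis using a0 r by (intro mult_mono) auto
  qed
qed

lemma geometric_sum_int_le:
  fixes g :: real and A :: "int set"
  assumes g: "0 < g" "g < 1" and A: "finite A"
  shows "(\<Sum>k\<in>A. g powr \<bar>real_of_int l - real_of_int k\<bar>) \<le> 2 / (1 - g)"
proof -
  have half: "(\<Sum>k\<in>B. g powr \<bar>real_of_int l - real_of_int k\<bar>) \<le> 1 / (1 - g)"
    if B: "finite B" "inj_on (\<lambda>k. nat \<bar>l - k\<bar>) B" for B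
  proof -
    have "(\<Sum>k\<in>B. g powr \<bar>real_of_int l - real_of_int k\<bar>) = (\<Sum>k\<in>B. g ^ nat \<bar>l - k\<bar>)"
    proof (rule sum.cong[OF refl])
      fix k
      have "\<bar>real_of_int l - real_of_int k\<bar> = real (nat \<bar>l - k\<bar>)" by simp
      then show "g powr \<bar>real_of_int l - real_of_int k\<bar> = g ^ nat \<bar>l - k\<bar>" using g by (simp only: powr_realpow)
    qed
    also have "\<dots> = (\<Sum>j\<in>(\<lambda>k. nat \<bar>l - k\<bar>) ` B. g ^ j)" by (simp add: sum.reindex[OF B(2)])
    also have "\<dots> \<le> (\<Sum>j. g ^ j)"
      using g B by (intro sum_le_suminf summable_geometric) auto
    also have "\<dots> = 1 / (1 - g)" using g by (intro suminf_geometric) auto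
    finally show ?thesis .
  qed
  define B where "B = {k \<in> A. k \<le> l}"
  define D where "D = {k \<in> A. l < k}"
  have BD: "A = B \<union> D" "B \<inter> D = {}" "finite B" "finite D" using A by (auto simp: B_def D_def)
  have "(\<Sum>k\<in>A. g powr \<bar>real_of_int l - real_of_int k\<bar>) =
    (\<Sum>k\<in>B. g powr \<bar>real_of_int l - real_of_int k\<bar>) + (\<Sum>k\<in>D. g powr \<bar>real_of_int l - real_of_int k\<bar>)"
    unfolding BD(1) by (rule sum.union_disjoint) (use BD in auto)
  also have "\<dots> \<le> 1 / (1 - g) + 1 / (1 - g)"
    by (intro add_mono half BD) (auto simp: inj_on_def B_def D_def)
  finally show ?thesis by simp
qed

text \<open>Each term is at most the total, so \<open>t - 1\<close> of its \<open>t\<close> powers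
  may be replaced by powers of the total. It is applied with \<open>t = 2 * \<kappa>\<close>, which
  is at least 1.\<close>

lemma sum_powr_le_powr_sum:
  fixes s :: "'a \<Rightarrow> real"
  assumes "finite A" "\<And>i. i \<in> A \<Longrightarrow> 0 < s i" "t \<ge> 1"
  shows "(\<Sum>i\<in>A. s i powr t) \<le> (\<Sum>i\<in>A. s i) powr t"
proof (cases "A = {}")
  case False
  define S where "S = (\<Sum>i\<in>A. s i)"
  have S: "S > 0" unfolding S_def using False assms by (intro sum_pos) auto
  have "(\<Sum>i\<in>A. s i powr t) \<le> (\<Sum>i\<in>A. s i * S powr (t - 1))"
  proof (rule sum_mono)
    fix i assume i: "i \<in> A"
    have "s i \<le> S" unfolding S_def using i assms by (intro member_le_sum) (auto intro: less_imp_le)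
    then have "s i powr (t - 1) \<le> S powr (t - 1)" using assms i by (intro powr_mono2) (auto intro: less_imp_le)
    then have "s i * s i powr (t - 1) \<le> s i * S powr (t - 1)" using assms(2)[OF i] by (intro mult_left_mono) auto
    moreover have "s i * s i powr (t - 1) = s i powr t" using assms(2)[OF i] by (simp add: powr_diff)
    ultimately show "s i powr t \<le> s i * S powr (t - 1)" by simp
  qed
  also have "\<dots> = S * S powr (t - 1)" by (simp add: S_def sum_distrib_right)
  also have "\<dots> = S powr t" using S by (simp add: powr_diff)
  finally show ?thesis by (simp add: S_def)
qed simp

text \<open>Serves to choose one number of sample points that is fine enough for all finitely many
  level sets and pairs of them.\<close>

lemma finite_archimedean:
  fixes g :: "'a \<Rightarrow> real"
  assumes "finite A" "\<And>a. a \<in> A \<Longrightarrow> g a > 0"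
  obtains N :: nat where "N \<ge> 1" "\<And>a M. a \<in> A \<Longrightarrow> N \<le> M \<Longrightarrow> 1 \<le> real M * g a"
proof -
  have "\<exists>N::nat. N \<ge> 1 \<and> (\<forall>a\<in>A. \<forall>M\<ge>N. 1 \<le> real M * g a)"
    using assms
  proof (induction A rule: finite_induct)
    case empty
    show ?case by (rule exI[of _ 1]) simp
  next
    case (insert a A)
    then obtain N where N: "N \<ge> 1" "\<And>b M. b \<in> A \<Longrightarrow> M \<ge> N \<Longrightarrow> 1 \<le> real M * g b" by blast
    have ga: "g a > 0" using insert by simp
    obtain K :: nat where K: "1 / g a < real K" using reals_Archimedean2 by blast
    have "1 \<le> real M * g a" if "M \<ge> max N K" for M
    proof -
      have "1 / g a \<le> real M" using K that by simp
      then show ?thesis using ga by (simp add: pos_divide_le_eq)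
    qed
    then show ?case using N by (intro exI[of _ "max N K"]) auto
  qed
  then show ?thesis using that by blast
qed

text \<open>By symmetry the operators act on the eigenfunction, where the sample point contributes
  \<open>\<rho> ^ m\<close> times a phase, and the weight cancels the phase. All summands agree, so
  averaging costs nothing but \<open>\<rho> ^ m\<close>.\<close>

lemma integral_time_average:
  fixes u f :: "real^'n::finite \<Rightarrow> complex"
  assumes \<rho>: "0 < \<rho>" "\<rho> < 1" and u: "u \<in> L2" and f: "f \<in> L2" and N: "N \<ge> 1"
    and eig: "\<And>r. norm r < 1 \<Longrightarrow> AE x in lborel. mehler_op r u x = r ^ m * u x"
  shows "(LBINT x. u x * time_average \<rho> N (\<lambda>j. cis (- (real m * (real j / (2 * real N)))) / of_nat N) f x)
     = of_real (\<rho> ^ m) * (LBINT x. u x * f x)"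
proof -
  let ?U = "\<lambda>j. mehler_op (sample \<rho> N j)"
  define b where "b j = cis (- (real m * (real j / (2 * real N)))) / of_nat N" for j
  have sm: "norm (sample \<rho> N j) < 1" for j using \<rho> by (simp add: norm_sample)
  note um [measurable] = L2_measurable[OF u] and fm [measurable] = L2_measurable[OF f]
  have single: "(LBINT x. u x * (b j * ?U j f x)) = of_real (\<rho> ^ m) / of_nat N * (LBINT x. u x * f x)" for j
  proof -
    have "(LBINT x. u x * (b j * ?U j f x)) = b j * (LBINT x. u x * ?U j f x)"
      by (simp add: mult.left_commute)
    also have "(LBINT x. u x * ?U j f x) = (LBINT x. ?U j u x * f x)"
      by (rule mehler_op_symmetric[OF sm u f, symmetric])
    also have "\<dots> = (LBINT x. sample \<rho> N j ^ m * (u x * f x))"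
    proof (rule integral_cong_AE)
      show "AE x in lborel. ?U j u x * f x = sample \<rho> N j ^ m * (u x * f x)"
        using eig[OF sm, of j] by eventually_elim (simp add: mult.assoc)
    qed (use mehler_op_measurable[OF u] in auto)
    also have "b j * \<dots> = (b j * sample \<rho> N j ^ m) * (LBINT x. u x * f x)" by simp
    also have "b j * sample \<rho> N j ^ m = of_real (\<rho> ^ m) / of_nat N"
      by (simp add: b_def sample_def power_mult_distrib Complex.DeMoivre cis_mult)
    finally show ?thesis .
  qed
  have "(LBINT x. u x * time_average \<rho> N b f x) = (\<Sum>j<N. \<integral>x. u x * (b j * ?U j f x) \<partial>lborel)"
    unfolding time_average_def sum_distrib_left
    by (rule Bochner_Integration.integral_sum) (intro L2_mult_integrable u L2_scale mehler_op_L2 sm f)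
  also have "\<dots> = of_real (\<rho> ^ m) * (LBINT x. u x * f x)"
    unfolding single using N by simp
  finally show ?thesis by (simp add: b_def[abs_def])
qed

section \<open>Dyadic level sets and the dual function\<close>

definition level_set :: "(real^'n::finite \<Rightarrow> complex) \<Rightarrow> int \<Rightarrow> (real^'n) set" where
  "level_set u l = {x. 2 powr real_of_int l \<le> norm (u x) \<and> norm (u x) < 2 powr real_of_int (l + 1)}"

lemma level_set_finite:
  fixes u :: "real^'n::finite \<Rightarrow> complex"
  assumes u: "u \<in> L2"
  shows "level_set u l \<in> sets borel" "emeasure lborel (level_set u l) < \<infinity>"
proof -
  note [measurable] = L2_measurable[OF u]
  show m: "level_set u l \<in> sets borel" unfolding level_set_def by measurable
  have "integrable lborel (\<lambda>x. indicator (level_set u l) x :: real)"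
  proof (rule Bochner_Integration.integrable_bound)
    show "integrable lborel (\<lambda>x. (norm (u x))\<^sup>2 / (2 powr real_of_int l)\<^sup>2)"
      using L2_square_integrable[OF u] by simp
    show "AE x in lborel. norm (indicator (level_set u l) x :: real) \<le> norm ((norm (u x))\<^sup>2 / (2 powr real_of_int l)\<^sup>2)"
    proof (rule AE_I2)
      fix x
      show "norm (indicator (level_set u l) x :: real) \<le> norm ((norm (u x))\<^sup>2 / (2 powr real_of_int l)\<^sup>2)"
        by (auto simp: indicator_def level_set_def power_divide[symmetric] intro!: one_le_power)
    qed
  qed (use m in measurable)
  then show "emeasure lborel (level_set u l) < \<infinity>" using m by (simp add: integrable_indicator_iff)
qed

text \<open>A dyadic version of \<open>cnj (u x) * norm (u x) powr (p - 2)\<close>, the function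
  dual to \<open>u\<close>, cut to one level. Its pairing with \<open>u\<close> is comparable to the
  integral of \<open>norm (u x) powr p\<close> over that level.\<close>

definition level_part :: "real \<Rightarrow> (real^'n::finite \<Rightarrow> complex) \<Rightarrow> int \<Rightarrow> real^'n \<Rightarrow> complex" where
  "level_part p u l x = of_real (2 powr (real_of_int l * (p - 2)) * indicator (level_set u l) x) * cnj (u x)"

lemma bounded_supp_level_part:
  fixes u :: "real^'n::finite \<Rightarrow> complex"
  assumes u: "u \<in> L2"
  shows "bounded_supp (level_part p u l) (2 * 2 powr (real_of_int l * (p - 1))) (level_set u l)"
  unfolding bounded_supp_def
proof (intro conjI allI level_set_finite[OF u])
  note um [measurable] = L2_measurable[OF u] and lm [measurable] = level_set_finite(1)[OF u, of l]
  have [measurable]: "(\<lambda>x. cnj (u x)) \<in> borel_measurable borel" by (rule L2_measurable[OF L2_cnj[OF u]])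
  show "level_part p u l \<in> borel_measurable borel" unfolding level_part_def by measurable
  show "norm (level_part p u l x) \<le> 2 * 2 powr (real_of_int l * (p - 1)) * indicator (level_set u l) x" for x
  proof (cases "x \<in> level_set u l")
    case True
    have "2 powr (real_of_int l * (p - 2)) * norm (u x) \<le> 2 powr (real_of_int l * (p - 2)) * 2 powr real_of_int (l + 1)"
      using True by (intro mult_left_mono) (auto simp: level_set_def)
    also have "\<dots> = 2 powr (1 + real_of_int l * (p - 1))"
      by (simp add: powr_add[symmetric] algebra_simps)
    also have "\<dots> = 2 * 2 powr (real_of_int l * (p - 1))" by (simp add: powr_add)
    finally show ?thesis using True by (simp add: level_part_def norm_mult)
  qed (simp add: level_part_def)
qed simp

lemma integral_level_part:
  fixes u :: "real^'n::finite \<Rightarrow> complex"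
  assumes u: "u \<in> L2"
  shows "2 powr (real_of_int l * p) * measure lborel (level_set u l) \<le> Re (LBINT x. u x * level_part p u l x)"
proof -
  note E = level_set_finite[OF u, of l]
  have i: "integrable lborel (\<lambda>x. u x * level_part p u l x)"
    by (rule L2_mult_integrable[OF u bounded_suppD(1)[OF bounded_supp_level_part[OF u]]])
  have "2 powr (real_of_int l * p) * measure lborel (level_set u l) = (LBINT x. 2 powr (real_of_int l * p) * indicator (level_set u l) x)"
    using E by simp
  also have "\<dots> \<le> (LBINT x. Re (u x * level_part p u l x))"
  proof (rule integral_mono)
    show "integrable lborel (\<lambda>x. 2 powr (real_of_int l * p) * indicator (level_set u l) x)"
      using E by (intro integrable_mult_right) (simp add: integrable_indicator_iff)
    show "integrable lborel (\<lambda>x. Re (u x * level_part p u l x))" by (rule integrable_Re[OF i])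
    fix x
    have eq: "Re (u x * level_part p u l x) = 2 powr (real_of_int l * (p - 2)) * indicator (level_set u l) x * (norm (u x))\<^sup>2"
      unfolding level_part_def cmod_power2 by (simp add: power2_eq_square algebra_simps)
    show "2 powr (real_of_int l * p) * indicator (level_set u l) x \<le> Re (u x * level_part p u l x)"
    proof (cases "x \<in> level_set u l")
      case True
      have "2 powr (real_of_int l * p) = 2 powr (real_of_int l * (p - 2)) * (2 powr real_of_int l)\<^sup>2"
        by (simp add: power2_eq_square powr_add[symmetric] algebra_simps)
      also have "\<dots> \<le> 2 powr (real_of_int l * (p - 2)) * (norm (u x))\<^sup>2"
        using True by (intro mult_left_mono power_mono) (auto simp: level_set_def)
      finally show ?thesis unfolding eq using True by simp
    next
      case False
      then show ?thesis unfolding eq by simp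
    qed
  qed
  also have "\<dots> = Re (LBINT x. u x * level_part p u l x)" by (rule integral_Re[OF i])
  finally show ?thesis .
qed

lemma radius_exists:
  fixes m :: nat
  obtains \<rho> :: real where "0 < \<rho>" "\<rho> < 1" "1/2 \<le> \<rho> ^ 4" "1/2 \<le> \<rho> ^ m"
proof
  \<comment> \<open>The power \<open>m + 4\<close> equals 1/2, so the powers \<open>4\<close> and
    \<open>m\<close> are at least that.\<close>
  define \<rho> where "\<rho> = root (m + 4) (1/2)"
  have p: "\<rho> ^ (m + 4) = 1/2" by (simp add: \<rho>_def)
  show 0: "0 < \<rho>" "\<rho> < 1" by (auto simp: \<rho>_def)
  show "1/2 \<le> \<rho> ^ 4" "1/2 \<le> \<rho> ^ m"
    using power_decreasing[of 4 "m + 4" \<rho>] power_decreasing[of m "m + 4" \<rho>] 0 p by auto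
qed

text \<open>Duality closes on itself: the sum \<open>S\<close> is bounded by \<open>l2norm u\<close>
  times the norm of the averaged dual function, and that norm by a multiple of
  \<open>S powr (1 - 1 / p)\<close>. Since \<open>A\<close> is finite, so is \<open>S\<close>, and
  the power can be cancelled.\<close>

lemma eigenfunction_level_sum_bound:
  fixes p :: real
  assumes p: "2 < p" and n: "real CARD('n::finite) / 2 \<le> p / (p - 2)"
  shows "\<exists>K\<ge>0. \<forall>(u :: real^'n \<Rightarrow> complex) m A. u \<in> L2 \<longrightarrow>
     (\<forall>r. norm r < 1 \<longrightarrow> (AE x in lborel. mehler_op r u x = r ^ m * u x)) \<longrightarrow> finite A \<longrightarrow>
     (\<Sum>l\<in>A. 2 powr (real_of_int l * p) * measure lborel (level_set u l)) \<le> (K * l2norm u) powr p"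
proof -
  define \<sigma> where "\<sigma> = p / (p - 2)"
  have \<sigma>: "1 < \<sigma>" "real CARD('n) / 2 \<le> \<sigma>" using p n by (auto simp: \<sigma>_def)
  \<comment> \<open>The exponent produced by the bilinear estimate; the choice of \<sigma> makes it
    the reciprocal \<open>1 - 1 / p\<close> of the dual exponent.\<close>
  define \<kappa> where "\<kappa> = 1/2 + 1 / (2 * \<sigma>)"
  have \<kappa>p: "\<kappa> = 1 - 1 / p" using p by (simp add: \<kappa>_def \<sigma>_def field_simps)
  have \<kappa>: "0 < \<kappa>" "1/2 \<le> \<kappa>" "\<kappa> < 1" using \<sigma> p by (auto simp: \<kappa>_def \<kappa>p[unfolded \<kappa>_def])
  define \<eta> where "\<eta> = min (1 / (8 * \<sigma>)) ((\<sigma> - 1) / (4 * \<sigma>))"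
  have \<eta>: "0 < \<eta>" "\<eta> \<le> 1 / (8 * \<sigma>)" "\<eta> \<le> (\<sigma> - 1) / (4 * \<sigma>)" using \<sigma> by (auto simp: \<eta>_def)
  define q where "q = p - 1"
  have q: "0 < q" using p by (simp add: q_def)
  define g where "g = max (2 powr (- q / 2)) (2 powr (- (q * \<eta> / (2 * \<kappa>))))"
  have lt1: "(2::real) powr (- t) < 1" if "t > 0" for t
    using that powr_less_mono[of "- t" 0 2] by simp
  have g: "0 < g" "g < 1" "2 powr (- q / 2) \<le> g" "2 powr (- (q * \<eta> / (2 * \<kappa>))) \<le> g"
    using lt1[of "q / 2"] lt1[of "q * \<eta> / (2 * \<kappa>)"] q \<eta> \<kappa> by (auto simp: g_def less_max_iff_disj)
  define C where "C = sqrt (6 * (6 * 4 ^ CARD('n) + 2 * 2 powr \<sigma> / (\<sigma> - 1))) * 2 ^ CARD('n) + 2 * 2 powr \<sigma> / (\<sigma> - 1)"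
  have C: "C \<ge> 0" unfolding C_def using \<sigma> by (intro add_nonneg_nonneg mult_nonneg_nonneg) auto
  define K2 where "K2 = 8 * C * (4 / (1 - g))"
  have K2: "K2 \<ge> 0" using C g by (simp add: K2_def)
  have main: "(\<Sum>l\<in>A. 2 powr (real_of_int l * p) * measure lborel (level_set u l)) \<le> (2 * sqrt K2 * l2norm u) powr p"
    if u: "u \<in> L2" and eig: "\<And>r. norm r < 1 \<Longrightarrow> AE x in lborel. mehler_op r u x = r ^ m * u x" and fA: "finite A"
    for u :: "real^'n \<Rightarrow> complex" and m A
  proof -
    define e where "e l = measure lborel (level_set u l)" for l
    \<comment> \<open>Levels of measure zero contribute nothing, and the bilinear estimate requires
      positive measures.\<close>
    define B where "B = {l \<in> A. e l > 0}"
    have B: "finite B" "\<And>l. l \<in> B \<Longrightarrow> e l > 0" using fA by (auto simp: B_def)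
    define s where "s l = 2 powr (real_of_int l * p) * e l" for l
    define S where "S = (\<Sum>l\<in>B. s l)"
    have s0: "s l > 0" if "l \<in> B" for l using B(2)[OF that] by (simp add: s_def)
    have SA: "(\<Sum>l\<in>A. s l) = S"
      unfolding S_def B_def using fA
      by (intro sum.mono_neutral_right) (auto simp: s_def e_def not_less measure_le_0_iff)
    have S0: "S \<ge> 0" unfolding S_def using s0 by (intro sum_nonneg) (auto intro: less_imp_le)
    \<comment> \<open>The natural weight of level \<open>l\<close> in the Gram bound: it equals the
      height \<open>2 powr (l * q)\<close> of the dual function times
      \<open>e l powr \<kappa>\<close>.\<close>
    define a where "a l = s l powr \<kappa>" for l
    have a_eq: "a l = 2 powr (real_of_int l * q) * e l powr \<kappa>" if "l \<in> B" for l
    proof -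
      have "p * \<kappa> = q" using p by (simp add: \<kappa>p q_def field_simps)
      then show ?thesis using B(2)[OF that] by (simp add: a_def s_def powr_mult powr_powr mult.assoc)
    qed
    define dl where "dl = (\<lambda>(l, k). e l powr (1 / (4 * \<sigma>)) * e k powr (3 / (4 * \<sigma>)))"
    obtain N1 where N1: "N1 \<ge> 1" "\<And>l M. l \<in> B \<Longrightarrow> N1 \<le> M \<Longrightarrow> 1 \<le> real M * e l powr (1 / \<sigma>)"
      using finite_archimedean[OF B(1), of "\<lambda>l. e l powr (1 / \<sigma>)"] B(2) by (metis powr_gt_zero less_irrefl)
    have dlp: "dl lk > 0" if "lk \<in> B \<times> B" for lk
      using that B(2) by (auto simp: dl_def intro!: mult_pos_pos) (metis less_irrefl)+
    obtain N2 where N2: "N2 \<ge> 1" "\<And>lk M. lk \<in> B \<times> B \<Longrightarrow> N2 \<le> M \<Longrightarrow> 1 \<le> real M * dl lk"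
      using finite_archimedean[of "B \<times> B" dl] B(1) dlp by (metis finite_cartesian_product)
    define N where "N = max N1 N2"
    have N: "N \<ge> 1" using N1 by (simp add: N_def)
    obtain \<rho> :: real where \<rho>: "0 < \<rho>" "\<rho> < 1" "1/2 \<le> \<rho> ^ 4" "1/2 \<le> \<rho> ^ m"
      using radius_exists[of m] by metis
    define b where "b = (\<lambda>j. cis (- (real m * (real j / (2 * real N)))) / of_nat N)"
    have bn: "norm (b j) \<le> 1 / real N" for j by (simp add: b_def norm_divide)
    define f where "f l = level_part p u l" for l
    note bs = bounded_supp_level_part[OF u, of p, folded f_def]
    note fL = bounded_suppD(1)[OF bs]
    define V where "V l = time_average \<rho> N b (f l)" for l
    have sm: "norm (sample \<rho> N j) < 1" for j using \<rho> by (simp add: norm_sample)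
    have VL: "V l \<in> L2" for l
      unfolding V_def time_average_def[abs_def] by (intro L2_sum L2_scale mehler_op_L2 sm fL)
    let ?w = "\<lambda>l k. g powr \<bar>real_of_int l - real_of_int k\<bar>"
    let ?t = "\<lambda>l k. (min (e l) (e k) / max (e l) (e k)) powr \<eta>"
    \<comment> \<open>The 8 collects a factor 2 from each of the two heights and one from the
      optimized split.\<close>
    have gram1: "norm (L2_inner (V l) (V k)) \<le> 8 * C * (a l * a k * ?t l k)"
      if l: "l \<in> B" and k: "k \<in> B" and le: "e l \<le> e k" for l k
    proof -
      define \<delta> where "\<delta> = e l powr (1 / (4 * \<sigma>)) * e k powr (3 / (4 * \<sigma>))"
      have n1: "1 \<le> real N * e l powr (1 / \<sigma>)" by (rule N1(2)[OF l]) (simp add: N_def)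
      have n2: "1 \<le> real N * \<delta>" using N2(2)[of "(l, k)" N] l k by (simp add: N_def dl_def \<delta>_def)
      have "norm (L2_inner (V l) (V k)) \<le> C * ((2 * 2 powr (real_of_int l * (p - 1))) * (2 * 2 powr (real_of_int k * (p - 1)))) *
         (\<delta> powr (1/2) * e l powr (1/2 + 1 / (2 * \<sigma>)) * e k powr (1/2) + \<delta> powr (1 - \<sigma>) * (e l * e k))"
        unfolding V_def C_def
        by (rule time_average_bilinear_bound[OF \<rho>(1-3) \<sigma> bs _ B(2)[OF l] bs _ n1 n2 bn]) (auto simp: e_def)
      also have "\<dots> \<le> C * ((2 * 2 powr (real_of_int l * (p - 1))) * (2 * 2 powr (real_of_int k * (p - 1)))) *
         (2 * ((e l powr \<kappa> * e k powr \<kappa>) * (e l / e k) powr \<eta>))"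
        unfolding \<kappa>_def
        by (intro mult_left_mono optimized_split_bound[OF \<sigma>(1) B(2)[OF l] le \<delta>_def \<eta>(2,3)]) (use C in auto)
      also have "\<dots> = 8 * C * (a l * a k * (e l / e k) powr \<eta>)"
        unfolding a_eq[OF l] a_eq[OF k] q_def by (simp add: mult_ac)
      finally show ?thesis using le by (simp add: min_def max_def)
    qed
    have gram: "norm (L2_inner (V l) (V k)) \<le> 8 * C * ((a l)\<^sup>2 * ?w l k + (a k)\<^sup>2 * ?w l k)"
      if l: "l \<in> B" and k: "k \<in> B" for l k
    proof -
      \<comment> \<open>Conjugation symmetry lets the smaller of the two sets always take the role
        that carries the window.\<close>
      have 1: "norm (L2_inner (V l) (V k)) \<le> 8 * C * (a l * a k * ?t l k)"
      proof (cases "e l \<le> e k")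
        case True
        then show ?thesis by (rule gram1[OF l k])
      next
        case False
        then show ?thesis using gram1[OF k l]
          by (simp add: L2_inner_cnj[of "V k" "V l"] min.commute max.commute mult_ac)
      qed
      have dec: "a i * a j * (min (e i) (e j) / max (e i) (e j)) powr \<eta> \<le> ((a i)\<^sup>2 + (a j)\<^sup>2) * g powr (real_of_int i - real_of_int j)"
        if "i \<in> B" "j \<in> B" "j \<le> i" for i j
      proof (rule level_interaction_decay[OF B(2)[OF that(1)] B(2)[OF that(2)] q \<kappa>(1) less_imp_le[OF \<eta>(1)] _ _ _ g(3,4)])
        show "0 \<le> real_of_int i - real_of_int j" using that by simp
        show "a i = 2 powr (real_of_int j * q + (real_of_int i - real_of_int j) * q) * e i powr \<kappa>"
          unfolding a_eq[OF that(1)] by (simp add: algebra_simps)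
        show "a j = 2 powr (real_of_int j * q) * e j powr \<kappa>" by (rule a_eq[OF that(2)])
      qed
      have 2: "a l * a k * ?t l k \<le> ((a l)\<^sup>2 + (a k)\<^sup>2) * ?w l k"
      proof (cases "k \<le> l")
        case True
        then show ?thesis using dec[OF l k True] by simp
      next
        case False
        then show ?thesis using dec[OF k l] by (simp add: min.commute max.commute mult.commute[of "a l"] add.commute abs_if)
      qed
      have "8 * C * (a l * a k * ?t l k) \<le> 8 * C * (((a l)\<^sup>2 + (a k)\<^sup>2) * ?w l k)"
        using C by (intro mult_left_mono 2) auto
      with 1 show ?thesis by (simp add: distrib_right)
    qed
    have rowg: "(\<Sum>k\<in>B. ?w l k) \<le> 2 / (1 - g)" for l
      by (rule geometric_sum_int_le[OF g(1,2) B(1)])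
    have "(l2norm (\<lambda>x. \<Sum>l\<in>B. V l x))\<^sup>2 \<le> (\<Sum>l\<in>B. \<Sum>k\<in>B. norm (L2_inner (V l) (V k)))"
      by (rule l2norm_sum_square_le[OF VL])
    also have "\<dots> \<le> (\<Sum>l\<in>B. \<Sum>k\<in>B. 8 * C * ((a l)\<^sup>2 * ?w l k + (a k)\<^sup>2 * ?w l k))"
      by (intro sum_mono gram)
    also have "\<dots> = 8 * C * ((\<Sum>l\<in>B. \<Sum>k\<in>B. (a l)\<^sup>2 * ?w l k) +
        (\<Sum>l\<in>B. \<Sum>k\<in>B. (a k)\<^sup>2 * ?w l k))"
      by (simp only: sum_distrib_left[symmetric] sum.distrib)
    \<comment> \<open>The two halves agree after exchanging the indices; each has row sums at most
      \<open>2 / (1 - g)\<close>, whence the 4 in \<open>K2\<close>.\<close>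
    also have "(\<Sum>l\<in>B. \<Sum>k\<in>B. (a k)\<^sup>2 * ?w l k) = (\<Sum>l\<in>B. \<Sum>k\<in>B. (a l)\<^sup>2 * ?w l k)"
      by (subst sum.swap) (simp add: abs_minus_commute)
    also have "(\<Sum>l\<in>B. \<Sum>k\<in>B. (a l)\<^sup>2 * ?w l k) = (\<Sum>l\<in>B. (a l)\<^sup>2 * (\<Sum>k\<in>B. ?w l k))"
      by (simp only: sum_distrib_left)
    also have "8 * C * ((\<Sum>l\<in>B. (a l)\<^sup>2 * (\<Sum>k\<in>B. ?w l k)) + (\<Sum>l\<in>B. (a l)\<^sup>2 * (\<Sum>k\<in>B. ?w l k)))
       \<le> 8 * C * ((\<Sum>l\<in>B. (a l)\<^sup>2 * (2 / (1 - g))) + (\<Sum>l\<in>B. (a l)\<^sup>2 * (2 / (1 - g))))"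
      using C by (intro mult_left_mono add_mono sum_mono rowg) auto
    also have "\<dots> = K2 * (\<Sum>l\<in>B. (a l)\<^sup>2)"
      unfolding sum_distrib_right[symmetric] K2_def by simp
    also have "\<dots> \<le> K2 * (S powr (2 * \<kappa>))"
    proof (rule mult_left_mono[OF _ K2])
      have "(\<Sum>l\<in>B. (a l)\<^sup>2) = (\<Sum>l\<in>B. s l powr (2 * \<kappa>))"
        by (intro sum.cong refl) (simp add: a_def power2_eq_square powr_add[symmetric])
      also have "\<dots> \<le> S powr (2 * \<kappa>)"
        unfolding S_def by (rule sum_powr_le_powr_sum[OF B(1) s0]) (use \<kappa> in auto)
      finally show "(\<Sum>l\<in>B. (a l)\<^sup>2) \<le> S powr (2 * \<kappa>)" .
    qed
    also have "\<dots> = (sqrt K2 * S powr \<kappa>)\<^sup>2"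
      using K2 by (simp add: power_mult_distrib) (simp add: power2_eq_square powr_add[symmetric])
    finally have VV: "l2norm (\<lambda>x. \<Sum>l\<in>B. V l x) \<le> sqrt K2 * S powr \<kappa>"
      by (rule power2_le_imp_le) (use K2 in auto)
    have "1/2 * S \<le> \<rho> ^ m * S" using \<rho> S0 by (intro mult_right_mono) auto
    also have "S \<le> norm (\<Sum>l\<in>B. \<integral>x. u x * f l x \<partial>lborel)"
    proof -
      have "S \<le> (\<Sum>l\<in>B. Re (LBINT x. u x * f l x))"
        unfolding S_def s_def e_def f_def by (intro sum_mono integral_level_part u)
      also have "\<dots> = Re (\<Sum>l\<in>B. \<integral>x. u x * f l x \<partial>lborel)" by simp
      also have "\<dots> \<le> norm (\<Sum>l\<in>B. \<integral>x. u x * f l x \<partial>lborel)" by (rule complex_Re_le_cmod)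
      finally show ?thesis .
    qed
    also have "\<rho> ^ m * norm (\<Sum>l\<in>B. \<integral>x. u x * f l x \<partial>lborel) = norm (\<Sum>l\<in>B. of_real (\<rho> ^ m) * (LBINT x. u x * f l x))"
      unfolding sum_distrib_left[symmetric] norm_mult norm_of_real using \<rho> by simp
    also have "(\<Sum>l\<in>B. of_real (\<rho> ^ m) * (LBINT x. u x * f l x)) = (\<Sum>l\<in>B. \<integral>x. u x * V l x \<partial>lborel)"
      unfolding V_def b_def by (intro sum.cong refl integral_time_average[symmetric] \<rho> u fL N eig)
    also have "\<dots> = (LBINT x. u x * (\<Sum>l\<in>B. V l x))"
      unfolding sum_distrib_left by (rule Bochner_Integration.integral_sum[symmetric]) (intro L2_mult_integrable u VL)
    also have "norm \<dots> \<le> l2norm u * l2norm (\<lambda>x. \<Sum>l\<in>B. V l x)"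
      by (rule L2_Cauchy_Schwarz[OF u L2_sum[OF VL]])
    also have "\<dots> \<le> l2norm u * (sqrt K2 * S powr \<kappa>)" by (intro mult_left_mono VV) simp
    finally have fin: "1/2 * S \<le> l2norm u * (sqrt K2 * S powr \<kappa>)" using \<rho> by (simp add: mult_left_mono)
    \<comment> \<open>Dividing by \<open>S powr \<kappa>\<close> leaves
      \<open>S powr (1 / p)\<close>; the 2 compensates \<open>\<rho> ^ m \<ge> 1/2\<close>.\<close>
    have "S \<le> (2 * sqrt K2 * l2norm u) powr p"
    proof (cases "S = 0")
      case False
      then have S: "S > 0" using S0 by simp
      have "S = S powr (1 / p) * S powr \<kappa>" using S p by (simp add: powr_add[symmetric] \<kappa>p)
      with fin have "S powr (1 / p) * S powr \<kappa> \<le> (2 * sqrt K2 * l2norm u) * S powr \<kappa>" by (simp add: mult_ac)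
      then have "S powr (1 / p) \<le> 2 * sqrt K2 * l2norm u" using S by simp
      then have "(S powr (1 / p)) powr p \<le> (2 * sqrt K2 * l2norm u) powr p" using p by (intro powr_mono2) auto
      then show ?thesis using S p by (simp add: powr_powr)
    qed simp
    then show ?thesis using SA by (simp add: s_def e_def)
  qed
  show ?thesis by (intro exI[of _ "2 * sqrt K2"] conjI allI impI main) (use K2 in auto)
qed

text \<open>On level \<open>l\<close> the function stays below twice the lower bound of the level,
  which costs \<open>2 powr p\<close>. The levels exhaust the set where \<open>u\<close> does not
  vanish, and monotone convergence passes from finitely many levels to all.\<close>

lemma nn_integral_powr_le_level_sums:
  fixes u :: "real^'n::finite \<Rightarrow> complex" and p :: real
  assumes u: "u \<in> L2" and p: "0 < p"
    and bd: "\<And>A. finite A \<Longrightarrow> (\<Sum>l\<in>A. 2 powr (real_of_int l * p) * measure lborel (level_set u l)) \<le> M"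
  shows "(\<integral>\<^sup>+x. ennreal (norm (u x) powr p) \<partial>lborel) \<le> ennreal (2 powr p * M)"
proof -
  note [measurable] = L2_measurable[OF u] level_set_finite(1)[OF u]
  define c where "c l = 2 powr (real_of_int (l + 1) * p)" for l
  define g where "g L x = (\<Sum>l\<in>{- int L..int L}. ennreal (c l) * indicator (level_set u l) x)" for L x
  have gm: "g L \<in> borel_measurable lborel" for L unfolding g_def by measurable
  have inc: "incseq g"
    unfolding incseq_def le_fun_def g_def by (intro allI impI sum_mono2) auto
  have pt: "ennreal (norm (u x) powr p) \<le> (SUP L. g L x)" for x
  proof (cases "u x = 0")
    case False
    define l where "l = \<lfloor>log 2 (norm (u x))\<rfloor>"
    have nz: "norm (u x) > 0" using False by simp
    have e: "2 powr (log 2 (norm (u x))) = norm (u x)" using nz by simp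
    have "2 powr real_of_int l \<le> 2 powr (log 2 (norm (u x)))" unfolding l_def by (intro powr_mono) auto
    moreover have "2 powr (log 2 (norm (u x))) < 2 powr (real_of_int (l + 1))"
      unfolding l_def by (intro powr_less_mono) (auto simp: floor_correct)
    ultimately have x: "x \<in> level_set u l" unfolding e level_set_def by simp
    have "norm (u x) powr p \<le> (2 powr real_of_int (l + 1)) powr p"
      using x p by (intro powr_mono2) (auto simp: level_set_def)
    then have "ennreal (norm (u x) powr p) \<le> ennreal (c l) * indicator (level_set u l) x"
      using x by (simp add: c_def powr_powr)
    also have "\<dots> \<le> g (nat \<bar>l\<bar>) x"
      unfolding g_def by (rule member_le_sum) auto
    also have "\<dots> \<le> (SUP L. g L x)" by (rule SUP_upper) simp
    finally show ?thesis .
  qed (use p in simp)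
  have int: "(\<integral>\<^sup>+x. g L x \<partial>lborel) \<le> ennreal (2 powr p * M)" for L
  proof -
    have "(\<integral>\<^sup>+x. g L x \<partial>lborel) = (\<Sum>l\<in>{- int L..int L}. ennreal (c l) * emeasure lborel (level_set u l))"
      unfolding g_def by (subst nn_integral_sum) (auto simp: nn_integral_cmult_indicator)
    also have "\<dots> = (\<Sum>l\<in>{- int L..int L}. ennreal (c l * measure lborel (level_set u l)))"
      using level_set_finite(2)[OF u]
      by (intro sum.cong refl) (simp add: emeasure_eq_ennreal_measure ennreal_mult c_def less_top)
    also have "\<dots> = ennreal (\<Sum>l\<in>{- int L..int L}. c l * measure lborel (level_set u l))"
      by (rule sum_ennreal) (simp add: c_def)
    also have "(\<Sum>l\<in>{- int L..int L}. c l * measure lborel (level_set u l)) =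
       2 powr p * (\<Sum>l\<in>{- int L..int L}. 2 powr (real_of_int l * p) * measure lborel (level_set u l))"
    proof -
      have "c l = 2 powr p * 2 powr (real_of_int l * p)" for l
        by (simp add: c_def powr_add[symmetric] algebra_simps)
      then show ?thesis unfolding sum_distrib_left by (simp add: mult.assoc)
    qed
    also have "ennreal \<dots> \<le> ennreal (2 powr p * M)"
      by (intro ennreal_leI mult_left_mono bd) auto
    finally show ?thesis .
  qed
  have "(\<integral>\<^sup>+x. ennreal (norm (u x) powr p) \<partial>lborel) \<le> (\<integral>\<^sup>+x. (SUP L. g L x) \<partial>lborel)"
    by (rule nn_integral_mono) (rule pt)
  also have "\<dots> = (SUP L. \<integral>\<^sup>+x. g L x \<partial>lborel)"
    by (rule nn_integral_monotone_convergence_SUP[OF inc gm])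
  also have "\<dots> \<le> ennreal (2 powr p * M)" by (intro SUP_least int)
  finally show ?thesis .
qed

lemma hermite_eigenfunction_Lp_bound:
  fixes p :: real
  assumes p: "2 < p" and n: "real CARD('n::finite) / 2 \<le> p / (p - 2)"
  obtains C :: real where "C \<ge> 0"
    "\<And>k (u :: real^'n \<Rightarrow> complex). u \<in> hermite_eigenspace k \<Longrightarrow> Lp_norm (ereal p) u \<le> ennreal (C * l2norm u)"
proof -
  obtain K where K: "K \<ge> 0" "\<And>(u :: real^'n \<Rightarrow> complex) m A. u \<in> L2 \<Longrightarrow>
     (\<And>r. norm r < 1 \<Longrightarrow> AE x in lborel. mehler_op r u x = r ^ m * u x) \<Longrightarrow> finite A \<Longrightarrow>
     (\<Sum>l\<in>A. 2 powr (real_of_int l * p) * measure lborel (level_set u l)) \<le> (K * l2norm u) powr p"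
    using eigenfunction_level_sum_bound[OF assms] by blast
  have "Lp_norm (ereal p) u \<le> ennreal ((2 * K) * l2norm u)" if u: "u \<in> hermite_eigenspace k" for k and u :: "real^'n \<Rightarrow> complex"
  proof -
    have uL: "u \<in> L2" by (rule hermite_eigenspace_L2[OF u])
    obtain m where m: "\<And>(u :: real^'n \<Rightarrow> complex) r. u \<in> hermite_eigenspace k \<Longrightarrow> norm r < 1 \<Longrightarrow>
       AE x in lborel. mehler_op r u x = r ^ m * u x"
      using hermite_eigenspace_mehler_op[of k] by metis
    define I where "I = (\<integral>\<^sup>+x. ennreal (norm (u x) powr p) \<partial>lborel)"
    have "I \<le> ennreal (2 powr p * (K * l2norm u) powr p)"
      unfolding I_def by (rule nn_integral_powr_le_level_sums[OF uL _ K(2)[OF uL m[OF u]]]) (use p in auto)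
    also have "2 powr p * (K * l2norm u) powr p = (2 * (K * l2norm u)) powr p"
      using K(1) by (simp add: powr_mult)
    finally have I: "I \<le> ennreal ((2 * (K * l2norm u)) powr p)" .
    then have fin: "I \<noteq> \<infinity>" by (auto simp: top_unique)
    have "enn2real I \<le> (2 * (K * l2norm u)) powr p"
      using enn2real_mono[OF I] by simp
    then have "enn2real I powr (1 / p) \<le> ((2 * (K * l2norm u)) powr p) powr (1 / p)"
      using p by (intro powr_mono2) auto
    also have "\<dots> = 2 * (K * l2norm u)" using p K(1) by (simp add: powr_powr)
    finally have "enn2real I powr (1 / p) \<le> 2 * K * l2norm u" by simp
    then show ?thesis
      unfolding Lp_norm_def Let_def using fin by (simp add: I_def[symmetric] ennreal_leI)
  qed
  then show ?thesis using that[of "2 * K"] K(1) by simp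
qed

theorem corollary2p2:
  fixes p :: ereal
  assumes "CARD('n::finite) \<ge> 2"
    and "2 \<le> p"
    and "p \<le> (if CARD('n) = 2 then \<infinity>
              else ereal (2 * real CARD('n) / (real CARD('n) - 2)))"
    and "\<not> (CARD('n) = 2 \<and> p = \<infinity>)"
  shows "\<exists>C::real. \<forall>k\<in>hermite_spectrum TYPE('n). \<forall>\<phi>::real^'n \<Rightarrow> complex. \<phi> \<in> L2 \<longrightarrow>
           Lp_norm p (hermite_proj k \<phi>) \<le> ennreal C * Lp_norm 2 \<phi>"
proof -
  \<comment> \<open>For dimension two infinity is excluded by the last assumption, otherwise by the
    finite upper bound.\<close>
  have "p \<noteq> \<infinity>" "p \<noteq> - \<infinity>" using assms by (auto split: if_splits)
  then obtain q where q: "p = ereal q" by (cases p) auto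
  have q2: "2 \<le> q" using assms(2) unfolding q by (metis ereal_less_eq(3) numeral_eq_ereal)
  have bound: "\<exists>C\<ge>0. \<forall>k (u :: real^'n \<Rightarrow> complex). u \<in> hermite_eigenspace k \<longrightarrow> Lp_norm p u \<le> ennreal (C * l2norm u)"
  \<comment> \<open>At \<open>q = 2\<close> the rate \<open>q / (q - 2)\<close> degenerates, and the
    bound holds with equality and constant 1.\<close>
  proof (cases "q = 2")
    case True
    then have "p = 2" unfolding q by (metis numeral_eq_ereal)
    then have "Lp_norm p u \<le> ennreal (1 * l2norm u)" if "u \<in> hermite_eigenspace k" for k and u :: "real^'n \<Rightarrow> complex"
      using Lp_norm_2[OF hermite_eigenspace_L2[OF that]] by (simp only: mult_1)
    then show ?thesis by (intro exI[of _ 1]) auto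
  next
    case False
    with q2 have q2: "2 < q" by simp
    \<comment> \<open>With denominators cleared, both the upper bound on \<open>q\<close> and the
      required decay rate become this inequality; in dimension two it holds for every real
      \<open>q\<close>.\<close>
    have "real CARD('n) * (q - 2) \<le> 2 * q"
    proof (cases "CARD('n) = 2")
      case False
      with assms(1) have n: "real CARD('n) - 2 > 0" by linarith
      have "q \<le> 2 * real CARD('n) / (real CARD('n) - 2)" using assms(3) False by (simp add: q)
      then show ?thesis using n by (simp add: pos_le_divide_eq algebra_simps)
    qed simp
    then have "real CARD('n) / 2 \<le> q / (q - 2)" using q2 by (simp add: pos_le_divide_eq)
    from hermite_eigenfunction_Lp_bound[OF q2 this] show ?thesis unfolding q by metis
  qed
  then obtain C where C: "C \<ge> 0"
    "\<And>k (u :: real^'n \<Rightarrow> complex). u \<in> hermite_eigenspace k \<Longrightarrow> Lp_norm p u \<le> ennreal (C * l2norm u)" by blast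
  show ?thesis
  proof (intro exI[of _ C] ballI allI impI)
    fix k and \<phi> :: "real^'n \<Rightarrow> complex"
    assume \<phi>: "\<phi> \<in> L2"
    have "Lp_norm p (hermite_proj k \<phi>) \<le> ennreal (C * l2norm (hermite_proj k \<phi>))"
      by (rule C(2)[OF hermite_proj_eigenspace[OF \<phi>]])
    also have "\<dots> \<le> ennreal (C * l2norm \<phi>)"
      using C(1) by (intro ennreal_leI mult_left_mono l2norm_hermite_proj_le[OF \<phi>])
    also have "\<dots> = ennreal C * Lp_norm 2 \<phi>" unfolding Lp_norm_2[OF \<phi>] using C(1) by (simp add: ennreal_mult)
    finally show "Lp_norm p (hermite_proj k \<phi>) \<le> ennreal C * Lp_norm 2 \<phi>" .
  qed
qed

end
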